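(* Let $M,N,P$ be $\mathbf{W}$-modules of the class $\mathcal{S}$ with $\mathrm{Supp}\,P=\mathrm{Supp}\,M+\mathrm{Supp}\,N$; put $u=\mathrm{Supp}\,M$, $v=\mathrm{Supp}\,N$. Let $\delta_1\in\deg M$, $\delta_2\in\deg N$, $\gamma\in\deg P$. Identify $\mathcal{G}_{\mathbf{W}}(M\times N,P)$ with $\mathcal{G}_{\mathbf{W}}(\Omega^{\delta_1}_u\times\Omega^{\delta_2}_v,\Omega^\gamma_{u+v})$ through $\mathbf{W}$-equivariant isomorphisms of germs of modules. Then: (i) If $\{\delta_1,\delta_2,\gamma\}\subset\{0,1\}$, then $\dim\mathcal{G}_{\mathbf{W}}(M\times N,P)=2$; moreover, identifying the germs of $M,N,P$ with those of $\Omega^0_u,\Omega^0_v,\Omega^1_{u+v}$, the germs of $P^{0,1}_{u,v}\circ(\mathrm{id}\times d)$ and $P^{1,0}_{u,v}\circ(d\times\mathrm{id})$ form a basis of this space. (ii) If $(\delta_1,\delta_2,\gamma)\in\mathfrak{z}^*$, then $\dim\mathcal{G}_{\mathbf{W}}(M\times N,P)=1$, and a generator is given by the germ listed in the following table (for any line of the table whose triple equals $(\delta_1,\delta_2,\gamma)$): 1. $(-\frac23,-\frac23,\frac53)$: $G_{u,v}$ 2. $(0,0,3)$: $B^{1,1}_{u,v}\circ(d\times d)$ 3. $(0,-2,1)$: $d\circ B^{1,-2}_{u,v}\circ(d\times\mathrm{id})$ 4. $(-2,0,1)$: $d\circ B^{-2,1}_{u,v}\circ(\mathrm{id}\times d)$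 5. $(0,\delta,\delta+2)$: $B^{1,\delta}_{u,v}\circ(d\times\mathrm{id})$ 6. $(\delta,0,\delta+2)$: $B^{\delta,1}_{u,v}\circ(\mathrm{id}\times d)$ 7. $(\delta,-\delta-1,1)$: $d\circ B^{\delta,-\delta-1}_{u,v}$ 8. $(\delta_1,\delta_2,\delta_1+\delta_2+1)$: $B^{\delta_1,\delta_2}_{u,v}$ 9. $(\delta_1,\delta_2,\delta_1+\delta_2)$: $P^{\delta_1,\delta_2}_{u,v}$ 10. $(1,\delta,\delta)$: $P^{0,\delta}_{u,v}\circ(d^{-1}\times\mathrm{id})$ 11. $(\delta,1,\delta)$: $P^{\delta,0}_{u,v}\circ(\mathrm{id}\times d^{-1})$ 12. $(\delta,1-\delta,0)$: $d^{-1}\circ P^{\delta,1-\delta}_{u,v}$ (iii) Otherwise $\mathcal{G}_{\mathbf{W}}(M\times N,P)=0$.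
   Context: $\mathbf{W}$ is the Witt algebra with basis $L_n=z^{n+1}\frac{d}{dz}$ ($n\in\mathbb{Z}$), $[L_m,L_n]=(n-m)L_{m+n}$. For a $\mathbf{W}$-module $M$ put $M_s=\{m:L_0.m=sm\}$ and $\mathrm{Supp}\,M=\{s:M_s\neq0\}$. The class $\mathcal{S}$ consists of the $\mathbf{W}$-modules $M=\bigoplus_sM_s$ such that $\mathrm{Supp}\,M$ is exactly one $\mathbb{Z}$-coset of $\mathbb{C}$ (viewed as an element of $\mathbb{C}/\mathbb{Z}$) and $\dim M_s=1$ for $s\in\mathrm{Supp}\,M$. $\Omega^\delta_u$ ($\delta\in\mathbb{C}$, $u\in\mathbb{C}/\mathbb{Z}$) is the $\mathbf{W}$-module with basis $(e^\delta_x)_{x\in u}$ and $L_m.e^\delta_x=(m\delta+x)e^\delta_{x+m}$. Degree: for $M\in\mathcal{S}$, $\deg M=\{\delta\}$ if $M\cong\Omega^\delta_s$ for some $s$ with $\delta\in\mathbb{C}\setminus\{0,1\}$; $\deg M=\{0,1\}$ otherwise. (Known: by the Kaplansky–Santharoubane classification, the modules with degree $\{0,1\}$ are, up to isomorphism, $\Omega^0_u,\Omega^1_u$, the reducible indecomposable modules of the class $\mathcal S$, and $\mathbb{C}[z,z^{-1}]/\mathbb{C}\oplus\mathbb{C}$; and for $M\in\mathcal{S}$ with support $u$ and any $\delta\in\deg M$ there is a $\mathbf{W}$-equivariant isomorphism of germs $\mathcal{G}_{\mathbf{W}}(M)\simeq\mathcal{G}_{\mathbf{W}}(\Omega^\delta_u)$.)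 Germs. $M_{\ge x}=\bigoplus_{\Re s\ge x}M_s$ for $x\in\mathbb{R}$. The space of germs of linear maps is $\mathcal{G}(M,N)=\mathrm{Hom}(M,N)/\mathrm{Hom}^0(M,N)$, with $\mathrm{Hom}^0(M,N)$ the maps vanishing on $M_{\ge x}$ for some $x$. The space of germs of bilinear maps is $\mathcal{G}(M\times N,P)=\mathbf{B}(M\times N,P)/\mathbf{B}^0(M\times N,P)$, where $\mathbf{B}(M\times N,P)$ is the space of bilinear maps and $\mathbf{B}^0(M\times N,P)$ those vanishing on $M_{\ge x}\times N_{\ge x}$ for $x$ large. These are $\mathbf{W}$-modules via $(L.\phi)(m)=L.\phi(m)-\phi(L.m)$ and $(L.\pi)(m,n)=L.\pi(m,n)-\pi(L.m,n)-\pi(m,L.n)$; the subscript $\mathbf{W}$ denotes the subspace of $\mathbf{W}$-invariant (="equivariant") germs. $\mathbf{W}$-equivariant germs can be composed; the germ of a module $M$, denoted $\mathcal{G}_{\mathbf{W}}(M)$, is $M$ viewed in the category whose morphisms are $\mathbf{W}$-equivariant germs of linear maps, and $\mathcal{G}_{\mathbf{W}}(M\times N,P)$ depends functorially on the germs of $M,N,P$. Operators (symbols stand for their germs): $P^{\delta_1,\delta_2}_{u,v}(e^{\delta_1}_x,e^{\delta_2}_y)=e^{\delta_1+\delta_2}_{x+y}$; $B^{\delta_1,\delta_2}_{u,v}(e^{\delta_1}_x,e^{\delta_2}_y)=(\delta_2x-\delta_1y)e^{\delta_1+\delta_2+1}_{x+y}$; $d:\Omega^0_u\to\Omega^1_u$,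 $e^0_x\mapsto x\,e^1_x$; $d^{-1}$ is the germ inverse of $d$, i.e. the germ of $e^1_x\mapsto x^{-1}e^0_x$ ($x\ne0$); $G_{u,v}(e^{-2/3}_x,e^{-2/3}_y)=(x-y)(2x+y)(x+2y)e^{5/3}_{x+y}$. The set $\mathfrak{z}\subset\mathbb{C}^3$ is the union of the two planes $\gamma=\delta_1+\delta_2$ and $\gamma=\delta_1+\delta_2+1$; the six lines $\{(0,\delta,\delta+2)\}$, $\{(\delta,0,\delta+2)\}$, $\{(\delta,1,\delta)\}$, $\{(1,\delta,\delta)\}$, $\{(\delta,-1-\delta,1)\}$, $\{(\delta,1-\delta,0)\}$ ($\delta\in\mathbb{C}$); and the five points $(0,0,3)$, $(0,-2,1)$, $(-2,0,1)$, $(1,1,0)$, $(-\frac23,-\frac23,\frac53)$. $\mathfrak{z}^*$ is the set of $(\delta_1,\delta_2,\gamma)\in\mathfrak{z}$ with $\{\delta_1,\delta_2,\gamma\}\not\subset\{0,1\}$. *)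

theory Defs
  imports Complex_Main "HOL-Library.Poly_Mapping" "HOL-Library.Function_Algebras"
    "HOL-Library.Set_Algebras"
begin

section \<open>Free complex vector spaces\<close>

text \<open>Finitely supported functions \<open>'i \<Rightarrow>\<^sub>0 complex\<close> model the vector space with basis
  \<open>'i\<close>, the basis vectors being \<open>Poly_Mapping.single i 1\<close>.\<close>

definition pm_scale :: "complex \<Rightarrow> ('i \<Rightarrow>\<^sub>0 complex) \<Rightarrow> ('i \<Rightarrow>\<^sub>0 complex)" where
  "pm_scale c = Poly_Mapping.map ((*) c)"

definition pm_linear :: "('i \<Rightarrow> ('k \<Rightarrow>\<^sub>0 complex)) \<Rightarrow> ('i \<Rightarrow>\<^sub>0 complex) \<Rightarrow> ('k \<Rightarrow>\<^sub>0 complex)" where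
  "pm_linear b p = (\<Sum>i\<in>Poly_Mapping.keys p. pm_scale (Poly_Mapping.lookup p i) (b i))"

definition pm_bilinear ::
    "('i \<Rightarrow> 'j \<Rightarrow> ('k \<Rightarrow>\<^sub>0 complex)) \<Rightarrow> ('i \<Rightarrow>\<^sub>0 complex) \<Rightarrow> ('j \<Rightarrow>\<^sub>0 complex) \<Rightarrow> ('k \<Rightarrow>\<^sub>0 complex)" where
  "pm_bilinear b p q = pm_linear (\<lambda>i. pm_linear (b i) q) p"


section \<open>The Witt algebra and its modules\<close>

type_synonym witt = "int \<Rightarrow>\<^sub>0 complex"

definition L :: "int \<Rightarrow> witt" where
  "L n = Poly_Mapping.single n 1"

definition bracket :: "witt \<Rightarrow> witt \<Rightarrow> witt" where
  "bracket = pm_bilinear (\<lambda>m n. pm_scale (of_int (n - m)) (L (m + n)))"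

text \<open>A module has as underlying space a subspace \<open>vspace M\<close> of an ambient vector space; its
  operations only matter there.\<close>

record 'a wmod =
  vspace :: "'a set"
  scale :: "complex \<Rightarrow> 'a \<Rightarrow> 'a"
  act :: "witt \<Rightarrow> 'a \<Rightarrow> 'a"

text \<open>Linear maps between the underlying spaces. Values outside \<open>vspace M\<close> are arbitrary; they
  play no role, and two maps differing only there have the same germ.\<close>

definition Hom :: "'a::ab_group_add wmod \<Rightarrow> 'b::ab_group_add wmod \<Rightarrow> ('a \<Rightarrow> 'b) set" where
  "Hom M N = {f. (\<forall>m\<in>vspace M. f m \<in> vspace N) \<and>
     (\<forall>m\<in>vspace M. \<forall>m'\<in>vspace M. f (m + m') = f m + f m') \<and>
     (\<forall>c. \<forall>m\<in>vspace M. f (scale M c m) = scale N c (f m))}"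

definition witt_module :: "'a::ab_group_add wmod \<Rightarrow> bool" where
  "witt_module M \<longleftrightarrow> vector_space (scale M) \<and> module.subspace (scale M) (vspace M) \<and>
     (\<forall>X. act M X \<in> Hom M M) \<and>
     (\<forall>X Y. \<forall>m\<in>vspace M. act M (X + Y) m = act M X m + act M Y m) \<and>
     (\<forall>c X. \<forall>m\<in>vspace M. act M (pm_scale c X) m = scale M c (act M X m)) \<and>
     (\<forall>X Y. \<forall>m\<in>vspace M. act M (bracket X Y) m = act M X (act M Y m) - act M Y (act M X m))"

definition wt_space :: "'a::ab_group_add wmod \<Rightarrow> complex \<Rightarrow> 'a set" where
  "wt_space M s = {m \<in> vspace M. act M (L 0) m = scale M s m}"

definition Supp :: "'a::ab_group_add wmod \<Rightarrow> complex set" where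
  "Supp M = {s. wt_space M s \<noteq> {0}}"

definition int_cosets :: "complex set set" where
  "int_cosets = {r +o \<int> |r. True}"

text \<open>As eigenspaces for distinct eigenvalues are independent, spanning by the weight spaces
  means that \<open>M\<close> is their direct sum.\<close>

definition class_S :: "'a::ab_group_add wmod set" where
  "class_S = {M. witt_module M \<and> vspace M = module.span (scale M) (\<Union>s. wt_space M s) \<and>
     Supp M \<in> int_cosets \<and> (\<forall>s\<in>Supp M. vector_space.dim (scale M) (wt_space M s) = 1)}"

definition wmod_iso :: "'a::ab_group_add wmod \<Rightarrow> 'b::ab_group_add wmod \<Rightarrow> bool" where
  "wmod_iso M N \<longleftrightarrow> (\<exists>f\<in>Hom M N. bij_betw f (vspace M) (vspace N) \<and>
     (\<forall>X. \<forall>m\<in>vspace M. f (act M X m) = act N X (f m)))"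

text \<open>The basis vector \<open>e x\<close> stands for \<open>e\<^sup>\<delta>\<^sub>x\<close>, for every \<open>\<delta>\<close>.\<close>

definition e :: "complex \<Rightarrow> (complex \<Rightarrow>\<^sub>0 complex)" where
  "e x = Poly_Mapping.single x 1"

definition Omega :: "complex \<Rightarrow> complex set \<Rightarrow> (complex \<Rightarrow>\<^sub>0 complex) wmod" where
  "Omega \<delta> u = \<lparr> vspace = {p. Poly_Mapping.keys p \<subseteq> u}, scale = pm_scale,
     act = pm_bilinear (\<lambda>m x. pm_scale (of_int m * \<delta> + x) (e (x + of_int m))) \<rparr>"

definition Deg :: "'a::ab_group_add wmod \<Rightarrow> complex set" where
  "Deg M = (let D = {\<delta>. \<delta> \<notin> {0, 1} \<and> (\<exists>s\<in>int_cosets. wmod_iso M (Omega \<delta> s))}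
     in if D \<noteq> {} then D else {0, 1})"


section \<open>Germs\<close>

definition upper :: "'a::ab_group_add wmod \<Rightarrow> real \<Rightarrow> 'a set" where
  "upper M x = module.span (scale M) (\<Union>s\<in>{s. x \<le> Re s}. wt_space M s)"

definition Hom0 :: "'a::ab_group_add wmod \<Rightarrow> 'b::ab_group_add wmod \<Rightarrow> ('a \<Rightarrow> 'b) set" where
  "Hom0 M N = {f \<in> Hom M N. \<exists>x. \<forall>m\<in>upper M x. f m = 0}"

text \<open>The linear maps whose class modulo \<open>Hom0\<close> is invariant.\<close>

definition Hom_W :: "'a::ab_group_add wmod \<Rightarrow> 'b::ab_group_add wmod \<Rightarrow> ('a \<Rightarrow> 'b) set" where
  "Hom_W M N = {f \<in> Hom M N. \<forall>X. (\<lambda>m. act N X (f m) - f (act M X m)) \<in> Hom0 M N}"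

text \<open>The linear maps whose germ is an isomorphism in the category with morphisms the equivariant
  germs.\<close>

definition germ_iso :: "'a::ab_group_add wmod \<Rightarrow> 'b::ab_group_add wmod \<Rightarrow> ('a \<Rightarrow> 'b) set" where
  "germ_iso M N = {f \<in> Hom_W M N. \<exists>g\<in>Hom_W N M.
     (\<lambda>m. g (f m) - m) \<in> Hom0 M M \<and> (\<lambda>n. f (g n) - n) \<in> Hom0 N N}"

definition Bil :: "'a::ab_group_add wmod \<Rightarrow> 'b::ab_group_add wmod \<Rightarrow> 'c::ab_group_add wmod
    \<Rightarrow> ('a \<Rightarrow> 'b \<Rightarrow> 'c) set" where
  "Bil M N P = {\<pi>. (\<forall>m\<in>vspace M. (\<lambda>n. \<pi> m n) \<in> Hom N P) \<and> (\<forall>n\<in>vspace N. (\<lambda>m. \<pi> m n) \<in> Hom M P)}"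

definition Bil0 :: "'a::ab_group_add wmod \<Rightarrow> 'b::ab_group_add wmod \<Rightarrow> 'c::ab_group_add wmod
    \<Rightarrow> ('a \<Rightarrow> 'b \<Rightarrow> 'c) set" where
  "Bil0 M N P = {\<pi> \<in> Bil M N P. \<exists>x. \<forall>m\<in>upper M x. \<forall>n\<in>upper N x. \<pi> m n = 0}"

definition bil_act :: "'a::ab_group_add wmod \<Rightarrow> 'b::ab_group_add wmod \<Rightarrow> 'c::ab_group_add wmod
    \<Rightarrow> witt \<Rightarrow> ('a \<Rightarrow> 'b \<Rightarrow> 'c) \<Rightarrow> ('a \<Rightarrow> 'b \<Rightarrow> 'c)" where
  "bil_act M N P X \<pi> = (\<lambda>m n. act P X (\<pi> m n) - \<pi> (act M X m) n - \<pi> m (act N X n))"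

text \<open>A germ is a coset of \<open>Bil0 M N P\<close> for pointwise addition.\<close>

definition bgerm :: "'a::ab_group_add wmod \<Rightarrow> 'b::ab_group_add wmod \<Rightarrow> 'c::ab_group_add wmod
    \<Rightarrow> ('a \<Rightarrow> 'b \<Rightarrow> 'c) \<Rightarrow> ('a \<Rightarrow> 'b \<Rightarrow> 'c) set" where
  "bgerm M N P \<pi> = \<pi> +o Bil0 M N P"

definition G_W :: "'a::ab_group_add wmod \<Rightarrow> 'b::ab_group_add wmod \<Rightarrow> 'c::ab_group_add wmod
    \<Rightarrow> ('a \<Rightarrow> 'b \<Rightarrow> 'c) set set" where
  "G_W M N P = {bgerm M N P \<pi> |\<pi>. \<pi> \<in> Bil M N P \<and> (\<forall>X. bil_act M N P X \<pi> \<in> Bil0 M N P)}"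

text \<open>Linear combinations of germs in the quotient by \<open>Bil0 M N P\<close>. Adding \<open>Bil0 M N P\<close> is needed
  because a coset multiplied elementwise by \<open>0\<close>, as well as the empty sum, is \<open>{0}\<close>.\<close>

definition germ_comb :: "'a::ab_group_add wmod \<Rightarrow> 'b::ab_group_add wmod \<Rightarrow> 'c::ab_group_add wmod
    \<Rightarrow> complex list \<Rightarrow> ('a \<Rightarrow> 'b \<Rightarrow> 'c) set list \<Rightarrow> ('a \<Rightarrow> 'b \<Rightarrow> 'c) set" where
  "germ_comb M N P cs gs = Bil0 M N P +
     (\<Sum>i<length gs. (\<lambda>\<pi> m n. scale P (cs ! i) (\<pi> m n)) ` (gs ! i))"

definition is_basis_G_W :: "'a::ab_group_add wmod \<Rightarrow> 'b::ab_group_add wmod \<Rightarrow> 'c::ab_group_add wmod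
    \<Rightarrow> ('a \<Rightarrow> 'b \<Rightarrow> 'c) set list \<Rightarrow> bool" where
  "is_basis_G_W M N P gs \<longleftrightarrow> set gs \<subseteq> G_W M N P \<and>
     (\<forall>g\<in>G_W M N P. \<exists>!cs. length cs = length gs \<and> g = germ_comb M N P cs gs)"

definition dim_G_W_eq :: "'a::ab_group_add wmod \<Rightarrow> 'b::ab_group_add wmod \<Rightarrow> 'c::ab_group_add wmod
    \<Rightarrow> nat \<Rightarrow> bool" where
  "dim_G_W_eq M N P n \<longleftrightarrow> (\<exists>gs. length gs = n \<and> is_basis_G_W M N P gs)"


section \<open>The operators\<close>

type_synonym omega = "complex \<Rightarrow>\<^sub>0 complex"

definition comp2 :: "('c \<Rightarrow> 'd) \<Rightarrow> ('a' \<Rightarrow> 'b' \<Rightarrow> 'c) \<Rightarrow> ('a \<Rightarrow> 'a') \<Rightarrow> ('b \<Rightarrow> 'b') \<Rightarrow> 'a \<Rightarrow> 'b \<Rightarrow> 'd" where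
  "comp2 h \<pi> f g = (\<lambda>m n. h (\<pi> (f m) (g n)))"

text \<open>The formulas below do not depend on the cosets \<open>u\<close>, \<open>v\<close>, and that for \<open>P\<close> not even
  on the degrees: the operators are the restrictions to the relevant modules \<open>Omega\<close>.\<close>

definition op_P :: "omega \<Rightarrow> omega \<Rightarrow> omega" where
  "op_P = pm_bilinear (\<lambda>x y. e (x + y))"

definition op_B :: "complex \<Rightarrow> complex \<Rightarrow> omega \<Rightarrow> omega \<Rightarrow> omega" where
  "op_B \<delta>1 \<delta>2 = pm_bilinear (\<lambda>x y. pm_scale (\<delta>2 * x - \<delta>1 * y) (e (x + y)))"

definition op_d :: "omega \<Rightarrow> omega" where
  "op_d = pm_linear (\<lambda>x. pm_scale x (e x))"

text \<open>As \<open>inverse 0 = 0\<close>, this representative of the germ inverse of \<open>op_d\<close> sends \<open>e 0\<close> to \<open>0\<close>.\<close>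

definition op_dinv :: "omega \<Rightarrow> omega" where
  "op_dinv = pm_linear (\<lambda>x. pm_scale (inverse x) (e x))"

definition op_G :: "omega \<Rightarrow> omega \<Rightarrow> omega" where
  "op_G = pm_bilinear (\<lambda>x y. pm_scale ((x - y) * (2 * x + y) * (x + 2 * y)) (e (x + y)))"

definition zset :: "(complex \<times> complex \<times> complex) set" where
  "zset =
     {(\<delta>1, \<delta>2, \<gamma>). \<gamma> = \<delta>1 + \<delta>2} \<union> {(\<delta>1, \<delta>2, \<gamma>). \<gamma> = \<delta>1 + \<delta>2 + 1} \<union>
     {(0, \<delta>, \<delta> + 2) |\<delta>. True} \<union> {(\<delta>, 0, \<delta> + 2) |\<delta>. True} \<union>
     {(\<delta>, 1, \<delta>) |\<delta>. True} \<union> {(1, \<delta>, \<delta>) |\<delta>. True} \<union>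
     {(\<delta>, - 1 - \<delta>, 1) |\<delta>. True} \<union> {(\<delta>, 1 - \<delta>, 0) |\<delta>. True} \<union>
     {(0, 0, 3), (0, - 2, 1), (- 2, 0, 1), (1, 1, 0), (- 2 / 3, - 2 / 3, 5 / 3)}"

definition zset_star :: "(complex \<times> complex \<times> complex) set" where
  "zset_star = {(\<delta>1, \<delta>2, \<gamma>) \<in> zset. \<not> {\<delta>1, \<delta>2, \<gamma>} \<subseteq> {0, 1}}"

inductive table :: "complex \<times> complex \<times> complex \<Rightarrow> (omega \<Rightarrow> omega \<Rightarrow> omega) \<Rightarrow> bool" where
  "table (- 2 / 3, - 2 / 3, 5 / 3) op_G"
| "table (0, 0, 3) (comp2 id (op_B 1 1) op_d op_d)"
| "table (0, - 2, 1) (comp2 op_d (op_B 1 (- 2)) op_d id)"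
| "table (- 2, 0, 1) (comp2 op_d (op_B (- 2) 1) id op_d)"
| "table (0, \<delta>, \<delta> + 2) (comp2 id (op_B 1 \<delta>) op_d id)"
| "table (\<delta>, 0, \<delta> + 2) (comp2 id (op_B \<delta> 1) id op_d)"
| "table (\<delta>, - \<delta> - 1, 1) (comp2 op_d (op_B \<delta> (- \<delta> - 1)) id id)"
| "table (\<delta>1, \<delta>2, \<delta>1 + \<delta>2 + 1) (op_B \<delta>1 \<delta>2)"
| "table (\<delta>1, \<delta>2, \<delta>1 + \<delta>2) op_P"
| "table (1, \<delta>, \<delta>) (comp2 id op_P op_dinv id)"
| "table (\<delta>, 1, \<delta>) (comp2 id op_P id op_dinv)"
| "table (\<delta>, 1 - \<delta>, 0) (comp2 op_dinv op_P id id)"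

end

theory Submission
  imports Defs "HOL-Computational_Algebra.Polynomial"
begin

text \<open>
  On modules \<open>\<Omega>\<close> an equivariant germ is a function \<open>c (x, y)\<close>, for \<open>x\<close>, \<open>y\<close> far to the right, with
  \<open>(x + y + m \<gamma>) c (x, y) = (x + m \<delta>1) c (x + m, y) + (y + m \<delta>2) c (x, y + m)\<close>. By the bracket relations the
  equations for all \<open>m \<ge> 1\<close> hold on one common quadrant. Eliminating \<open>c (x, y + m)\<close> between the equations
  at \<open>(x, y)\<close> and \<open>(x, y + 1)\<close>, and then \<open>c (X - 1, y + 1)\<close> between several \<open>x\<close>, shows that \<open>c (X, y)\<close> is
  a polynomial in \<open>X\<close>, provided that \<open>\<delta>1 \<noteq> 1\<close>, \<open>\<delta>2 \<noteq> 1\<close>, \<open>\<gamma> \<noteq> 0\<close>; hence \<open>c\<close> is a polynomial in \<open>x\<close> and \<open>y\<close>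
  and the equation is an identity in \<open>x\<close>, \<open>y\<close>, \<open>m\<close>. Its part linear in \<open>m\<close> is Euler's equation, so \<open>c\<close> is homogeneous
  of degree \<open>d = \<gamma> - \<delta>1 - \<delta>2\<close>, and with \<open>c = \<Sum> b\<^sub>p x\<^sup>p y\<^sup>q / (p! q!)\<close> the rest becomes
  \<open>b\<^sub>k (i + (k - i + 1) \<delta>1) + b\<^sub>i (d - k + (k - i + 1) \<delta>2) = 0\<close> for \<open>0 \<le> i < k \<le> d\<close>, which is solved by hand.

  That a module of the class \<open>S\<close> has the germ of some \<open>\<Omega>\<^sup>\<delta>\<close> follows from the \<open>sl\<^sub>2\<close>-relation, which makes
  \<open>L\<^bsub>-1\<^esub> L\<^sub>1\<close> a quadratic polynomial \<open>(x + \<delta>) (x + 1 - \<delta>)\<close> in the weight, so that \<open>L\<^sub>1\<close> can be normalised far to the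
  right. For \<open>\<delta> \<notin> {0, 1}\<close> the normal form propagates to the left, because \<open>L\<^bsub>-k\<^esub> L\<^sub>k \<noteq> 0\<close> on each weight space for
  some \<open>k \<in> {1, 2, 3}\<close>.
\<close>

section \<open>Polynomiality of the coefficient functions\<close>

text \<open>The elimination lets \<open>m\<close> grow from fixed columns \<open>x\<close>, so it
  needs the equations for all \<open>m\<close> on one quadrant, whereas the definition of an
  invariant germ allows the bound for \<open>L m\<close> to depend on \<open>m\<close>; hence the
  reduction to \<open>m = 1\<close> and \<open>m = 2\<close>. The excluded degrees are those with
  genuine poles, along x = 0, y = 0 or x + y = 0, as the table rows with \<open>op_dinv\<close>
  show. They are avoided by multiplying \<open>c\<close> by x, y or x + y, which trades a source
  degree 1 for 0 and the target degree 0 for 1. Every equation of the final linear system involves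
  two unknowns only, so a solution is determined by b_0, or by b_1 if the first degree is 0. After
  normalisation this fails only for d = 1 and \<delta>1 = \<delta>2 = 0, where both are free: this
  is the two-dimensional space in (i). Which triples admit a solution at all is a question of
  compatibility. For nonzero degrees and d \<ge> 4 two conditions linear in \<delta>1 + \<delta>2
  combine to (d - 3) (d + 1) (d + 2) = 0, which is why the list stops at degree 3. Germs ignore
  whatever happens to the left, so the exceptional modules of degree {0, 1} need not be
  listed.\<close>

definition poly_fun :: "nat \<Rightarrow> (complex \<Rightarrow> complex) \<Rightarrow> bool" where
  "poly_fun n f \<longleftrightarrow> (\<exists>p. degree p \<le> n \<and> f = poly p)"

lemma poly_fun_const: "poly_fun n (\<lambda>x. k)"
  unfolding poly_fun_def by (intro exI[of _ "[:k:]"]) auto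

lemma poly_fun_add: "poly_fun n f \<Longrightarrow> poly_fun n g \<Longrightarrow> poly_fun n (\<lambda>x. f x + g x)"
  unfolding poly_fun_def
proof (elim exE conjE)
  fix p q assume "degree p \<le> n" "f = poly p" "degree q \<le> n" "g = poly q"
  then show "\<exists>p. degree p \<le> n \<and> (\<lambda>x. f x + g x) = poly p"
    by (intro exI[of _ "p + q"]) (auto intro: degree_add_le)
qed

lemma poly_fun_diff: "poly_fun n f \<Longrightarrow> poly_fun n g \<Longrightarrow> poly_fun n (\<lambda>x. f x - g x)"
  unfolding poly_fun_def
proof (elim exE conjE)
  fix p q assume "degree p \<le> n" "f = poly p" "degree q \<le> n" "g = poly q"
  then show "\<exists>p. degree p \<le> n \<and> (\<lambda>x. f x - g x) = poly p"
    by (intro exI[of _ "p - q"]) (auto intro: degree_diff_le)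
qed

lemma poly_fun_mult:
  assumes "poly_fun k f" "poly_fun l g" "k + l \<le> n"
  shows "poly_fun n (\<lambda>x. f x * g x)"
proof -
  obtain p q where "degree p \<le> k" "f = poly p" "degree q \<le> l" "g = poly q"
    using assms unfolding poly_fun_def by auto
  moreover have "degree (p * q) \<le> n"
    using degree_mult_le[of p q] calculation assms(3) by linarith
  ultimately show ?thesis
    unfolding poly_fun_def by (intro exI[of _ "p * q"]) auto
qed

lemma poly_fun_cmult: "poly_fun n g \<Longrightarrow> poly_fun n (\<lambda>x. k * g x)"
  by (rule poly_fun_mult[where k = 0 and l = n]) (auto intro: poly_fun_const)

lemma poly_fun_mono: "poly_fun n f \<Longrightarrow> n \<le> n' \<Longrightarrow> poly_fun n' f"
  unfolding poly_fun_def by (auto intro: order_trans)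

lemma poly_fun_shift: "poly_fun n f \<Longrightarrow> poly_fun n (\<lambda>x. f (x + t))"
  unfolding poly_fun_def
proof (elim exE conjE)
  fix p assume "degree p \<le> n" "f = poly p"
  then show "\<exists>p. degree p \<le> n \<and> (\<lambda>x. f (x + t)) = poly p"
    by (intro exI[of _ "pcompose p [:t, 1:]"])
       (auto simp: poly_pcompose degree_pcompose algebra_simps)
qed

lemma poly_fun_linear: "poly_fun 1 (\<lambda>x. k + x * l)"
  unfolding poly_fun_def by (intro exI[of _ "[:k, l:]"]) auto

text \<open>A nonzero polynomial has finitely many roots, so agreement along one arithmetic
  progression suffices. This is how relations at far lattice points become identities in complex
  variables.\<close>

lemma poly_fun_eqI:
  assumes "poly_fun n f" "poly_fun n' g" "\<And>i::nat. i \<ge> k \<Longrightarrow> f (a + of_nat i) = g (a + of_nat i)"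
  shows "f = g"
proof -
  obtain p q where p: "f = poly p" "g = poly q"
    using assms(1,2) unfolding poly_fun_def by auto
  have "inj (\<lambda>i::nat. a + of_nat i :: complex)" by (auto simp: inj_def)
  then have "infinite ((\<lambda>i::nat. a + of_nat i :: complex) ` {k..})"
    using finite_imageD[of "\<lambda>i::nat. a + of_nat i :: complex" "{k..}"]
    by (metis infinite_Ici inj_on_subset subset_UNIV)
  moreover have "(\<lambda>i::nat. a + of_nat i :: complex) ` {k..} \<subseteq> {x. poly (p - q) x = 0}"
    using assms(3) p by auto
  ultimately have "p - q = 0"
    using poly_roots_finite finite_subset by metis
  then show ?thesis using p by simp
qed

section \<open>The equivariance equation on a quadrant and its elimination\<close>

text \<open>\<open>c i j\<close> is the coefficient of a bilinear germ at \<open>(a + i, b + j)\<close>, and the equation is \<open>L\<^sub>m\<close>-equivariance.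
  Only \<open>m \<ge> 1\<close> occurs, since then no points outside the quadrant are involved.\<close>

definition sol :: "complex \<Rightarrow> complex \<Rightarrow> complex \<Rightarrow> complex \<Rightarrow> complex \<Rightarrow> (nat \<Rightarrow> nat \<Rightarrow> complex) \<Rightarrow> bool" where
  "sol \<delta>1 \<delta>2 \<gamma> a b c \<longleftrightarrow> (\<forall>m i j. 1 \<le> m \<longrightarrow>
     (a + of_nat i + (b + of_nat j) + of_nat m * \<gamma>) * c i j =
     (a + of_nat i + of_nat m * \<delta>1) * c (i + m) j + (b + of_nat j + of_nat m * \<delta>2) * c i (j + m))"

lemma solD:
  assumes "sol \<delta>1 \<delta>2 \<gamma> a b c" "1 \<le> m"
  shows "(a + of_nat i + (b + of_nat j) + of_nat m * \<gamma>) * c i j =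
     (a + of_nat i + of_nat m * \<delta>1) * c (i + m) j + (b + of_nat j + of_nat m * \<delta>2) * c i (j + m)"
  using assms unfolding sol_def by blast

lemma sol_swap: "sol \<delta>1 \<delta>2 \<gamma> a b c \<Longrightarrow> sol \<delta>2 \<delta>1 \<gamma> b a (\<lambda>i j. c j i)"
  unfolding sol_def by (metis add.commute)

text \<open>With \<open>X = x + m\<close>, eliminating \<open>c (x, y + m)\<close> between the equations for \<open>m\<close> at \<open>(x, y)\<close> and for \<open>m - 1\<close> at
  \<open>(x, y + 1)\<close> leaves a relation between \<open>c (X, y)\<close> and \<open>c (X - 1, y + 1)\<close>. The determinant \<open>elim_det\<close> of two such
  relations, divided by \<open>x - x'\<close>, is bilinear in \<open>x\<close> and \<open>x'\<close>, so that suitable differences are constant in \<open>X\<close>.\<close>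

definition elim_left where "elim_left \<delta>1 \<delta>2 x y X = (y + 1 + (X - x - 1) * \<delta>2) * (x + (X - x) * \<delta>1)" for X :: complex
definition elim_right where "elim_right \<delta>1 \<delta>2 x y X = (y + (X - x) * \<delta>2) * (x + (X - x - 1) * \<delta>1)" for X :: complex
definition elim_rhs where "elim_rhs \<delta>2 \<gamma> x y C C' X =
  (y + 1 + (X - x - 1) * \<delta>2) * (x + y + (X - x) * \<gamma>) * C - (y + (X - x) * \<delta>2) * (x + y + 1 + (X - x - 1) * \<gamma>) * C'"
  for X :: complex

lemma sol_elim:
  fixes a b :: complex
  assumes s: "sol \<delta>1 \<delta>2 \<gamma> a b c" and I: "i + 2 \<le> I"
  shows "elim_left \<delta>1 \<delta>2 (a + of_nat i) (b + of_nat j) (a + of_nat I) * c I j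
    - elim_right \<delta>1 \<delta>2 (a + of_nat i) (b + of_nat j) (a + of_nat I) * c (I - 1) (Suc j)
    = elim_rhs \<delta>2 \<gamma> (a + of_nat i) (b + of_nat j) (c i j) (c i (Suc j)) (a + of_nat I)"
proof -
  \<comment> \<open>The two steps are \<open>Suc n\<close> from row \<open>j\<close> and
    \<open>n\<close> from row \<open>Suc j\<close>; both end in the same row. The gap of 2 gives
    \<open>n \<ge> 1\<close>, as \<open>sol\<close> requires.\<close>
  obtain n where n: "I = i + Suc n" "1 \<le> n" using I by (metis Suc_eq_plus1 add_2_eq_Suc' le_Suc_ex add.assoc le_add1 add.commute)
  have 1: "(a + of_nat i + (b + of_nat j) + of_nat (Suc n) * \<gamma>) * c i j =
     (a + of_nat i + of_nat (Suc n) * \<delta>1) * c I j + (b + of_nat j + of_nat (Suc n) * \<delta>2) * c i (Suc (j + n))"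
    using solD[OF s, of "Suc n" i j] n by simp
  have 2: "(a + of_nat i + (b + of_nat (Suc j)) + of_nat n * \<gamma>) * c i (Suc j) =
     (a + of_nat i + of_nat n * \<delta>1) * c (I - 1) (Suc j) + (b + of_nat (Suc j) + of_nat n * \<delta>2) * c i (Suc (j + n))"
    using solD[OF s, of n i "Suc j"] n by simp
  show ?thesis
    unfolding elim_left_def elim_right_def elim_rhs_def using 1 2 unfolding n(1) of_nat_add of_nat_Suc by algebra
qed

text \<open>The numerator of Cramer's rule. \<open>C\<close>, \<open>C'\<close> and
  \<open>D\<close>, \<open>D'\<close> are the values in the fixed columns \<open>x\<close> and
  \<open>x'\<close> on two adjacent rows. They stay constant as \<open>X\<close> moves, so this is a
  polynomial in \<open>X\<close>.\<close>

definition elim_num where "elim_num \<delta>1 \<delta>2 \<gamma> x y C C' x' D D' X =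
  elim_rhs \<delta>2 \<gamma> x y C C' X * elim_right \<delta>1 \<delta>2 x' y X - elim_rhs \<delta>2 \<gamma> x' y D D' X * elim_right \<delta>1 \<delta>2 x y X"

lemma poly_fun_elim_num: "poly_fun 4 (elim_num \<delta>1 \<delta>2 \<gamma> x y C C' x' D D')"
proof -
  have lin: "poly_fun 2 (\<lambda>X. (k + X * l) * (k' + X * l'))" for k l k' l'
    by (rule poly_fun_mult[where k = 1 and l = 1]) (auto intro: poly_fun_linear simp del: One_nat_def)
  have 1: "poly_fun 2 (elim_right \<delta>1 \<delta>2 x y)" for x
  proof -
    have "elim_right \<delta>1 \<delta>2 x y = (\<lambda>X. ((y - x * \<delta>2) + X * \<delta>2) * ((x - (x + 1) * \<delta>1) + X * \<delta>1))"
      unfolding elim_right_def by (auto simp: algebra_simps)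
    then show ?thesis using lin by simp
  qed
  have 2: "poly_fun 2 (elim_rhs \<delta>2 \<gamma> x y C C')" for x C C'
  proof -
    have "elim_rhs \<delta>2 \<gamma> x y C C' = (\<lambda>X. C * (((y + 1 - (x + 1) * \<delta>2) + X * \<delta>2) * ((x + y - x * \<gamma>) + X * \<gamma>))
        - C' * (((y - x * \<delta>2) + X * \<delta>2) * ((x + y + 1 - (x + 1) * \<gamma>) + X * \<gamma>)))"
      unfolding elim_rhs_def by (auto simp: algebra_simps)
    then show ?thesis using poly_fun_diff[OF poly_fun_cmult[OF lin] poly_fun_cmult[OF lin]] by simp
  qed
  show ?thesis
    unfolding elim_num_def by (intro poly_fun_diff poly_fun_mult[where k = 2 and l = 2] 1 2) auto
qed

definition elim_det where "elim_det \<delta>1 \<delta>2 x x' y X =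
  elim_left \<delta>1 \<delta>2 x y X * elim_right \<delta>1 \<delta>2 x' y X - elim_left \<delta>1 \<delta>2 x' y X * elim_right \<delta>1 \<delta>2 x y X"

text \<open>Two columns give two linear equations for the same unknowns \<open>c I j\<close> and
  \<open>c (I - 1) (Suc j)\<close>; the second unknown is eliminated.\<close>

lemma sol_cramer:
  fixes a b :: complex
  assumes s: "sol \<delta>1 \<delta>2 \<gamma> a b c" and "i + 2 \<le> I" "i' + 2 \<le> I"
  shows "elim_det \<delta>1 \<delta>2 (a + of_nat i) (a + of_nat i') (b + of_nat j) (a + of_nat I) * c I j
    = elim_num \<delta>1 \<delta>2 \<gamma> (a + of_nat i) (b + of_nat j) (c i j) (c i (Suc j)) (a + of_nat i') (c i' j) (c i' (Suc j)) (a + of_nat I)"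
proof -
  have cramer: "(A * B' - A' * B) * c = R * B' - R' * B" if "A * c - B * d = R" "A' * c - B' * d = R'"
    for A B c d R A' B' R' :: complex
  proof -
    have "(A * B' - A' * B) * c = B' * (A * c) - B * (A' * c)" by (simp add: algebra_simps)
    also have "A * c = R + B * d" using that(1) by (simp add: algebra_simps)
    also have "A' * c = R' + B' * d" using that(2) by (simp add: algebra_simps)
    finally show ?thesis by (simp add: algebra_simps)
  qed
  show ?thesis
    unfolding elim_num_def elim_det_def
    using cramer[OF sol_elim[OF s assms(2), of j] sol_elim[OF s assms(3), of j]] .
qed

text \<open>Write \<open>elim_det\<close> as (x - x') B(x, x') with B of degree at most 1 in x and
  in x'. The differences x - x' are -2, -1, -3, -2, and the weights turn the left side into 6 times
  the mixed second difference of B. This is the coefficient of x x', which no longer contains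
  X.\<close>

lemma elim_det_second_diff:
  "- 3 * elim_det \<delta>1 \<delta>2 x (x + 2) y X + 6 * elim_det \<delta>1 \<delta>2 (x + 1) (x + 2) y X
   + 2 * elim_det \<delta>1 \<delta>2 x (x + 3) y X - 3 * elim_det \<delta>1 \<delta>2 (x + 1) (x + 3) y X
   = 6 * (1 - \<delta>1) * \<delta>2 * (1 - \<delta>1 - \<delta>2)"
  unfolding elim_det_def elim_left_def elim_right_def by algebra

text \<open>For \<delta>2 = 0 the mixed coefficient vanishes, but a single determinant is already
  free of \<open>X\<close>.\<close>

lemma elim_det_zero: "elim_det \<delta>1 0 x (x + 1) y X = \<delta>1 * (1 - \<delta>1) * y * (y + 1)"
  unfolding elim_det_def elim_left_def elim_right_def by algebra

text \<open>For \<delta>1 + \<delta>2 = 1 the mixed coefficient of B vanishes, and a first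
  difference isolates the coefficient of x. It retains the factor X + y, the source of a possible
  pole.\<close>

lemma elim_det_first_diff:
  "- elim_det \<delta>1 (1 - \<delta>1) x (x + 2) y X + 2 * elim_det \<delta>1 (1 - \<delta>1) (x + 1) (x + 2) y X
   = - 2 * \<delta>1 * (1 - \<delta>1) ^ 2 * (X + y)"
  unfolding elim_det_def elim_left_def elim_right_def by algebra

lemma poly_fun_divide_linear:
  assumes "poly_fun (Suc n) f" "f (- y) = 0"
  obtains g where "poly_fun n g" "\<And>x. f x = (x + y) * g x"
proof -
  obtain p where p: "degree p \<le> Suc n" "f = poly p" using assms(1) unfolding poly_fun_def by auto
  then have "poly p (- y) = 0" using assms(2) by simp
  then obtain q where q: "p = [:y, 1:] * q" by (metis dvdE minus_minus poly_eq_0_iff_dvd)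
  have "degree q \<le> n"
  proof (cases "q = 0")
    case False
    then have "degree p = Suc (degree q)" using q degree_mult_eq[of "[:y,1:]" q] by simp
    then show ?thesis using p(1) by simp
  qed simp
  then show ?thesis
    using that[of "poly q"] p(2) q unfolding poly_fun_def by (auto simp: algebra_simps)
qed

text \<open>The bound \<open>5 \<le> i\<close> leaves room for eliminating with the columns \<open>0, \<dots>, 3\<close>.\<close>

lemma sol_poly_fun_x_degenerate:
  assumes s: "sol 0 0 \<gamma> a b c" and \<gamma>: "\<gamma> \<noteq> 0"
    and nz: "a \<noteq> 0" "b + of_nat j \<noteq> 0" "\<And>i j. a + of_nat i + (b + of_nat j) \<noteq> 0"
  shows "\<exists>f. poly_fun 4 f \<and> (\<forall>i\<ge>5. c i j = f (a + of_nat i))"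
proof -
  define y where "y = b + of_nat j"
  \<comment> \<open>With \<delta>1 = \<delta>2 = 0 all determinants \<open>elim_det\<close> vanish.
    Instead \<open>c i (j + k)\<close> and \<open>c 0 (j + (i + k))\<close> are eliminated through
    column 0, which leaves a recursion in \<open>i\<close> with the inhomogeneous term
    \<open>l k\<close>, of degree 1 in the weight.\<close>
  define l where "l k X = ((y + of_nat k) * (a + y + (X - a) * \<gamma>) * c 0 j
    - y * (a + y + of_nat k + (X - a - of_nat k) * \<gamma>) * c 0 (j + k)) / a" for k X
  have pl: "poly_fun 1 (l k)" for k
  proof -
    have *: "(y + of_nat k) * (a + y + (X - a) * \<gamma>) * c 0 j - y * (a + y + of_nat k + (X - a - of_nat k) * \<gamma>) * c 0 (j + k)
      = ((y + of_nat k) * (a + y - a * \<gamma>) * c 0 j - y * (a + y + of_nat k - (a + of_nat k) * \<gamma>) * c 0 (j + k))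
      + X * ((y + of_nat k) * \<gamma> * c 0 j - y * \<gamma> * c 0 (j + k))" for X
      by algebra
    show ?thesis
      unfolding l_def * divide_inverse mult.commute[of _ "inverse a"]
      by (rule poly_fun_cmult[OF poly_fun_linear])
  qed
  have step: "(a + of_nat i + y + of_nat k) * c (i + k) j = (a + of_nat i + y + of_nat k * \<gamma>) * c i j + l k (a + of_nat (i + k))"
    if "1 \<le> k" "1 \<le> i" for i k
  proof -
    have 1: "(a + y + of_nat (i + k) * \<gamma>) * c 0 j = a * c (i + k) j + y * c 0 (j + (i + k))"
      using solD[OF s, of "i + k" 0 j] that unfolding y_def by simp
    have 2: "(a + (y + of_nat k) + of_nat i * \<gamma>) * c 0 (j + k) = a * c i (j + k) + (y + of_nat k) * c 0 (j + (i + k))"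
      using solD[OF s, of "i" 0 "j + k"] that unfolding y_def by (simp add: add_ac)
    have 3: "(a + of_nat i + y + of_nat k * \<gamma>) * c i j = (a + of_nat i) * c (i + k) j + y * c i (j + k)"
      using solD[OF s, of k i j] that unfolding y_def by simp
    have 4: "a * l k (a + of_nat (i + k)) = (y + of_nat k) * (a + y + of_nat (i + k) * \<gamma>) * c 0 j
      - y * (a + y + of_nat k + of_nat i * \<gamma>) * c 0 (j + k)"
      unfolding l_def using nz(1) by simp
    have "a * ((a + of_nat i + y + of_nat k) * c (i + k) j) = a * ((a + of_nat i + y + of_nat k * \<gamma>) * c i j + l k (a + of_nat (i + k)))"
      using 1 2 3 4 by algebra
    then show ?thesis using nz(1) by simp
  qed
  show ?thesis
  proof (cases "\<gamma> = 1")
    case False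
    \<comment> \<open>Comparing two steps \<open>k = 1\<close> with one step \<open>k = 2\<close>
      leaves \<open>c i j\<close> with the factor \<gamma> (\<gamma> - 1), so that it can be solved
      for.\<close>
    define f where "f X = (1 / (\<gamma> * (\<gamma> - 1))) * ((X + y + 1) * l 2 (X + 2) - (X + y + 1) * l 1 (X + 2) - (X + y + 1 + \<gamma>) * l 1 (X + 1))" for X
    have lin: "poly_fun 1 (\<lambda>X. X + k)" for k
      using poly_fun_linear[of k 1] by (simp add: add.commute)
    have "poly_fun 4 f"
      unfolding f_def add.assoc
      by (intro poly_fun_cmult poly_fun_diff poly_fun_mult[where k = 1 and l = 1] lin poly_fun_shift pl) auto
    moreover have "c i j = f (a + of_nat i)" if "i \<ge> 5" for i
    proof -
      define x where "x = a + of_nat i"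
      have 1: "(x + y + 1) * c (i + 1) j = (x + y + \<gamma>) * c i j + l 1 (x + 1)"
        using step[of 1 i] that unfolding x_def by (simp add: add_ac)
      have 2: "(x + y + 2) * c (i + 2) j = (x + y + 1 + \<gamma>) * c (i + 1) j + l 1 (x + 2)"
        using step[of 1 "i + 1"] that unfolding x_def by (simp add: add_ac)
      have 3: "(x + y + 2) * c (i + 2) j = (x + y + 2 * \<gamma>) * c i j + l 2 (x + 2)"
        using step[of 2 i] that unfolding x_def by (simp add: add_ac)
      have "\<gamma> * (\<gamma> - 1) * c i j = (x + y + 1) * l 2 (x + 2) - (x + y + 1) * l 1 (x + 2) - (x + y + 1 + \<gamma>) * l 1 (x + 1)"
        using 1 2 3 by algebra
      then show ?thesis unfolding f_def x_def[symmetric] using False \<gamma> by (simp add: field_simps)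
    qed
    ultimately show ?thesis by blast
  next
    case True
    have lin: "poly_fun 1 (\<lambda>X. X + k)" for k
      using poly_fun_linear[of k 1] by (simp add: add.commute)
    \<comment> \<open>For \<gamma> = 1 the values of \<open>c\<close> cancel in the same comparison
      and a relation between \<open>l 1\<close> and \<open>l 2\<close> remains. At
      \<open>- y - 1\<close> it gives \<open>l 1 (- y) = 0\<close>, so the recursion can be divided
      by its common factor and \<open>c\<close> grows by a constant \<open>h\<close>.\<close>
    have "(\<lambda>x. (x + (y + 2)) * l 1 (x + 1)) = (\<lambda>x. (x + (y + 1)) * (l 2 (x + 2) - l 1 (x + 2)))"
    proof (rule poly_fun_eqI)
      show "poly_fun 2 (\<lambda>x. (x + (y + 2)) * l 1 (x + 1))"
        by (intro poly_fun_mult[where k = 1 and l = 1] lin poly_fun_shift pl) auto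
      show "poly_fun 2 (\<lambda>x. (x + (y + 1)) * (l 2 (x + 2) - l 1 (x + 2)))"
        by (intro poly_fun_mult[where k = 1 and l = 1] poly_fun_diff lin poly_fun_shift pl) auto
      fix i :: nat assume that: "i \<ge> 1"
      define x where "x = a + of_nat i"
      have 1: "(x + y + 1) * c (i + 1) j = (x + y + 1) * c i j + l 1 (x + 1)"
        using step[of 1 i] that True unfolding x_def by (simp add: add_ac)
      have 2: "(x + y + 2) * c (i + 2) j = (x + y + 2) * c (i + 1) j + l 1 (x + 2)"
        using step[of 1 "i + 1"] that True unfolding x_def by (simp add: add_ac)
      have 3: "(x + y + 2) * c (i + 2) j = (x + y + 2) * c i j + l 2 (x + 2)"
        using step[of 2 i] that True unfolding x_def by (simp add: add_ac)
      show "(x + (y + 2)) * l 1 (x + 1) = (x + (y + 1)) * (l 2 (x + 2) - l 1 (x + 2))"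
        using 1 2 3 by algebra
    qed
    from fun_cong[OF this, of "- y - 1"] have "l 1 (- y) = 0" by simp
    then obtain g where g: "poly_fun 0 g" "\<And>x. l 1 x = (x + y) * g x"
      using poly_fun_divide_linear[of 0 "l 1" y] pl[of 1] by auto
    then obtain h where h: "\<And>x. g x = h"
      unfolding poly_fun_def by (auto elim!: degree_eq_zeroE)
    have "c (i + 1) j = c i j + h" if "i \<ge> 1" for i
    proof -
      have "(a + of_nat i + y + 1) * c (i + 1) j = (a + of_nat i + y + 1) * (c i j + h)"
        using step[of 1 i] that True g(2) h by (simp add: algebra_simps)
      moreover have "a + of_nat i + y + 1 \<noteq> 0"
        using nz(3)[of "i + 1" j] unfolding y_def by (simp add: add_ac)
      ultimately show ?thesis by simp
    qed
    then have c: "c (i + 1) j = c 1 j + of_nat i * h" for i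
      by (induction i) (auto simp: algebra_simps)
    have "c i j = (c 1 j - (a + 1) * h) + (a + of_nat i) * h" if "i \<ge> 5" for i
      using c[of "i - 1"] that by (simp add: algebra_simps of_nat_diff)
    moreover have "poly_fun 4 (\<lambda>X. (c 1 j - (a + 1) * h) + X * h)"
      by (rule poly_fun_mono[OF poly_fun_linear]) simp
    ultimately show ?thesis by blast
  qed
qed

text \<open>The quantity that has to be nonzero depends on the degrees: the mixed difference of
  determinants unless \<delta>2 (1 - \<delta>1 - \<delta>2) vanishes, the determinant itself for
  \<delta>2 = 0, the first difference for \<delta>2 = 1 - \<delta>1, and a separate recursion if
  both degrees are 0. The bound 4 is the same for all rows, as the later interpolation
  requires.\<close>

lemma sol_poly_fun_x:
  assumes s: "sol \<delta>1 \<delta>2 \<gamma> a b c" and \<delta>: "\<delta>1 \<noteq> 1" "\<delta>2 \<noteq> 1" "\<gamma> \<noteq> 0"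
    and nz: "a \<noteq> 0" "\<And>j. b + of_nat j \<noteq> 0" "\<And>i j. a + of_nat i + (b + of_nat j) \<noteq> 0"
  shows "\<exists>f. poly_fun 4 f \<and> (\<forall>i\<ge>5. c i j = f (a + of_nat i))"
proof -
  define N where "N j i i' = elim_num \<delta>1 \<delta>2 \<gamma> (a + of_nat i) (b + of_nat j) (c i j) (c i (Suc j))
    (a + of_nat i') (c i' j) (c i' (Suc j))" for i i' j
  have N: "elim_det \<delta>1 \<delta>2 (a + of_nat i) (a + of_nat i') (b + of_nat j) (a + of_nat I) * c I j = N j i i' (a + of_nat I)"
    if "5 \<le> I" "i \<le> 3" "i' \<le> 3" for I i i' j
    unfolding N_def by (rule sol_cramer[OF s]) (use that in auto)
  have pN: "poly_fun 4 (N j i i')" for i i' j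
    unfolding N_def by (rule poly_fun_elim_num)
  consider "\<delta>1 = 0" "\<delta>2 = 0" | "\<delta>2 = 0" "\<delta>1 \<noteq> 0" | "\<delta>2 \<noteq> 0" "\<delta>1 + \<delta>2 \<noteq> 1" | "\<delta>2 \<noteq> 0" "\<delta>2 = 1 - \<delta>1"
    by (metis add_diff_cancel_left')
  then show ?thesis
  proof cases
    case 1
    then show ?thesis using sol_poly_fun_x_degenerate assms by blast
  next
    case 2
    define k where "k = \<delta>1 * (1 - \<delta>1) * (b + of_nat j) * (b + of_nat j + 1)"
    have "k \<noteq> 0" using 2 \<delta> nz(2)[of j] nz(2)[of "Suc j"] unfolding k_def by (simp add: add_ac)
    moreover have "k * c I j = N j 0 1 (a + of_nat I)" if "5 \<le> I" for I
      using N[of I 0 1 j] that 2 elim_det_zero[of \<delta>1 a "b + of_nat j"] unfolding k_def by simp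
    ultimately have "c I j = 1 / k * N j 0 1 (a + of_nat I)" if "5 \<le> I" for I
      using that by (simp add: eq_divide_eq mult.commute)
    then show ?thesis using poly_fun_cmult[OF pN] by blast
  next
    case 3
    define k where "k = 6 * (1 - \<delta>1) * \<delta>2 * (1 - \<delta>1 - \<delta>2)"
    have "1 - \<delta>1 - \<delta>2 \<noteq> 0" using 3 by (metis add.commute diff_add_cancel diff_diff_eq eq_iff_diff_eq_0)
    then have k0: "k \<noteq> 0" using 3 \<delta> unfolding k_def by simp
    define f where "f X = 1 / k * ((6 * N j 1 2 X + 2 * N j 0 3 X) - (3 * N j 0 2 X + 3 * N j 1 3 X))" for X
    have "poly_fun 4 f"
      unfolding f_def by (intro poly_fun_cmult poly_fun_diff poly_fun_add pN)
    moreover have "c I j = f (a + of_nat I)" if "5 \<le> I" for I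
    proof -
      have "k * c I j = (6 * N j 1 2 (a + of_nat I) + 2 * N j 0 3 (a + of_nat I)) - (3 * N j 0 2 (a + of_nat I) + 3 * N j 1 3 (a + of_nat I))"
      proof -
        have e: "elim_det \<delta>1 \<delta>2 a (a + 2) (b + of_nat j) (a + of_nat I) * c I j = N j 0 2 (a + of_nat I)"
          "elim_det \<delta>1 \<delta>2 (a + 1) (a + 2) (b + of_nat j) (a + of_nat I) * c I j = N j 1 2 (a + of_nat I)"
          "elim_det \<delta>1 \<delta>2 a (a + 3) (b + of_nat j) (a + of_nat I) * c I j = N j 0 3 (a + of_nat I)"
          "elim_det \<delta>1 \<delta>2 (a + 1) (a + 3) (b + of_nat j) (a + of_nat I) * c I j = N j 1 3 (a + of_nat I)"
          using N[OF that, of 0 2 j] N[OF that, of 1 2 j] N[OF that, of 0 3 j] N[OF that, of 1 3 j] by simp_all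
        have comb: "(- 3 * A + 6 * B + 2 * C - 3 * D) * z = (6 * (B * z) + 2 * (C * z)) - (3 * (A * z) + 3 * (D * z))"
          for A B C D z :: complex by (simp add: algebra_simps)
        show ?thesis
          unfolding k_def elim_det_second_diff[of \<delta>1 \<delta>2 a "b + of_nat j" "a + of_nat I", symmetric] comb e ..
      qed
      then show ?thesis unfolding f_def using k0 by (simp add: eq_divide_eq mult.commute)
    qed
    ultimately show ?thesis by blast
  next
    case 4
    \<comment> \<open>Here \<open>c\<close> may have a pole on the line \<open>x + y = 0\<close>, which \<open>\<gamma> \<noteq> 0\<close> excludes.\<close>
    define k where "k = - 2 * \<delta>1 * (1 - \<delta>1) ^ 2"
    have k0: "k \<noteq> 0" using 4 \<delta> unfolding k_def by auto
    define n where "n j X = 1 / k * (2 * N j 1 2 X - N j 0 2 X)" for j X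
    have pn: "poly_fun 4 (n j)" for j
      unfolding n_def by (intro poly_fun_cmult poly_fun_diff poly_fun_add pN)
    have n: "n j (a + of_nat I) = (a + of_nat I + (b + of_nat j)) * c I j" if "5 \<le> I" for I j
    proof -
      have "k * (a + of_nat I + (b + of_nat j)) * c I j = 2 * N j 1 2 (a + of_nat I) - N j 0 2 (a + of_nat I)"
      proof -
        have e: "elim_det \<delta>1 (1 - \<delta>1) a (a + 2) (b + of_nat j) (a + of_nat I) * c I j = N j 0 2 (a + of_nat I)"
          "elim_det \<delta>1 (1 - \<delta>1) (a + 1) (a + 2) (b + of_nat j) (a + of_nat I) * c I j = N j 1 2 (a + of_nat I)"
          using N[OF that, of 0 2 j] N[OF that, of 1 2 j] 4(2) by simp_all
        have comb: "(- A + 2 * B) * z = 2 * (B * z) - A * z"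
          for A B z :: complex by (simp add: algebra_simps)
        show ?thesis
          unfolding k_def elim_det_first_diff[of \<delta>1 a "b + of_nat j" "a + of_nat I", symmetric] comb e ..
      qed
      then show ?thesis unfolding n_def using k0 by (simp add: field_simps)
    qed
    define y where "y = b + of_nat j"
    have lin: "poly_fun 1 (\<lambda>X. X + k)" for k
      using poly_fun_linear[of k 1] by (simp add: add.commute)
    \<comment> \<open>The equation for \<open>m = 1\<close>, multiplied by (x + y) (x + y + 1) so
      that only the polynomials \<open>n\<close> occur. At x = - y the right side vanishes and
      \<gamma> times \<open>n j (- y)\<close> remains on the left.\<close>
    have "(\<lambda>x. (x + (y + \<gamma>)) * ((x + (y + 1)) * n j x)) =
      (\<lambda>x. (x + \<delta>1) * ((x + y) * n j (x + 1)) + (y + \<delta>2) * ((x + y) * n (Suc j) x))"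
    proof (rule poly_fun_eqI)
      have 1: "poly_fun 5 (\<lambda>x. (x + u) * n j' (x + t))" for u j' t
        by (intro poly_fun_mult[where k = 1 and l = 4] lin poly_fun_shift pn) auto
      show "poly_fun 6 (\<lambda>x. (x + (y + \<gamma>)) * ((x + (y + 1)) * n j x))"
        using poly_fun_mult[OF lin 1[of "y + 1" j 0], of 6 "y + \<gamma>"] by simp
      show "poly_fun 6 (\<lambda>x. (x + \<delta>1) * ((x + y) * n j (x + 1)) + (y + \<delta>2) * ((x + y) * n (Suc j) x))"
        using poly_fun_add[OF poly_fun_mult[OF lin 1[of "y" j 1], of 6 "\<delta>1"] poly_fun_cmult[OF poly_fun_mono[OF 1[of y "Suc j" 0], of 6], of "y + \<delta>2"]]
        by simp
      fix i :: nat assume that: "i \<ge> 5"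
      define x where "x = a + of_nat i"
      have 1: "n j x = (x + y) * c i j" using n that unfolding x_def y_def by simp
      have 2: "n j (x + 1) = (x + 1 + y) * c (Suc i) j" using n[of "Suc i" j] that unfolding x_def y_def by (simp add: add_ac)
      have 3: "n (Suc j) x = (x + (y + 1)) * c i (Suc j)" using n[of i "Suc j"] that unfolding x_def y_def by (simp add: add_ac)
      have 4: "(x + y + \<gamma>) * c i j = (x + \<delta>1) * c (Suc i) j + (y + \<delta>2) * c i (Suc j)"
        using solD[OF s, of 1 i j] unfolding x_def y_def by simp
      show "(x + (y + \<gamma>)) * ((x + (y + 1)) * n j x) =
        (x + \<delta>1) * ((x + y) * n j (x + 1)) + (y + \<delta>2) * ((x + y) * n (Suc j) x)"
        unfolding 1 2 3 using 4 by algebra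
    qed
    from fun_cong[OF this, of "- y"] have "n j (- y) = 0" using \<delta>(3) by simp
    then obtain g where g: "poly_fun 3 g" "\<And>x. n j x = (x + y) * g x"
      using poly_fun_divide_linear[of 3 "n j" y] pn[of j] by (auto simp: numeral_eq_Suc)
    have "c I j = g (a + of_nat I)" if "5 \<le> I" for I
      using n[OF that, of j] g(2)[of "a + of_nat I"] nz(3)[of I j] unfolding y_def by simp
    then show ?thesis using poly_fun_mono[OF g(1), of 4] by auto
  qed
qed

section \<open>Interpolation in two variables\<close>

lemma poly_fun_sum: "finite S \<Longrightarrow> (\<And>k. k \<in> S \<Longrightarrow> poly_fun n (f k)) \<Longrightarrow> poly_fun n (\<lambda>x. \<Sum>k\<in>S. f k x)"
  by (induction S rule: finite_induct) (auto intro: poly_fun_const poly_fun_add)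

lemma poly_fun_coeffs:
  assumes "poly_fun n f"
  obtains k where "\<And>x. f x = (\<Sum>p\<le>n. k p * x ^ p)"
proof -
  obtain P where P: "degree P \<le> n" "f = poly P" using assms unfolding poly_fun_def by auto
  have "poly P x = (\<Sum>p\<le>n. coeff P p * x ^ p)" for x
    unfolding poly_altdef using P(1)
    by (intro sum.mono_neutral_left) (auto simp: coeff_eq_0)
  then show ?thesis using that P(2) by blast
qed

lemma poly_fun_power: "poly_fun p (\<lambda>x. x ^ p)"
  unfolding poly_fun_def by (intro exI[of _ "monom 1 p"]) (auto simp: poly_monom degree_monom_eq)

lemma lagrange_basis:
  fixes t :: "nat \<Rightarrow> complex"
  assumes "inj t"
  obtains l where "\<And>k. k \<le> N \<Longrightarrow> poly_fun N (l k)"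
    "\<And>k n. k \<le> N \<Longrightarrow> n \<le> N \<Longrightarrow> l k (t n) = (if n = k then 1 else 0)"
proof
  define P where "P k = (\<Prod>n\<in>{..N} - {k}. [:- t n, 1:])" for k
  define l where "l k x = 1 / poly (P k) (t k) * poly (P k) x" for k x
  show "poly_fun N (l k)" if "k \<le> N" for k
  proof -
    have "degree (P k) \<le> (\<Sum>n\<in>{..N} - {k}. degree [:- t n, 1:])"
      unfolding P_def using degree_prod_sum_le[of "{..N} - {k}" "\<lambda>n. [:- t n, 1:]"] by (simp add: o_def)
    also have "\<dots> = N" using that by simp
    finally have "poly_fun N (poly (P k))" unfolding poly_fun_def by blast
    then show ?thesis unfolding l_def by (rule poly_fun_cmult)
  qed
  show "l k (t n) = (if n = k then 1 else 0)" if "k \<le> N" "n \<le> N" for k n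
    using that assms unfolding l_def P_def poly_prod by (auto simp: prod_zero_iff inj_def)
qed

lemma poly_fun_lagrange:
  assumes "inj (t :: nat \<Rightarrow> complex)" "\<And>k. k \<le> N \<Longrightarrow> poly_fun N (l k)"
    "\<And>k n. k \<le> N \<Longrightarrow> n \<le> N \<Longrightarrow> l k (t n) = (if n = k then 1 else 0)" "poly_fun N f"
  shows "f x = (\<Sum>k\<le>N. f (t k) * l k x)"
proof -
  have "poly_fun N (\<lambda>x. \<Sum>k\<le>N. f (t k) * l k x)"
    by (intro poly_fun_sum poly_fun_cmult assms) auto
  then obtain q where q: "degree q \<le> N" "(\<lambda>x. \<Sum>k\<le>N. f (t k) * l k x) = poly q"
    unfolding poly_fun_def by auto
  obtain p where p: "degree p \<le> N" "f = poly p" using assms(4) unfolding poly_fun_def by auto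
  have c: "card (t ` {..N}) = Suc N" using assms(1) by (simp add: card_image inj_on_subset)
  have "p = q"
  proof (rule poly_eqI_degree[of "t ` {..N}"])
    fix x assume "x \<in> t ` {..N}"
    then obtain n where n: "n \<le> N" "x = t n" by auto
    have "poly q x = (\<Sum>k\<le>N. f (t k) * l k (t n))" unfolding q(2)[symmetric] n(2) ..
    also have "\<dots> = (\<Sum>k\<le>N. if k = n then f (t k) else 0)"
      by (rule sum.cong) (use assms(3) n in auto)
    also have "\<dots> = f (t n)" using n by simp
    finally show "poly p x = poly q x" using p(2) n(2) by simp
  qed (use p q c in auto)
  then show ?thesis using p(2) fun_cong[OF q(2), of x] by simp
qed

text \<open>Lagrange interpolation in x at N + 1 columns from \<open>k\<close> on: the interpolated
  values are entries of fixed columns, hence polynomials in y. A common degree bound is essential,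
  because the same nodes must serve every row.\<close>

lemma jointly_polynomial:
  fixes c :: "nat \<Rightarrow> nat \<Rightarrow> complex"
  assumes "\<And>j. \<exists>f. poly_fun N f \<and> (\<forall>i\<ge>k. c i j = f (a + of_nat i))"
    and "\<And>i. \<exists>f. poly_fun N f \<and> (\<forall>j\<ge>k. c i j = f (b + of_nat j))"
  obtains f where "\<And>p q. p > N \<or> q > N \<Longrightarrow> f p q = 0"
    "\<And>i j. k \<le> i \<Longrightarrow> k \<le> j \<Longrightarrow> c i j = (\<Sum>p\<le>N. \<Sum>q\<le>N. f p q * (a + of_nat i) ^ p * (b + of_nat j) ^ q)"
proof -
  obtain F where F: "\<And>j. poly_fun N (F j)" "\<And>i j. i \<ge> k \<Longrightarrow> c i j = F j (a + of_nat i)"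
    using assms(1) by metis
  obtain G where G: "\<And>i. poly_fun N (G i)" "\<And>i j. j \<ge> k \<Longrightarrow> c i j = G i (b + of_nat j)"
    using assms(2) by metis
  define t where "t n = a + of_nat (k + n)" for n
  have t: "inj t" unfolding t_def by (auto simp: inj_def)
  obtain l where l: "\<And>n. n \<le> N \<Longrightarrow> poly_fun N (l n)"
    "\<And>m n. m \<le> N \<Longrightarrow> n \<le> N \<Longrightarrow> l m (t n) = (if n = m then 1 else 0)"
    using lagrange_basis[OF t, of N] by blast
  have "\<exists>K. \<forall>x. l n x = (\<Sum>p\<le>N. K p * x ^ p)" if "n \<le> N" for n
    using poly_fun_coeffs[OF l(1)[OF that]] by metis
  then obtain K where K: "\<And>n x. n \<le> N \<Longrightarrow> l n x = (\<Sum>p\<le>N. K n p * x ^ p)" by metis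
  have "\<exists>K. \<forall>x. G n x = (\<Sum>p\<le>N. K p * x ^ p)" for n
    using poly_fun_coeffs[OF G(1)] by metis
  then obtain H where H: "\<And>n x. G n x = (\<Sum>p\<le>N. H n p * x ^ p)" by metis
  define f where "f p q = (if p > N \<or> q > N then 0 else \<Sum>n\<le>N. K n p * H (k + n) q)" for p q
  show ?thesis
  proof (rule that[of f])
    fix i j assume ij: "k \<le> i" "k \<le> j"
    define x where "x = a + of_nat i"
    define y where "y = b + of_nat j"
    have "c i j = F j x" using F ij unfolding x_def by blast
    also have "\<dots> = (\<Sum>n\<le>N. F j (t n) * l n x)"
      by (rule poly_fun_lagrange[OF t l F(1)])
    also have "\<dots> = (\<Sum>n\<le>N. G (k + n) y * l n x)"
    proof (rule sum.cong)
      fix n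
      have "F j (t n) = G (k + n) y" using F(2)[of "k + n" j] G(2)[OF ij(2), of "k + n"] unfolding t_def y_def by simp
      then show "F j (t n) * l n x = G (k + n) y * l n x" by simp
    qed simp
    also have "\<dots> = (\<Sum>n\<le>N. (\<Sum>p\<le>N. K n p * x ^ p) * (\<Sum>q\<le>N. H (k + n) q * y ^ q))"
      by (rule sum.cong) (use K H in auto)
    also have "\<dots> = (\<Sum>n\<le>N. \<Sum>p\<le>N. \<Sum>q\<le>N. (K n p * H (k + n) q) * x ^ p * y ^ q)"
      unfolding sum_product by (intro sum.cong refl) (simp add: mult_ac)
    also have "\<dots> = (\<Sum>p\<le>N. \<Sum>n\<le>N. \<Sum>q\<le>N. (K n p * H (k + n) q) * x ^ p * y ^ q)"
      by (rule sum.swap)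
    also have "\<dots> = (\<Sum>p\<le>N. \<Sum>q\<le>N. \<Sum>n\<le>N. (K n p * H (k + n) q) * x ^ p * y ^ q)"
      by (intro sum.cong refl sum.swap)
    also have "\<dots> = (\<Sum>p\<le>N. \<Sum>q\<le>N. f p q * x ^ p * y ^ q)"
      by (intro sum.cong refl) (simp add: f_def sum_distrib_right)
    finally show "c i j = (\<Sum>p\<le>N. \<Sum>q\<le>N. f p q * (a + of_nat i) ^ p * (b + of_nat j) ^ q)"
      unfolding x_def y_def .
  qed (auto simp: f_def)
qed

text \<open>The expansion in powers of \<open>m\<close>, summed over the full square of exponents;
  the added terms have p + r > N and vanish. Fixed ranges allow coefficients to be compared one by
  one.\<close>

lemma poly_translate:
  fixes x m :: complex
  assumes "\<And>p. p > N \<Longrightarrow> g p = 0"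
  shows "(\<Sum>p\<le>N. g p * (x + m) ^ p) = (\<Sum>r\<le>N. (\<Sum>p\<le>N. g (p + r) * of_nat ((p + r) choose r) * x ^ p) * m ^ r)"
proof -
  have "(\<Sum>p\<le>N. g p * (x + m) ^ p) = (\<Sum>k\<le>N. \<Sum>i\<le>k. g k * (of_nat (k choose i) * m ^ i * x ^ (k - i)))"
    by (subst add.commute) (simp add: binomial_ring sum_distrib_left)
  also have "\<dots> = (\<Sum>k\<le>N. \<Sum>i\<le>k. (\<lambda>r p. g (p + r) * of_nat ((p + r) choose r) * x ^ p * m ^ r) i (k - i))"
    by (intro sum.cong refl) simp
  also have "\<dots> = (\<Sum>(r, p)\<in>{(i, j). i + j \<le> N}. g (p + r) * of_nat ((p + r) choose r) * x ^ p * m ^ r)"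
    by (rule sum.triangle_reindex_eq[symmetric])
  also have "\<dots> = (\<Sum>(r, p)\<in>{..N} \<times> {..N}. g (p + r) * of_nat ((p + r) choose r) * x ^ p * m ^ r)"
    by (rule sum.mono_neutral_left) (auto, metis assms add.commute not_le)
  also have "\<dots> = (\<Sum>r\<le>N. \<Sum>p\<le>N. g (p + r) * of_nat ((p + r) choose r) * x ^ p * m ^ r)"
    by (rule sum.cartesian_product[symmetric])
  finally show ?thesis by (simp add: sum_distrib_right)
qed

lemma sum_shift_power:
  fixes x :: complex
  assumes "g 0 = 0" "g (Suc N) = 0"
  shows "x * (\<Sum>p\<le>N. g (Suc p) * x ^ p) = (\<Sum>p\<le>N. g p * x ^ p)"
proof -
  have "(\<Sum>p\<le>N. g p * x ^ p) = (\<Sum>p\<le>Suc N. g p * x ^ p)" using assms by simp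
  also have "\<dots> = x * (\<Sum>p\<le>N. g (Suc p) * x ^ p)"
    unfolding sum.atMost_Suc_shift using assms(1) by (simp add: sum_distrib_left mult_ac)
  finally show ?thesis by simp
qed

lemma double_sum_coeffs_zero:
  fixes k :: "nat \<Rightarrow> nat \<Rightarrow> complex"
  assumes "\<And>x y. (\<Sum>p\<le>N. \<Sum>q\<le>N. k p q * x ^ p * y ^ q) = 0" "p \<le> N" "q \<le> N"
  shows "k p q = 0"
proof -
  have "(\<Sum>q\<le>N. k p q * y ^ q) = 0" for y
  proof -
    have "(\<Sum>p\<le>N. (\<Sum>q\<le>N. k p q * y ^ q) * x ^ p) = 0" for x
      using assms(1)[of x y] by (simp add: sum_distrib_left mult_ac)
    then show ?thesis using polyfun_eq_0[where n = N and c = "\<lambda>p. \<Sum>q\<le>N. k p q * y ^ q"] assms(2) by blast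
  qed
  then show ?thesis using polyfun_eq_0[where n = N and c = "k p"] assms(3) by blast
qed

section \<open>From lattice points to a polynomial identity and its coefficients\<close>

text \<open>The variables are freed one at a time: m at a lattice point, then x on a lattice row,
  then y. Each time both sides are polynomials that agree along an arithmetic progression.\<close>

lemma sol_identity:
  fixes a b :: complex
  assumes s: "sol \<delta>1 \<delta>2 \<gamma> a b c"
    and c: "\<And>i j. k \<le> i \<Longrightarrow> k \<le> j \<Longrightarrow> c i j = F (a + of_nat i) (b + of_nat j)"
    and F: "\<And>y. poly_fun N (\<lambda>x. F x y)" "\<And>x. poly_fun N (F x)"
  shows "(x + y + m * \<gamma>) * F x y = (x + m * \<delta>1) * F (x + m) y + (y + m * \<delta>2) * F x (y + m)"
proof -
  have lin: "poly_fun 1 (\<lambda>m. u + m * v)" for u v by (rule poly_fun_linear)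
  have lin': "poly_fun 1 (\<lambda>x. x + v)" for v using poly_fun_linear[of v 1] by (simp add: add.commute)
  have F': "poly_fun N (\<lambda>m. F (x + m) y)" "poly_fun N (\<lambda>m. F x (y + m))" "poly_fun N (\<lambda>x. F (x + m) y)" "poly_fun N (\<lambda>y. F x (y + m))" for x y m
    using poly_fun_shift[OF F(1)[of y], of x] poly_fun_shift[OF F(2)[of x], of y]
      poly_fun_shift[OF F(1)[of y], of m] poly_fun_shift[OF F(2)[of x], of m]
    by (simp_all add: add.commute)
  have m1: "poly_fun 1 g \<Longrightarrow> poly_fun N h \<Longrightarrow> poly_fun (N + 1) (\<lambda>x. g x * h x)" for g h
    by (rule poly_fun_mult) auto
  have m0: "poly_fun N h \<Longrightarrow> poly_fun (N + 1) (\<lambda>x. u * h x)" for u h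
    by (rule poly_fun_mono[OF poly_fun_cmult]) auto
  have 1: "(x + y + m * \<gamma>) * F x y = (x + m * \<delta>1) * F (x + m) y + (y + m * \<delta>2) * F x (y + m)"
    if "x = a + of_nat i" "y = b + of_nat j" "k \<le> i" "k \<le> j" for x y m i j
  proof -
    have "(\<lambda>m. (x + y + m * \<gamma>) * F x y) = (\<lambda>m. (x + m * \<delta>1) * F (x + m) y + (y + m * \<delta>2) * F x (y + m))"
    proof (rule poly_fun_eqI[where a = 0])
      show "poly_fun (N + 1) (\<lambda>m. (x + m * \<delta>1) * F (x + m) y + (y + m * \<delta>2) * F x (y + m))"
        by (rule poly_fun_add[OF m1[OF lin F'(1)] m1[OF lin F'(2)]])
      show "poly_fun 1 (\<lambda>m. (x + y + m * \<gamma>) * F x y)"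
        by (rule poly_fun_mult[OF lin poly_fun_const[of 0]]) simp
      fix n :: nat assume "1 \<le> n"
      then show "(x + y + (0 + of_nat n) * \<gamma>) * F x y = (x + (0 + of_nat n) * \<delta>1) * F (x + (0 + of_nat n)) y + (y + (0 + of_nat n) * \<delta>2) * F x (y + (0 + of_nat n))"
        using solD[OF s, of n i j] c[of i j] c[of "i + n" j] c[of i "j + n"] that by (simp add: add.assoc)
    qed
    from fun_cong[OF this, of m] show ?thesis .
  qed
  have 2: "(x + y + m * \<gamma>) * F x y = (x + m * \<delta>1) * F (x + m) y + (y + m * \<delta>2) * F x (y + m)"
    if "y = b + of_nat j" "k \<le> j" for x y m j
  proof -
    have "(\<lambda>x. (x + (y + m * \<gamma>)) * F x y) = (\<lambda>x. (x + m * \<delta>1) * F (x + m) y + (y + m * \<delta>2) * F x (y + m))"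
    proof (rule poly_fun_eqI[where a = a and k = k])
      show "poly_fun (N + 1) (\<lambda>x. (x + m * \<delta>1) * F (x + m) y + (y + m * \<delta>2) * F x (y + m))"
        by (rule poly_fun_add[OF m1[OF lin' F'(3)] m0[OF F(1)]])
      show "poly_fun (N + 1) (\<lambda>x. (x + (y + m * \<gamma>)) * F x y)"
        by (rule m1[OF lin' F(1)])
    qed (use 1[OF _ that(1) _ that(2)] in \<open>auto simp: add.assoc\<close>)
    from fun_cong[OF this, of x] show ?thesis by (simp add: add.assoc)
  qed
  have "(\<lambda>y. (y + (x + m * \<gamma>)) * F x y) = (\<lambda>y. (x + m * \<delta>1) * F (x + m) y + (y + m * \<delta>2) * F x (y + m))"
  proof (rule poly_fun_eqI[where a = b and k = k])
    show "poly_fun (N + 1) (\<lambda>y. (x + m * \<delta>1) * F (x + m) y + (y + m * \<delta>2) * F x (y + m))"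
      by (rule poly_fun_add[OF m0[OF F(2)] m1[OF lin' F'(4)]])
    show "poly_fun (N + 1) (\<lambda>y. (y + (x + m * \<gamma>)) * F x y)"
      by (rule m1[OF lin' F(2)])
    fix i :: nat assume "k \<le> i"
    then show "(b + of_nat i + (x + m * \<gamma>)) * F x (b + of_nat i) =
      (x + m * \<delta>1) * F (x + m) (b + of_nat i) + (b + of_nat i + m * \<delta>2) * F x (b + of_nat i + m)"
      using 2[OF refl, of i x m] by (simp only: add_ac)
  qed
  from fun_cong[OF this, of y] show ?thesis by (simp add: add_ac)
qed

lemma coefficients_of_identity:
  fixes f :: "nat \<Rightarrow> nat \<Rightarrow> complex"
  assumes supp: "\<And>p q. p > N \<or> q > N \<Longrightarrow> f p q = 0"
    and F: "\<And>x y. F x y = (\<Sum>p\<le>N. \<Sum>q\<le>N. f p q * x ^ p * y ^ q)"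
    and E: "\<And>x y m. (x + y + m * \<gamma>) * F x y = (x + m * \<delta>1) * F (x + m) y + (y + m * \<delta>2) * F x (y + m)"
  shows "f (p + r) q * (of_nat ((p + r) choose Suc r) + \<delta>1 * of_nat ((p + r) choose r))
    + f p (q + r) * (of_nat ((q + r) choose Suc r) + \<delta>2 * of_nat ((q + r) choose r)) = (if r = 0 then \<gamma> * f p q else 0)"
proof -
  define A where "A r x y = (\<Sum>p\<le>N. \<Sum>q\<le>N. f (p + r) q * of_nat ((p + r) choose r) * x ^ p * y ^ q)" for r x y
  define B where "B r x y = (\<Sum>p\<le>N. \<Sum>q\<le>N. f p (q + r) * of_nat ((q + r) choose r) * x ^ p * y ^ q)" for r x y
  have A: "F (x + m) y = (\<Sum>r\<le>N. A r x y * m ^ r)" for x y m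
  proof -
    have "F (x + m) y = (\<Sum>q\<le>N. (\<Sum>p\<le>N. f p q * (x + m) ^ p) * y ^ q)"
      unfolding F by (subst sum.swap) (simp add: sum_distrib_right)
    also have "\<dots> = (\<Sum>q\<le>N. (\<Sum>r\<le>N. (\<Sum>p\<le>N. f (p + r) q * of_nat ((p + r) choose r) * x ^ p) * m ^ r) * y ^ q)"
      by (subst poly_translate) (auto simp: supp)
    also have "\<dots> = (\<Sum>r\<le>N. \<Sum>q\<le>N. (\<Sum>p\<le>N. f (p + r) q * of_nat ((p + r) choose r) * x ^ p) * m ^ r * y ^ q)"
      by (subst sum.swap) (simp add: sum_distrib_right)
    also have "\<dots> = (\<Sum>r\<le>N. A r x y * m ^ r)"
    proof (intro sum.cong refl)
      fix r
      show "(\<Sum>q\<le>N. (\<Sum>p\<le>N. f (p + r) q * of_nat ((p + r) choose r) * x ^ p) * m ^ r * y ^ q) = A r x y * m ^ r"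
        unfolding A_def by (subst sum.swap) (simp add: sum_distrib_right sum_distrib_left mult_ac)
    qed
    finally show ?thesis .
  qed
  have B: "F x (y + m) = (\<Sum>r\<le>N. B r x y * m ^ r)" for x y m
  proof -
    have "F x (y + m) = (\<Sum>p\<le>N. (\<Sum>q\<le>N. f p q * (y + m) ^ q) * x ^ p)"
      unfolding F by (simp add: sum_distrib_left mult_ac)
    also have "\<dots> = (\<Sum>p\<le>N. (\<Sum>r\<le>N. (\<Sum>q\<le>N. f p (q + r) * of_nat ((q + r) choose r) * y ^ q) * m ^ r) * x ^ p)"
      by (subst poly_translate) (auto simp: supp)
    also have "\<dots> = (\<Sum>r\<le>N. \<Sum>p\<le>N. (\<Sum>q\<le>N. f p (q + r) * of_nat ((q + r) choose r) * y ^ q) * m ^ r * x ^ p)"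
      by (subst sum.swap) (simp add: sum_distrib_right)
    also have "\<dots> = (\<Sum>r\<le>N. B r x y * m ^ r)"
      unfolding B_def by (intro sum.cong refl) (simp add: sum_distrib_left mult_ac)
    finally show ?thesis .
  qed
  have AN: "A (Suc N) x y = 0" "B (Suc N) x y = 0" for x y unfolding A_def B_def by (simp_all add: supp)
  have A0: "A 0 x y = F x y" "B 0 x y = F x y" for x y unfolding A_def B_def F by simp_all
  \<comment> \<open>\<open>K x y r\<close> is the coefficient of the power r + 1 of m. The terms
    without m cancel because \<open>A 0\<close>, \<open>B 0\<close> and \<open>F\<close> coincide,
    so the identity is divisible by m.\<close>
  define K where "K x y r = x * A (Suc r) x y + \<delta>1 * A r x y + (y * B (Suc r) x y + \<delta>2 * B r x y) - (if r = 0 then \<gamma> * F x y else 0)" for x y r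
  have K: "K x y r = 0" if "r \<le> N" for x y r
  proof -
    have "(\<Sum>r\<le>Suc N. (case r of 0 \<Rightarrow> 0 | Suc r \<Rightarrow> K x y r) * m ^ r) = 0" for m
    proof -
      have a: "(\<Sum>r\<le>N. A r x y * m ^ r) = F x y + m * (\<Sum>r\<le>N. A (Suc r) x y * m ^ r)"
        using sum.atMost_Suc_shift[where g = "\<lambda>r. A r x y * m ^ r" and n = N] by (simp add: AN A0 sum_distrib_left mult_ac)
      have b: "(\<Sum>r\<le>N. B r x y * m ^ r) = F x y + m * (\<Sum>r\<le>N. B (Suc r) x y * m ^ r)"
        using sum.atMost_Suc_shift[where g = "\<lambda>r. B r x y * m ^ r" and n = N] by (simp add: AN A0 sum_distrib_left mult_ac)
      have alg: "m * (x * SA' + \<delta>1 * SA + (y * SB' + \<delta>2 * SB) - \<gamma> * Z) = 0"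
        if "SA = Z + m * SA'" "SB = Z + m * SB'" "(x + y + m * \<gamma>) * Z = (x + m * \<delta>1) * SA + (y + m * \<delta>2) * SB"
        for SA SA' SB SB' Z :: complex using that by algebra
      have "m * (x * (\<Sum>r\<le>N. A (Suc r) x y * m ^ r) + \<delta>1 * (\<Sum>r\<le>N. A r x y * m ^ r)
        + (y * (\<Sum>r\<le>N. B (Suc r) x y * m ^ r) + \<delta>2 * (\<Sum>r\<le>N. B r x y * m ^ r)) - \<gamma> * F x y) = 0"
        by (rule alg[OF a b]) (use E[of x y m] in \<open>simp only: A B\<close>)
      moreover have "(\<Sum>r\<le>N. (if r = 0 then \<gamma> * F x y else 0) * m ^ r) = \<gamma> * F x y"
      proof -
        have "(\<Sum>r\<le>N. (if r = 0 then \<gamma> * F x y else 0) * m ^ r) = (\<Sum>r\<le>N. if r = 0 then \<gamma> * F x y else 0)"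
          by (rule sum.cong) auto
        then show ?thesis by simp
      qed
      moreover have "(\<Sum>r\<le>Suc N. (case r of 0 \<Rightarrow> 0 | Suc r \<Rightarrow> K x y r) * m ^ r) = m * (\<Sum>r\<le>N. K x y r * m ^ r)"
        unfolding sum.atMost_Suc_shift by (simp add: sum_distrib_left mult_ac)
      moreover have "(\<Sum>r\<le>N. K x y r * m ^ r) = x * (\<Sum>r\<le>N. A (Suc r) x y * m ^ r) + \<delta>1 * (\<Sum>r\<le>N. A r x y * m ^ r)
        + (y * (\<Sum>r\<le>N. B (Suc r) x y * m ^ r) + \<delta>2 * (\<Sum>r\<le>N. B r x y * m ^ r)) - (\<Sum>r\<le>N. (if r = 0 then \<gamma> * F x y else 0) * m ^ r)"
        unfolding K_def by (simp only: distrib_right left_diff_distrib sum.distrib sum_subtractf sum_distrib_left mult.assoc)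
      ultimately show ?thesis by simp
    qed
    then have "(case Suc r of 0 \<Rightarrow> 0 | Suc r \<Rightarrow> K x y r) = 0"
      using polyfun_eq_0[where n = "Suc N" and c = "\<lambda>r. case r of 0 \<Rightarrow> 0 | Suc r \<Rightarrow> K x y r"] that Suc_le_mono by blast
    then show ?thesis by simp
  qed
  \<comment> \<open>The factor x shifts the exponent p by one, so that the terms with
    \<open>A (Suc r)\<close> and \<open>A r\<close> share their monomials. Nothing is lost at p = 0,
    where \<open>r choose Suc r\<close> is 0.\<close>
  have xA: "x * A (Suc r) x y = (\<Sum>p\<le>N. \<Sum>q\<le>N. f (p + r) q * of_nat ((p + r) choose Suc r) * x ^ p * y ^ q)" for x y r
  proof -
    have "x * (\<Sum>p\<le>N. (\<Sum>q\<le>N. f (Suc p + r) q * of_nat ((Suc p + r) choose Suc r) * y ^ q) * x ^ p)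
      = (\<Sum>p\<le>N. (\<Sum>q\<le>N. f (p + r) q * of_nat ((p + r) choose Suc r) * y ^ q) * x ^ p)"
      by (rule sum_shift_power[where g = "\<lambda>p. \<Sum>q\<le>N. f (p + r) q * of_nat ((p + r) choose Suc r) * y ^ q"]) (auto simp: supp intro!: sum.neutral)
    then show ?thesis unfolding A_def by (simp add: sum_distrib_left mult_ac)
  qed
  have yB: "y * B (Suc r) x y = (\<Sum>p\<le>N. \<Sum>q\<le>N. f p (q + r) * of_nat ((q + r) choose Suc r) * x ^ p * y ^ q)" for x y r
  proof -
    have *: "y * (\<Sum>q\<le>N. f p (Suc q + r) * of_nat ((Suc q + r) choose Suc r) * y ^ q)
      = (\<Sum>q\<le>N. f p (q + r) * of_nat ((q + r) choose Suc r) * y ^ q)" for p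
      by (rule sum_shift_power[where g = "\<lambda>q. f p (q + r) * of_nat ((q + r) choose Suc r)"]) (auto simp: supp)
    have "y * B (Suc r) x y = (\<Sum>p\<le>N. x ^ p * (y * (\<Sum>q\<le>N. f p (Suc q + r) * of_nat ((Suc q + r) choose Suc r) * y ^ q)))"
      unfolding B_def by (simp add: sum_distrib_left mult_ac)
    then show ?thesis unfolding * by (simp add: sum_distrib_left mult_ac)
  qed
  consider "p > N \<or> q > N \<or> r > N" | "p \<le> N" "q \<le> N" "r \<le> N" by linarith
  then show ?thesis
  proof cases
    case 1
    then have "f (p + r) q = 0" "f p (q + r) = 0" "r = 0 \<Longrightarrow> f p q = 0" by (auto intro!: supp)
    then show ?thesis by simp
  next
    case 2
    define k where "k p q = f (p + r) q * (of_nat ((p + r) choose Suc r) + \<delta>1 * of_nat ((p + r) choose r))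
      + f p (q + r) * (of_nat ((q + r) choose Suc r) + \<delta>2 * of_nat ((q + r) choose r)) - (if r = 0 then \<gamma> * f p q else 0)" for p q
    have *: "(\<Sum>p\<le>N. \<Sum>q\<le>N. k p q * x ^ p * y ^ q) = 0" for x y
    proof -
      have "(\<Sum>p\<le>N. \<Sum>q\<le>N. k p q * x ^ p * y ^ q) = K x y r"
        unfolding K_def xA yB unfolding A_def B_def F k_def
        by (cases "r = 0") (simp_all add: sum_distrib_left algebra_simps sum.distrib sum_subtractf)
      then show ?thesis using K 2 by simp
    qed
    have "k p q = 0" by (rule double_sum_coeffs_zero[where N = N and k = k]) (use 2 * in simp_all)
    then show ?thesis unfolding k_def by simp
  qed
qed

section \<open>The linear system for the coefficients\<close>

text \<open>For \<open>c = \<Sum> f p q x\<^sup>p y\<^sup>q\<close> these are the coefficients of \<open>x\<^sup>p y\<^sup>q m\<^bsup>r + 1\<^esup>\<close> in the equivariance equation.\<close>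

definition coeff_system :: "complex \<Rightarrow> complex \<Rightarrow> complex \<Rightarrow> (nat \<Rightarrow> nat \<Rightarrow> complex) \<Rightarrow> bool" where
  "coeff_system \<delta>1 \<delta>2 \<gamma> f \<longleftrightarrow> (\<forall>p q r.
     f (p + r) q * (of_nat ((p + r) choose Suc r) + \<delta>1 * of_nat ((p + r) choose r))
     + f p (q + r) * (of_nat ((q + r) choose Suc r) + \<delta>2 * of_nat ((q + r) choose r))
     = (if r = 0 then \<gamma> * f p q else 0))"

lemma coeff_system_comb:
  assumes "coeff_system \<delta>1 \<delta>2 \<gamma> f" "coeff_system \<delta>1 \<delta>2 \<gamma> g"
  shows "coeff_system \<delta>1 \<delta>2 \<gamma> (\<lambda>p q. f p q - k * g p q)"
  unfolding coeff_system_def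
proof (intro allI)
  fix p q r
  have lin: "(f1 - k * g1) * u + (f2 - k * g2) * v = (f1 * u + f2 * v) - k * (g1 * u + g2 * v)" for f1 g1 f2 g2 u v
    by (simp add: algebra_simps)
  show "(f (p + r) q - k * g (p + r) q) * (of_nat ((p + r) choose Suc r) + \<delta>1 * of_nat ((p + r) choose r))
     + (f p (q + r) - k * g p (q + r)) * (of_nat ((q + r) choose Suc r) + \<delta>2 * of_nat ((q + r) choose r))
     = (if r = 0 then \<gamma> * (f p q - k * g p q) else 0)"
    unfolding lin using assms unfolding coeff_system_def by (simp add: algebra_simps)
qed

lemma coeff_system_swap:
  "coeff_system \<delta>1 \<delta>2 \<gamma> f \<Longrightarrow> coeff_system \<delta>2 \<delta>1 \<gamma> (\<lambda>p q. f q p)"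
  unfolding coeff_system_def by (simp add: add.commute)

lemma coeff_system_degree:
  assumes "coeff_system \<delta>1 \<delta>2 \<gamma> f" "f p q \<noteq> 0"
  shows "\<gamma> = \<delta>1 + \<delta>2 + of_nat (p + q)"
proof -
  have "f p q * (of_nat p + \<delta>1) + f p q * (of_nat q + \<delta>2) = \<gamma> * f p q"
    using assms(1)[unfolded coeff_system_def, rule_format, of p 0 q] by simp
  then have "f p q * (\<delta>1 + \<delta>2 + of_nat (p + q) - \<gamma>) = 0" by (simp add: algebra_simps)
  then show ?thesis using assms(2) by simp
qed

text \<open>The equation for r = k - i at the monomial x^i y^(d - k) involves only the coefficients
  of x^k y^(d - k) and x^i y^(d - i). The factorials in \<open>b\<close> absorb the binomial
  coefficients.\<close>

lemma coeff_system_pair: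
  assumes "coeff_system \<delta>1 \<delta>2 \<gamma> f" "i < k" "k \<le> d"
  defines "b \<equiv> \<lambda>p. f p (d - p) * fact p * fact (d - p)"
  shows "b k * (of_nat i + (of_nat k - of_nat i + 1) * \<delta>1)
    + b i * (of_nat d - of_nat k + (of_nat k - of_nat i + 1) * \<delta>2) = 0"
proof -
  obtain r where r: "k = i + r" "0 < r" using assms(2) less_imp_add_positive by blast
  obtain q where q: "d = k + q" using assms(3) le_Suc_ex by blast
  have absorb: "of_nat ((n + r) choose Suc r) * of_nat (Suc r) = (of_nat ((n + r) choose r) * of_nat n :: complex)" for n
  proof -
    have "((n + r) choose Suc r) * Suc r = ((n + r) choose r) * n"
      using binomial_absorb_comp[of "n + r" r] binomial_absorption[of r "n + r"] by (simp add: mult.commute)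
    then show ?thesis unfolding of_nat_mult[symmetric] by (rule arg_cong)
  qed
  have fct: "fact (n + r) = (of_nat ((n + r) choose r) * fact r * fact n :: complex)" for n
  proof -
    have "fact (n + r) = ((n + r) choose r) * fact r * fact n"
      using binomial_fact_lemma[of r "n + r"] by (simp add: mult_ac)
    then have "of_nat (fact (n + r)) = (of_nat (((n + r) choose r) * fact r * fact n) :: complex)" by (rule arg_cong)
    then show ?thesis by simp
  qed
  have E: "f (i + r) q * (of_nat ((i + r) choose Suc r) + \<delta>1 * of_nat ((i + r) choose r))
     + f i (q + r) * (of_nat ((q + r) choose Suc r) + \<delta>2 * of_nat ((q + r) choose r)) = 0"
    using assms(1) r(2) unfolding coeff_system_def by simp
  \<comment> \<open>Multiplied by r! i! q! (r + 1): the factor r + 1 makes the first binomial a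
    multiple of the second by \<open>absorb\<close>, and the factorials combine to
    \<open>b k\<close> and \<open>b i\<close> by \<open>fct\<close>.\<close>
  have "(fact r * fact i * fact q * of_nat (Suc r)) * (f (i + r) q * (of_nat ((i + r) choose Suc r) + \<delta>1 * of_nat ((i + r) choose r))
     + f i (q + r) * (of_nat ((q + r) choose Suc r) + \<delta>2 * of_nat ((q + r) choose r)))
    = fact r * fact i * fact q * (f (i + r) q * (of_nat ((i + r) choose Suc r) * of_nat (Suc r) + \<delta>1 * of_nat ((i + r) choose r) * of_nat (Suc r))
     + f i (q + r) * (of_nat ((q + r) choose Suc r) * of_nat (Suc r) + \<delta>2 * of_nat ((q + r) choose r) * of_nat (Suc r)))"
    by (simp add: algebra_simps)
  also have "\<dots> = f (i + r) q * (of_nat ((i + r) choose r) * fact r * fact i) * fact q * (of_nat i + of_nat (Suc r) * \<delta>1)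
     + f i (q + r) * fact i * (of_nat ((q + r) choose r) * fact r * fact q) * (of_nat q + of_nat (Suc r) * \<delta>2)"
    unfolding absorb by (simp add: algebra_simps)
  also have "\<dots> = b k * (of_nat i + (of_nat k - of_nat i + 1) * \<delta>1) + b i * (of_nat d - of_nat k + (of_nat k - of_nat i + 1) * \<delta>2)"
    unfolding b_def fct[symmetric] q r(1) by (simp add: add_ac)
  finally show ?thesis unfolding E by simp
qed

text \<open>For \<delta>1 \<noteq> 0 the pairs (0, k) express b_k through b_0, with factor (k + 1)
  \<delta>1. For \<delta>1 = 0 and d > 0 the pairs (1, k) express b_k through b_1, with factor 1,
  while b_0 vanishes by the pair (0, d) or (0, 1). Only for d = 1 and \<delta>1 = \<delta>2 = 0 do
  b_0 and b_1 both stay free.\<close>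

lemma coeff_system_unique:
  assumes f: "coeff_system \<delta>1 \<delta>2 \<gamma> f" and \<gamma>: "\<gamma> = \<delta>1 + \<delta>2 + of_nat d"
    and d: "\<not> (d = 1 \<and> \<delta>1 = 0 \<and> \<delta>2 = 0)"
    and 0: "f p0 (d - p0) = 0" "p0 = (if \<delta>1 \<noteq> 0 \<or> d = 0 then 0 else 1)"
  shows "f p q = 0"
proof -
  define b where "b p = f p (d - p) * fact p * fact (d - p)" for p
  have pair: "b k * (of_nat i + (of_nat k - of_nat i + 1) * \<delta>1)
    + b i * (of_nat d - of_nat k + (of_nat k - of_nat i + 1) * \<delta>2) = 0" if "i < k" "k \<le> d" for i k
    using coeff_system_pair[OF f that] unfolding b_def .
  have b0: "b p0 = 0" using 0(1) unfolding b_def by simp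
  have "b k = 0" if k: "k \<le> d" for k
  proof (cases "\<delta>1 = 0 \<and> d \<noteq> 0")
    case False
    then have b0: "b 0 = 0" using 0 b0 by auto
    show ?thesis
    proof (cases "k = 0")
      case False
      then have "b k * ((of_nat k + 1) * \<delta>1) = 0" using pair[of 0 k] k b0 by simp
      moreover have "of_nat k + 1 \<noteq> (0 :: complex)" by (metis of_nat_Suc of_nat_neq_0 add.commute)
      ultimately show ?thesis using \<open>\<not> (\<delta>1 = 0 \<and> d \<noteq> 0)\<close> False k by auto
    qed (use b0 in simp)
  next
    case True
    then have b1: "b 1 = 0" using 0 b0 by auto
    consider "k = 0" | "k = 1" | "k > 1" by linarith
    then show ?thesis
    proof cases
      case 1
      show ?thesis
      proof (cases "\<delta>2 = 0")
        case True
        then have "d > 1" using d \<open>\<delta>1 = 0 \<and> d \<noteq> 0\<close> by auto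
        then have "b 0 * (of_nat d - 1) = 0" using pair[of 0 1] b1 True by simp
        then show ?thesis using \<open>d > 1\<close> 1 by auto
      next
        case False
        have "b 0 * ((of_nat d + 1) * \<delta>2) = 0" using pair[of 0 d] True by simp
        moreover have "of_nat d + 1 \<noteq> (0 :: complex)" by (metis of_nat_Suc of_nat_neq_0 add.commute)
        ultimately show ?thesis using False 1 by auto
      qed
    next
      case 3
      then have "b k * 1 = 0" using pair[of 1 k] k b1 True by simp
      then show ?thesis by simp
    qed (use b1 in simp)
  qed
  then show ?thesis
  proof (cases "p + q = d")
    case True
    then have "b p = 0" "d - p = q" using \<open>\<And>k. k \<le> d \<Longrightarrow> b k = 0\<close> by auto
    then show ?thesis unfolding b_def by simp
  next
    case False
    then have "\<gamma> \<noteq> \<delta>1 + \<delta>2 + of_nat (p + q)" unfolding \<gamma> by (metis add_left_cancel of_nat_eq_iff)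
    then show ?thesis using coeff_system_degree[OF f] by blast
  qed
qed

text \<open>Here b_1 generates the solution. The pairs (1, k) determine every b_k with k \<ge> 2, so
  that the pairs (2, k) become conditions on \<delta>2 and d.\<close>

lemma coeff_system_first_zero:
  assumes f: "coeff_system 0 \<delta>2 \<gamma> f" and nz: "f p q \<noteq> 0" and d: "p + q = d" "d \<ge> 3"
  shows "d = 3 \<and> \<delta>2 \<in> {0, - 2}"
proof -
  have \<gamma>: "\<gamma> = 0 + \<delta>2 + of_nat d" using coeff_system_degree[OF f nz] d by simp
  define b where "b p = f p (d - p) * fact p * fact (d - p)" for p
  have pair: "b k * (of_nat i + (of_nat k - of_nat i + 1) * 0)
    + b i * (of_nat d - of_nat k + (of_nat k - of_nat i + 1) * \<delta>2) = 0" if "i < k" "k \<le> d" for i k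
    using coeff_system_pair[OF f that] unfolding b_def .
  have "f 1 (d - 1) \<noteq> 0"
    using coeff_system_unique[OF f \<gamma>, of 1 p q] nz d by auto
  then have b1: "b 1 \<noteq> 0" unfolding b_def by simp
  define D where "D = (of_nat d :: complex)"
  have bk: "b k = - b 1 * (D - of_nat k + of_nat k * \<delta>2)" if "2 \<le> k" "k \<le> d" for k
    using pair[of 1 k] that unfolding D_def by (simp add: add_eq_0_iff)
  have b2: "2 * b k + b 2 * (D - of_nat k + (of_nat k - 1) * \<delta>2) = 0" if "3 \<le> k" "k \<le> d" for k
    using pair[of 2 k] that unfolding D_def by (simp add: algebra_simps)
  \<comment> \<open>Substituting the pairs (1, 2) and (1, k) into (2, k) leaves a multiple of
    \<open>b 1\<close>, which is nonzero.\<close>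
  have "b 1 * (2 * (D - of_nat k + of_nat k * \<delta>2) + (D - 2 + 2 * \<delta>2) * (D - of_nat k + (of_nat k - 1) * \<delta>2)) = 0" if "3 \<le> k" "k \<le> d" for k
    using b2[OF that] bk[of k] bk[of 2] that by (simp add: algebra_simps)
  then have main: "2 * (D - of_nat k + of_nat k * \<delta>2) + (D - 2 + 2 * \<delta>2) * (D - of_nat k + (of_nat k - 1) * \<delta>2) = 0" if "3 \<le> k" "k \<le> d" for k
    using b1 that by auto
  have e1: "\<delta>2 * (2 * D + (D - 2 + 2 * \<delta>2) * (D - 1)) = 0"
    using main[of d] d unfolding D_def by (simp add: algebra_simps)
  show ?thesis
  proof (cases "d = 3")
    case True
    then have "D = 3" unfolding D_def by simp
    then have "4 * \<delta>2 * (\<delta>2 + 2) = 0" using e1 by (simp add: algebra_simps)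
    then have "\<delta>2 = 0 \<or> \<delta>2 + 2 = 0" by simp
    then show ?thesis using True by (simp add: eq_neg_iff_add_eq_0)
  next
    case False
    then have d4: "d \<ge> 4" using d by simp
    \<comment> \<open>For d \<ge> 4 the index k = d - 1 is at least 3 and supplies a second
      condition besides k = d. Together they force \<delta>2 = 1, which \<open>e3\<close> refutes
      for positive D.\<close>
    have e2: "2 * (1 + (D - 1) * \<delta>2) + (D - 2 + 2 * \<delta>2) * (1 + (D - 2) * \<delta>2) = 0"
      using main[of "d - 1"] d4 unfolding D_def by (simp add: of_nat_diff algebra_simps)
    have D0: "D \<noteq> 0" using d4 unfolding D_def by auto
    have D1: "D + of_nat 1 \<noteq> 0" unfolding D_def of_nat_add[symmetric] of_nat_eq_0_iff by simp
    have "\<delta>2 \<noteq> 0" using e2 D0 by auto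
    then have e3: "(D - 2 + 2 * \<delta>2) * (D - 1) = - 2 * D" using e1 by (simp add: add_eq_0_iff)
    have "\<delta>2 = 1" using e2 e3 by algebra
    then have "D * (D + 1) = 0" using e3 by (simp add: algebra_simps)
    then show ?thesis using D0 D1 by simp
  qed
qed

text \<open>The pairs containing 0 express the other coefficients through b_0, which is nonzero.
  Each further pair then yields a condition on the degrees: indices 0, 1, 2 for d = 2, the triples
  0, 1, 3 and 0, 1, 2 for d = 3, and 0, 1, d together with 0, 2, d for d \<ge> 4.\<close>

lemma coeff_system_degree_2_or_more:
  assumes f: "coeff_system \<delta>1 \<delta>2 \<gamma> f" and nz: "f p q \<noteq> 0" and d: "p + q = d" and \<delta>: "\<delta>1 \<noteq> 0" "\<delta>2 \<noteq> 0"
  shows "d = 2 \<Longrightarrow> \<delta>1 + \<delta>2 = - 1" "d = 3 \<Longrightarrow> \<delta>1 = - 2 / 3 \<and> \<delta>2 = - 2 / 3" "d \<le> 3"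
proof -
  have \<gamma>: "\<gamma> = \<delta>1 + \<delta>2 + of_nat d" using coeff_system_degree[OF f nz] d by simp
  define b where "b p = f p (d - p) * fact p * fact (d - p)" for p
  have pair: "b k * (of_nat i + (of_nat k - of_nat i + 1) * \<delta>1)
    + b i * (of_nat d - of_nat k + (of_nat k - of_nat i + 1) * \<delta>2) = 0" if "i < k" "k \<le> d" for i k
    using coeff_system_pair[OF f that] unfolding b_def .
  have "f 0 d \<noteq> 0"
    using coeff_system_unique[OF f \<gamma>, of 0 p q] nz \<delta> by auto
  then have b0: "b 0 \<noteq> 0" unfolding b_def by simp
  show "\<delta>1 + \<delta>2 = - 1" if "d = 2"
  proof -
    have 1: "b 1 * (2 * \<delta>1) + b 0 * (1 + 2 * \<delta>2) = 0" using pair[of 0 1] that by simp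
    have 2: "b 2 * (1 + 2 * \<delta>1) + b 1 * (2 * \<delta>2) = 0" using pair[of 1 2] that by simp
    have 3: "b 2 * (3 * \<delta>1) + b 0 * (3 * \<delta>2) = 0" using pair[of 0 2] that by simp
    have "b 0 * \<delta>2 * (\<delta>1 + \<delta>2 + 1) = 0" using 1 2 3 by algebra
    then show ?thesis using b0 \<delta> by (simp add: eq_neg_iff_add_eq_0)
  qed
  show "\<delta>1 = - 2 / 3 \<and> \<delta>2 = - 2 / 3" if "d = 3"
  proof -
    have 1: "b 1 * (2 * \<delta>1) + b 0 * (2 + 2 * \<delta>2) = 0" using pair[of 0 1] that by simp
    have 2: "b 2 * (3 * \<delta>1) + b 0 * (1 + 3 * \<delta>2) = 0" using pair[of 0 2] that by simp
    have 3: "b 3 * (4 * \<delta>1) + b 0 * (4 * \<delta>2) = 0" using pair[of 0 3] that by simp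
    have 4: "b 2 * (1 + 2 * \<delta>1) + b 1 * (1 + 2 * \<delta>2) = 0" using pair[of 1 2] that by simp
    have 5: "b 3 * (1 + 3 * \<delta>1) + b 1 * (3 * \<delta>2) = 0" using pair[of 1 3] that by simp
    have "b 0 * \<delta>2 * (4 + 3 * \<delta>1 + 3 * \<delta>2) = 0" using 1 3 5 by algebra
    then have "4 + 3 * \<delta>1 + 3 * \<delta>2 = 0" using b0 \<delta> by simp
    then have s: "3 * \<delta>1 = - 4 - 3 * \<delta>2" by algebra
    have "b 0 * (3 * \<delta>2 + 2) = 0" using 1 2 4 s by algebra
    then have "3 * \<delta>2 = - 2" using b0 by (simp add: eq_neg_iff_add_eq_0)
    moreover from this s have "3 * \<delta>1 = - 2" by simp
    ultimately show ?thesis by (simp add: field_simps)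
  qed
  show "d \<le> 3"
  proof (rule ccontr)
    assume "\<not> d \<le> 3"
    then have d4: "d \<ge> 4" by simp
    define D where "D = (of_nat d :: complex)"
    have 1: "b 1 * (2 * \<delta>1) + b 0 * (D - 1 + 2 * \<delta>2) = 0" using pair[of 0 1] d4 unfolding D_def by simp
    have 2: "b 2 * (3 * \<delta>1) + b 0 * (D - 2 + 3 * \<delta>2) = 0" using pair[of 0 2] d4 unfolding D_def by simp
    have "(D + 1) * (b d * \<delta>1 + b 0 * \<delta>2) = 0" using pair[of 0 d] d4 unfolding D_def by (simp add: algebra_simps)
    moreover have D1: "D + of_nat 1 \<noteq> 0" unfolding D_def of_nat_add[symmetric] of_nat_eq_0_iff by simp
    ultimately have 3: "b d * \<delta>1 + b 0 * \<delta>2 = 0" by simp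
    have 4: "b d * (1 + D * \<delta>1) + b 1 * (D * \<delta>2) = 0" using pair[of 1 d] d4 unfolding D_def by (simp add: algebra_simps)
    have 5: "b d * (2 + (D - 1) * \<delta>1) + b 2 * ((D - 1) * \<delta>2) = 0" using pair[of 2 d] d4 unfolding D_def by (simp add: algebra_simps)
    have "b 0 * \<delta>2 * (2 + 2 * D * \<delta>1 + D * (D - 1) + 2 * D * \<delta>2) = 0" using 1 3 4 by algebra
    then have "2 + 2 * D * \<delta>1 + D * (D - 1) + 2 * D * \<delta>2 = 0" using b0 \<delta> by simp
    then have 6: "2 + 2 * D * (\<delta>1 + \<delta>2) + D * (D - 1) = 0" by algebra
    have "b 0 * \<delta>2 * (6 + 3 * (D - 1) * \<delta>1 + (D - 1) * (D - 2) + 3 * (D - 1) * \<delta>2) = 0" using 2 3 5 by algebra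
    then have "6 + 3 * (D - 1) * \<delta>1 + (D - 1) * (D - 2) + 3 * (D - 1) * \<delta>2 = 0" using b0 \<delta> by simp
    then have 7: "6 + 3 * (D - 1) * (\<delta>1 + \<delta>2) + (D - 1) * (D - 2) = 0" by algebra
    \<comment> \<open>Conditions 6 and 7 are linear in \<delta>1 + \<delta>2. Eliminating the sum
      leaves this cubic, whose only positive root 3 lies below the range.\<close>
    have "(D - 3) * (D + 1) * (D + 2) = 0" using 6 7 by algebra
    moreover have "D \<noteq> of_nat 3" unfolding D_def of_nat_eq_iff using d4 by simp
    moreover have "D + of_nat 2 \<noteq> 0" unfolding D_def of_nat_add[symmetric] of_nat_eq_0_iff by simp
    ultimately show False using D1 by simp
  qed
qed

section \<open>Classification of the solutions on a quadrant\<close>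

text \<open>The relation [L_1, L_m] = (m - 1) L_(m+1) generates all positive m from 1 and 2. Only
  points to the right of and above (i, j) are visited, so the quadrant does not shrink with
  m.\<close>

lemma sol_from_generators:
  fixes a b :: complex
  assumes 1: "\<And>i j. (a + of_nat i + (b + of_nat j) + \<gamma>) * c i j =
     (a + of_nat i + \<delta>1) * c (i + 1) j + (b + of_nat j + \<delta>2) * c i (j + 1)"
    and 2: "\<And>i j. (a + of_nat i + (b + of_nat j) + 2 * \<gamma>) * c i j =
     (a + of_nat i + 2 * \<delta>1) * c (i + 2) j + (b + of_nat j + 2 * \<delta>2) * c i (j + 2)"
  shows "sol \<delta>1 \<delta>2 \<gamma> a b c"
proof -
  have "\<forall>i j. (a + of_nat i + (b + of_nat j) + of_nat (Suc m) * \<gamma>) * c i j =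
     (a + of_nat i + of_nat (Suc m) * \<delta>1) * c (i + Suc m) j + (b + of_nat j + of_nat (Suc m) * \<delta>2) * c i (j + Suc m)"
    for m
  proof (induction m rule: less_induct)
    case (less m)
    consider "m = 0" | "m = 1" | k where "m = Suc k" "k \<ge> 1" by (metis One_nat_def Suc_leI neq0_conv not0_implies_Suc)
    then show ?case
    proof cases
      case 3
      define M where "M = (of_nat m :: complex)"
      have IH: "(a + of_nat i + (b + of_nat j) + M * \<gamma>) * c i j =
         (a + of_nat i + M * \<delta>1) * c (i + m) j + (b + of_nat j + M * \<delta>2) * c i (j + m)" for i j
        using less[of k] 3 unfolding M_def by simp
      have M1: "M - 1 \<noteq> 0" using 3 unfolding M_def by auto
      show ?thesis
      proof (intro allI)
        fix i j
        define x where "x = a + of_nat i"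
        define y where "y = b + of_nat j"
        have e: "(x + y + M * \<gamma>) * c i j = (x + M * \<delta>1) * c (i + m) j + (y + M * \<delta>2) * c i (j + m)"
          "(x + 1 + y + M * \<gamma>) * c (i + 1) j = (x + 1 + M * \<delta>1) * c (i + Suc m) j + (y + M * \<delta>2) * c (i + 1) (j + m)"
          "(x + (y + 1) + M * \<gamma>) * c i (j + 1) = (x + M * \<delta>1) * c (i + m) (j + 1) + (y + 1 + M * \<delta>2) * c i (j + Suc m)"
          using IH[of i j] IH[of "i + 1" j] IH[of i "j + 1"] unfolding x_def y_def by (simp_all add: add_ac)
        have f: "(x + y + \<gamma>) * c i j = (x + \<delta>1) * c (i + 1) j + (y + \<delta>2) * c i (j + 1)"
          "(x + M + y + \<gamma>) * c (i + m) j = (x + M + \<delta>1) * c (i + Suc m) j + (y + \<delta>2) * c (i + m) (j + 1)"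
          "(x + (y + M) + \<gamma>) * c i (j + m) = (x + \<delta>1) * c (i + 1) (j + m) + (y + M + \<delta>2) * c i (j + Suc m)"
          using 1[of i j] 1[of "i + m" j] 1[of i "j + m"] unfolding x_def y_def M_def by (simp_all add: add_ac)
        have "(M - 1) * ((x + y + (M + 1) * \<gamma>) * c i j -
          ((x + (M + 1) * \<delta>1) * c (i + Suc m) j + (y + (M + 1) * \<delta>2) * c i (j + Suc m))) = 0"
          using e f by algebra
        then show "(a + of_nat i + (b + of_nat j) + of_nat (Suc m) * \<gamma>) * c i j =
          (a + of_nat i + of_nat (Suc m) * \<delta>1) * c (i + Suc m) j + (b + of_nat j + of_nat (Suc m) * \<delta>2) * c i (j + Suc m)"
          using M1 unfolding x_def y_def M_def by (simp add: add_ac)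
      qed
    next
      case 1
      then show ?thesis using \<open>\<And>i j. (a + of_nat i + (b + of_nat j) + \<gamma>) * c i j = _\<close> by simp
    next
      case 2
      then show ?thesis using \<open>\<And>i j. (a + of_nat i + (b + of_nat j) + 2 * \<gamma>) * c i j = _\<close> by (simp add: numeral_2_eq_2)
    qed
  qed
  then show ?thesis unfolding sol_def by (metis One_nat_def Suc_pred' less_eq_Suc_le)
qed

text \<open>Positive real parts keep x, y and x + y away from 0, which the elimination in either
  variable requires.\<close>

lemma sol_normal_form:
  fixes a b :: complex
  assumes s: "sol \<delta>1 \<delta>2 \<gamma> a b c" and \<delta>: "\<delta>1 \<noteq> 1" "\<delta>2 \<noteq> 1" "\<gamma> \<noteq> 0" and ab: "Re a > 0" "Re b > 0"
  obtains f where "coeff_system \<delta>1 \<delta>2 \<gamma> f"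
    "\<And>i j. 5 \<le> i \<Longrightarrow> 5 \<le> j \<Longrightarrow> c i j = (\<Sum>p\<le>4. \<Sum>q\<le>4. f p q * (a + of_nat i) ^ p * (b + of_nat j) ^ q)"
proof -
  have nz: "a + of_nat i \<noteq> 0" "b + of_nat i \<noteq> 0" "a + of_nat i + (b + of_nat j) \<noteq> 0" "b + of_nat i + (a + of_nat j) \<noteq> 0" for i j
  proof -
    have "Re (a + of_nat i) > 0" "Re (b + of_nat i) > 0" "Re (a + of_nat i + (b + of_nat j)) > 0" "Re (b + of_nat i + (a + of_nat j)) > 0"
      using ab by simp_all
    then show "a + of_nat i \<noteq> 0" "b + of_nat i \<noteq> 0" "a + of_nat i + (b + of_nat j) \<noteq> 0" "b + of_nat i + (a + of_nat j) \<noteq> 0"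
      by (metis less_irrefl zero_complex.sel(1))+
  qed
  have a0: "a \<noteq> 0" "b \<noteq> 0" using nz(1,2)[of 0] by auto
  have x: "\<exists>f. poly_fun 4 f \<and> (\<forall>i\<ge>5. c i j = f (a + of_nat i))" for j
    using sol_poly_fun_x[OF s \<delta> a0(1) nz(2,3)] .
  have y: "\<exists>f. poly_fun 4 f \<and> (\<forall>j\<ge>5. c i j = f (b + of_nat j))" for i
    using sol_poly_fun_x[OF sol_swap[OF s] \<delta>(2,1,3) a0(2) nz(1,4)] .
  obtain f where f: "\<And>p q. p > 4 \<or> q > 4 \<Longrightarrow> f p q = 0"
    "\<And>i j. 5 \<le> i \<Longrightarrow> 5 \<le> j \<Longrightarrow> c i j = (\<Sum>p\<le>4. \<Sum>q\<le>4. f p q * (a + of_nat i) ^ p * (b + of_nat j) ^ q)"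
    using jointly_polynomial[OF x y] by blast
  define F where "F x y = (\<Sum>p\<le>4. \<Sum>q\<le>4. f p q * x ^ p * y ^ q)" for x y
  have pF: "poly_fun 4 (\<lambda>x. F x y)" "poly_fun 4 (F x)" for x y
  proof -
    have "poly_fun 4 (\<lambda>x. \<Sum>p\<le>4. (\<Sum>q\<le>4. f p q * y ^ q) * x ^ p)" for y
      by (intro poly_fun_sum poly_fun_cmult poly_fun_mono[OF poly_fun_power]) auto
    moreover have "(\<lambda>x. F x y) = (\<lambda>x. \<Sum>p\<le>4. (\<Sum>q\<le>4. f p q * y ^ q) * x ^ p)" for y
      unfolding F_def by (simp add: sum_distrib_left mult_ac)
    ultimately show "poly_fun 4 (\<lambda>x. F x y)" by simp
    show "poly_fun 4 (F x)"
      unfolding F_def by (intro poly_fun_sum poly_fun_cmult poly_fun_mono[OF poly_fun_power]) auto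
  qed
  have "coeff_system \<delta>1 \<delta>2 \<gamma> f"
    unfolding coeff_system_def
  proof (intro allI)
    fix p q r
    show "f (p + r) q * (of_nat ((p + r) choose Suc r) + \<delta>1 * of_nat ((p + r) choose r))
     + f p (q + r) * (of_nat ((q + r) choose Suc r) + \<delta>2 * of_nat ((q + r) choose r))
     = (if r = 0 then \<gamma> * f p q else 0)"
    proof (rule coefficients_of_identity[where N = 4 and F = F])
      show "(x + y + m * \<gamma>) * F x y = (x + m * \<delta>1) * F (x + m) y + (y + m * \<delta>2) * F x (y + m)" for x y m
        by (rule sol_identity[OF s _ pF, where k = 5]) (use f(2) in \<open>simp add: F_def\<close>)
    qed (auto simp: F_def f(1))
  qed
  then show ?thesis using that f(2) by blast
qed

text \<open>A source degree 1 becomes 0 by composing with \<open>op_d\<close> in that argument, and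
  the target degree 0 becomes 1 by applying \<open>op_d\<close> to the value;
  \<open>norm_factor\<close> is the effect on the coefficient.\<close>

definition norm_in :: "complex \<Rightarrow> complex" where "norm_in \<delta> = (if \<delta> = 1 then 0 else \<delta>)"
definition norm_out :: "complex \<Rightarrow> complex" where "norm_out \<gamma> = (if \<gamma> = 0 then 1 else \<gamma>)"
definition norm_factor :: "complex \<Rightarrow> complex \<Rightarrow> complex \<Rightarrow> complex \<Rightarrow> complex \<Rightarrow> complex" where
  "norm_factor \<delta>1 \<delta>2 \<gamma> x y = (if \<delta>1 = 1 then x else 1) * (if \<delta>2 = 1 then y else 1) * (if \<gamma> = 0 then x + y else 1)"

text \<open>On the level of germs \<open>d\<close> identifies the degrees \<open>0\<close> and \<open>1\<close>, so that the excluded values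
  \<open>\<delta>1 = 1\<close>, \<open>\<delta>2 = 1\<close>, \<open>\<gamma> = 0\<close>, for which poles occur, can be avoided.\<close>

lemma sol_normalise:
  assumes "sol \<delta>1 \<delta>2 \<gamma> a b c"
  shows "sol (norm_in \<delta>1) (norm_in \<delta>2) (norm_out \<gamma>) a b
    (\<lambda>i j. norm_factor \<delta>1 \<delta>2 \<gamma> (a + of_nat i) (b + of_nat j) * c i j)"
  unfolding sol_def
proof (intro allI impI)
  fix m i j :: nat assume m: "1 \<le> m"
  define x y M where "x = a + of_nat i" and "y = b + of_nat j" and "M = (of_nat m :: complex)"
  have e: "(x + y + M * \<gamma>) * c i j = (x + M * \<delta>1) * c (i + m) j + (y + M * \<delta>2) * c i (j + m)"
    using solD[OF assms m] unfolding x_def y_def M_def by simp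
  define A B G where "A z = (if \<delta>1 = 1 then z else 1)" and "B z = (if \<delta>2 = 1 then z else 1)"
    and "G z = (if \<gamma> = 0 then z else 1)" for z :: complex
  have nf: "norm_factor \<delta>1 \<delta>2 \<gamma> u v = A u * B v * G (u + v)" for u v
    unfolding norm_factor_def A_def B_def G_def ..
  have 1: "(x + M * norm_in \<delta>1) * A (x + M) = A x * (x + M * \<delta>1)"
    "(y + M * norm_in \<delta>2) * B (y + M) = B y * (y + M * \<delta>2)"
    "(x + y + M * norm_out \<gamma>) * G (x + y) = G (x + y + M) * (x + y + M * \<gamma>)"
    unfolding A_def B_def G_def norm_in_def norm_out_def by simp_all
  have 2: "G (x + M + y) = G (x + y + M)" "G (x + (y + M)) = G (x + y + M)" by (simp_all add: add_ac)
  have "(x + y + M * norm_out \<gamma>) * (norm_factor \<delta>1 \<delta>2 \<gamma> x y * c i j) =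
    (x + M * norm_in \<delta>1) * (norm_factor \<delta>1 \<delta>2 \<gamma> (x + M) y * c (i + m) j) +
    (y + M * norm_in \<delta>2) * (norm_factor \<delta>1 \<delta>2 \<gamma> x (y + M) * c i (j + m))"
    unfolding nf 2 using e 1 by algebra
  then show "(a + of_nat i + (b + of_nat j) + of_nat m * norm_out \<gamma>) * (norm_factor \<delta>1 \<delta>2 \<gamma> (a + of_nat i) (b + of_nat j) * c i j) =
    (a + of_nat i + of_nat m * norm_in \<delta>1) * (norm_factor \<delta>1 \<delta>2 \<gamma> (a + of_nat (i + m)) (b + of_nat j) * c (i + m) j) +
    (b + of_nat j + of_nat m * norm_in \<delta>2) * (norm_factor \<delta>1 \<delta>2 \<gamma> (a + of_nat i) (b + of_nat (j + m)) * c i (j + m))"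
    unfolding x_def y_def M_def by (simp add: add.assoc)
qed

lemma norm_factor_nonzero:
  assumes "Re a > 0" "Re b > 0"
  shows "norm_factor \<delta>1 \<delta>2 \<gamma> (a + of_nat i) (b + of_nat j) \<noteq> 0"
proof -
  have "Re (a + of_nat i) > 0" "Re (b + of_nat j) > 0" "Re (a + of_nat i + (b + of_nat j)) > 0"
    using assms by simp_all
  then have "a + of_nat i \<noteq> 0" "b + of_nat j \<noteq> 0" "a + of_nat i + (b + of_nat j) \<noteq> 0"
    by (metis less_irrefl zero_complex.sel(1))+
  then show ?thesis unfolding norm_factor_def by simp
qed

text \<open>Subtracting the multiple of \<open>q\<close> that kills the determining coefficient
  leaves the zero solution of the linear system. The normalised triple is (0, 0, 1) only if all
  entries lie in {0, 1}, so \<open>triple\<close> rules out the one case with two free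
  coefficients.\<close>

lemma sol_proportional:
  fixes a b :: complex
  assumes c: "sol \<delta>1 \<delta>2 \<gamma> a b c" and q: "sol \<delta>1 \<delta>2 \<gamma> a b q" and ab: "Re a > 0" "Re b > 0"
    and triple: "\<not> {\<delta>1, \<delta>2, \<gamma>} \<subseteq> {0, 1}" and nz: "q i0 j0 \<noteq> 0" "5 \<le> i0" "5 \<le> j0"
  shows "\<exists>\<kappa>. \<forall>i\<ge>5. \<forall>j\<ge>5. c i j = \<kappa> * q i j"
proof -
  define e1 e2 g where "e1 = norm_in \<delta>1" and "e2 = norm_in \<delta>2" and "g = norm_out \<gamma>"
  define \<mu> where "\<mu> i j = norm_factor \<delta>1 \<delta>2 \<gamma> (a + of_nat i) (b + of_nat j)" for i j
  have \<mu>: "\<mu> i j \<noteq> 0" for i j unfolding \<mu>_def using norm_factor_nonzero[OF ab] .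
  have e: "e1 \<noteq> 1" "e2 \<noteq> 1" "g \<noteq> 0" "\<not> (e1 = 0 \<and> e2 = 0 \<and> g = 1)"
    using triple unfolding e1_def e2_def g_def norm_in_def norm_out_def by (auto split: if_splits)
  have sc: "sol e1 e2 g a b (\<lambda>i j. \<mu> i j * c i j)" "sol e1 e2 g a b (\<lambda>i j. \<mu> i j * q i j)"
    unfolding e1_def e2_def g_def \<mu>_def using sol_normalise[OF c] sol_normalise[OF q] .
  obtain f where f: "coeff_system e1 e2 g f"
    "\<And>i j. 5 \<le> i \<Longrightarrow> 5 \<le> j \<Longrightarrow> \<mu> i j * c i j = (\<Sum>p\<le>4. \<Sum>q\<le>4. f p q * (a + of_nat i) ^ p * (b + of_nat j) ^ q)"
    using sol_normal_form[OF sc(1) e(1-3) ab] by blast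
  obtain h where h: "coeff_system e1 e2 g h"
    "\<And>i j. 5 \<le> i \<Longrightarrow> 5 \<le> j \<Longrightarrow> \<mu> i j * q i j = (\<Sum>p\<le>4. \<Sum>q\<le>4. h p q * (a + of_nat i) ^ p * (b + of_nat j) ^ q)"
    using sol_normal_form[OF sc(2) e(1-3) ab] by blast
  have "\<exists>p q. h p q \<noteq> 0"
  proof (rule ccontr)
    assume "\<not> ?thesis"
    then have "\<mu> i0 j0 * q i0 j0 = 0" using h(2)[OF nz(2,3)] by simp
    then show False using nz \<mu> by simp
  qed
  then obtain p q' where pq: "h p q' \<noteq> 0" by blast
  define d where "d = p + q'"
  have g: "g = e1 + e2 + of_nat d" using coeff_system_degree[OF h(1) pq] unfolding d_def .
  have d1: "\<not> (d = 1 \<and> e1 = 0 \<and> e2 = 0)" using e(4) g by auto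
  define p0 where "p0 = (if e1 \<noteq> 0 \<or> d = 0 then 0 else 1 :: nat)"
  have h0: "h p0 (d - p0) \<noteq> 0" using coeff_system_unique[OF h(1) g d1 _ p0_def] pq by blast
  define \<kappa> where "\<kappa> = f p0 (d - p0) / h p0 (d - p0)"
  have "f p q - \<kappa> * h p q = 0" for p q
    by (rule coeff_system_unique[OF coeff_system_comb[OF f(1) h(1)] g d1 _ p0_def]) (use h0 in \<open>simp add: \<kappa>_def\<close>)
  then have "f p q = \<kappa> * h p q" for p q by simp
  then have "\<mu> i j * c i j = \<kappa> * (\<mu> i j * q i j)" if "5 \<le> i" "5 \<le> j" for i j
    unfolding f(2)[OF that] h(2)[OF that] by (simp add: sum_distrib_left mult.assoc)
  then have "\<mu> i j * c i j = \<mu> i j * (\<kappa> * q i j)" if "5 \<le> i" "5 \<le> j" for i j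
    using that by (simp add: mult_ac)
  then show ?thesis using \<mu> by (metis mult_left_cancel)
qed

lemma zset_iff: "(\<delta>1, \<delta>2, \<gamma>) \<in> zset \<longleftrightarrow> \<gamma> = \<delta>1 + \<delta>2 \<or> \<gamma> = \<delta>1 + \<delta>2 + 1 \<or> \<delta>1 = 0 \<and> \<gamma> = \<delta>2 + 2
  \<or> \<delta>2 = 0 \<and> \<gamma> = \<delta>1 + 2 \<or> \<delta>2 = 1 \<and> \<gamma> = \<delta>1 \<or> \<delta>1 = 1 \<and> \<gamma> = \<delta>2 \<or> \<delta>2 = - 1 - \<delta>1 \<and> \<gamma> = 1
  \<or> \<delta>2 = 1 - \<delta>1 \<and> \<gamma> = 0 \<or> \<delta>1 = 0 \<and> \<delta>2 = 0 \<and> \<gamma> = 3 \<or> \<delta>1 = 0 \<and> \<delta>2 = - 2 \<and> \<gamma> = 1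
  \<or> \<delta>1 = - 2 \<and> \<delta>2 = 0 \<and> \<gamma> = 1 \<or> \<delta>1 = 1 \<and> \<delta>2 = 1 \<and> \<gamma> = 0 \<or> \<delta>1 = - 2 / 3 \<and> \<delta>2 = - 2 / 3 \<and> \<gamma> = 5 / 3"
  unfolding zset_def by auto

text \<open>\<open>zset\<close> is the preimage of a shorter list of normalised triples. As
  \<open>norm_in\<close> identifies 1 with 0 and \<open>norm_out\<close> identifies 0 with 1, one
  degree d can account for components of different dimensions.\<close>

lemma sol_in_zset:
  fixes a b :: complex
  assumes c: "sol \<delta>1 \<delta>2 \<gamma> a b c" and ab: "Re a > 0" "Re b > 0"
    and triple: "\<not> {\<delta>1, \<delta>2, \<gamma>} \<subseteq> {0, 1}" and nz: "c i0 j0 \<noteq> 0" "5 \<le> i0" "5 \<le> j0"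
  shows "(\<delta>1, \<delta>2, \<gamma>) \<in> zset"
proof -
  define e1 e2 g where "e1 = norm_in \<delta>1" and "e2 = norm_in \<delta>2" and "g = norm_out \<gamma>"
  have e: "e1 \<noteq> 1" "e2 \<noteq> 1" "g \<noteq> 0" "\<not> (e1 = 0 \<and> e2 = 0 \<and> g = 1)"
    using triple unfolding e1_def e2_def g_def norm_in_def norm_out_def by (auto split: if_splits)
  have sc: "sol e1 e2 g a b (\<lambda>i j. norm_factor \<delta>1 \<delta>2 \<gamma> (a + of_nat i) (b + of_nat j) * c i j)"
    unfolding e1_def e2_def g_def using sol_normalise[OF c] .
  obtain f where f: "coeff_system e1 e2 g f"
    "\<And>i j. 5 \<le> i \<Longrightarrow> 5 \<le> j \<Longrightarrow> norm_factor \<delta>1 \<delta>2 \<gamma> (a + of_nat i) (b + of_nat j) * c i j = (\<Sum>p\<le>4. \<Sum>q\<le>4. f p q * (a + of_nat i) ^ p * (b + of_nat j) ^ q)"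
    using sol_normal_form[OF sc e(1-3) ab] by blast
  have "\<exists>p q. f p q \<noteq> 0"
  proof (rule ccontr)
    assume "\<not> ?thesis"
    then have "norm_factor \<delta>1 \<delta>2 \<gamma> (a + of_nat i0) (b + of_nat j0) * c i0 j0 = 0" using f(2)[OF nz(2,3)] by simp
    then show False using nz norm_factor_nonzero[OF ab] by simp
  qed
  then obtain p q where pq: "f p q \<noteq> 0" by blast
  define d where "d = p + q"
  have g: "g = e1 + e2 + of_nat d" using coeff_system_degree[OF f(1) pq] unfolding d_def .
  have "(d \<le> 1) \<or> (d = 2 \<and> (e1 = 0 \<or> e2 = 0 \<or> e1 + e2 = - 1))
    \<or> (d = 3 \<and> ((e1, e2) \<in> {(0, 0), (0, - 2), (- 2, 0), (- 2 / 3, - 2 / 3)}))"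
  proof (cases "e1 = 0 \<or> e2 = 0")
    case False
    then show ?thesis
      using coeff_system_degree_2_or_more[OF f(1) pq d_def[symmetric]] by fastforce
  next
    case True
    consider "d \<le> 2" | "d \<ge> 3" "e1 = 0" | "d \<ge> 3" "e2 = 0" using True by linarith
    then show ?thesis
    proof cases
      case 2
      have "d = 3 \<and> e2 \<in> {0, - 2}"
        by (rule coeff_system_first_zero[of e2 g f p q]) (use 2 f(1) pq d_def in auto)
      then show ?thesis using 2 by auto
    next
      case 3
      have "d = 3 \<and> e1 \<in> {0, - 2}"
        by (rule coeff_system_first_zero[of e1 g "\<lambda>p q. f q p" q p]) (use 3 coeff_system_swap[OF f(1)] pq d_def in auto)
      then show ?thesis using 3 by auto
    qed (use True in auto)
  qed
  then consider "d = 0" | "d = 1" | "d = 2" "e1 = 0" | "d = 2" "e2 = 0" | "d = 2" "e1 + e2 = - 1"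
    | "d = 3" "e1 = 0" "e2 = 0" | "d = 3" "e1 = 0" "e2 = - 2" | "d = 3" "e1 = - 2" "e2 = 0" | "d = 3" "e1 = - 2 / 3" "e2 = - 2 / 3"
    by (cases "d = 0"; cases "d = 1"; auto)
  then show ?thesis
    unfolding zset_iff using g e unfolding e1_def e2_def g_def norm_in_def norm_out_def
    by cases (simp_all split: if_splits add: add_eq_0_iff algebra_simps)
qed

lemma sol_linear:
  fixes a b :: complex
  assumes c: "sol 0 0 1 a b c" and ab: "Re a > 0" "Re b > 0"
  shows "\<exists>k l. \<forall>i\<ge>5. \<forall>j\<ge>5. c i j = k * (a + of_nat i) + l * (b + of_nat j)"
proof -
  obtain f where f: "coeff_system 0 0 1 f"
    "\<And>i j. 5 \<le> i \<Longrightarrow> 5 \<le> j \<Longrightarrow> c i j = (\<Sum>p\<le>4. \<Sum>q\<le>4. f p q * (a + of_nat i) ^ p * (b + of_nat j) ^ q)"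
    using sol_normal_form[OF c _ _ _ ab] by auto
  have z: "f p q = 0" if "p + q \<noteq> 1" for p q
    using coeff_system_degree[OF f(1), of p q] that by (metis add_0 of_nat_1_eq_iff)
  have "(\<Sum>p\<le>4. \<Sum>q\<le>4. f p q * x ^ p * y ^ q) = f 1 0 * x + f 0 1 * y" for x y
    by (simp add: numeral_eq_Suc z)
  with f(2) have "c i j = f 1 0 * (a + of_nat i) + f 0 1 * (b + of_nat j)" if "5 \<le> i" "5 \<le> j" for i j
    using that by metis
  then show ?thesis by metis
qed

section \<open>Linear algebra of germs\<close>

lemma witt_moduleD:
  assumes "witt_module M"
  shows witt_vector_space: "vector_space (scale M)"
    and witt_subspace: "module.subspace (scale M) (vspace M)"
    and witt_zero: "0 \<in> vspace M"
    and witt_add: "\<And>m m'. m \<in> vspace M \<Longrightarrow> m' \<in> vspace M \<Longrightarrow> m + m' \<in> vspace M"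
    and witt_scale: "\<And>c m. m \<in> vspace M \<Longrightarrow> scale M c m \<in> vspace M"
    and witt_diff: "\<And>m m'. m \<in> vspace M \<Longrightarrow> m' \<in> vspace M \<Longrightarrow> m - m' \<in> vspace M"
    and witt_sum: "\<And>S f. (\<And>i. i \<in> S \<Longrightarrow> f i \<in> vspace M) \<Longrightarrow> (\<Sum>i\<in>S. f i) \<in> vspace M"
    and witt_act_Hom: "\<And>X. act M X \<in> Hom M M"
    and witt_act: "\<And>X m. m \<in> vspace M \<Longrightarrow> act M X m \<in> vspace M"
    and witt_act_add_left: "\<And>X Y m. m \<in> vspace M \<Longrightarrow> act M (X + Y) m = act M X m + act M Y m"
    and witt_act_scale_left: "\<And>c X m. m \<in> vspace M \<Longrightarrow> act M (pm_scale c X) m = scale M c (act M X m)"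
    and witt_act_bracket: "\<And>X Y m. m \<in> vspace M \<Longrightarrow> act M (bracket X Y) m = act M X (act M Y m) - act M Y (act M X m)"
proof -
  show vs: "vector_space (scale M)" and sub: "module.subspace (scale M) (vspace M)"
    and H: "act M X \<in> Hom M M" for X
    using assms unfolding witt_module_def by auto
  interpret vector_space "scale M" by (rule vs)
  show "0 \<in> vspace M" by (rule subspace_0[OF sub])
  show "m \<in> vspace M \<Longrightarrow> m' \<in> vspace M \<Longrightarrow> m + m' \<in> vspace M" for m m' by (rule subspace_add[OF sub])
  show "m \<in> vspace M \<Longrightarrow> scale M c m \<in> vspace M" for m c by (rule subspace_scale[OF sub])
  show "m \<in> vspace M \<Longrightarrow> m' \<in> vspace M \<Longrightarrow> m - m' \<in> vspace M" for m m' by (rule subspace_diff[OF sub])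
  show "(\<And>i. i \<in> S \<Longrightarrow> f i \<in> vspace M) \<Longrightarrow> (\<Sum>i\<in>S. f i) \<in> vspace M" for S f by (rule subspace_sum[OF sub])
  show "m \<in> vspace M \<Longrightarrow> act M X m \<in> vspace M" for m X using H[of X] unfolding Hom_def by blast
qed (use assms in \<open>auto simp: witt_module_def\<close>)

lemma HomD:
  assumes "f \<in> Hom M N" "m \<in> vspace M"
  shows Hom_closed: "f m \<in> vspace N"
    and Hom_add: "m' \<in> vspace M \<Longrightarrow> f (m + m') = f m + f m'"
    and Hom_scale: "f (scale M c m) = scale N c (f m)"
  using assms unfolding Hom_def by auto

lemma Hom_zero:
  assumes "f \<in> Hom M N" "witt_module M"
  shows "f 0 = 0"
  using Hom_add[OF assms(1) witt_zero[OF assms(2)] witt_zero[OF assms(2)]] by simp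

lemma Hom_diff:
  assumes "f \<in> Hom M N" "witt_module M" "m \<in> vspace M" "m' \<in> vspace M"
  shows "f (m - m') = f m - f m'"
  using Hom_add[OF assms(1) witt_diff[OF assms(2,3,4)] assms(4)] by simp

lemma Hom_sum:
  assumes "f \<in> Hom M N" "witt_module M" "\<And>i. i \<in> S \<Longrightarrow> g i \<in> vspace M"
  shows "f (\<Sum>i\<in>S. g i) = (\<Sum>i\<in>S. f (g i))"
proof (cases "finite S")
  case True
  then show ?thesis using assms(3)
  proof (induction S rule: finite_induct)
    case (insert x F)
    then show ?case
      using Hom_add[OF assms(1), of "g x" "\<Sum>i\<in>F. g i"] witt_sum[OF assms(2), of F g] by simp
  qed (use Hom_zero[OF assms(1,2)] in simp)
qed (use Hom_zero[OF assms(1,2)] in simp)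

lemma Hom_comp: "f \<in> Hom M N \<Longrightarrow> g \<in> Hom N P \<Longrightarrow> (\<lambda>m. g (f m)) \<in> Hom M P"
  unfolding Hom_def by simp

lemma BilD:
  assumes "\<pi> \<in> Bil M N P" "m \<in> vspace M" "n \<in> vspace N"
  shows Bil_closed: "\<pi> m n \<in> vspace P"
    and Bil_add_left: "m' \<in> vspace M \<Longrightarrow> \<pi> (m + m') n = \<pi> m n + \<pi> m' n"
    and Bil_add_right: "n' \<in> vspace N \<Longrightarrow> \<pi> m (n + n') = \<pi> m n + \<pi> m n'"
    and Bil_scale_left: "\<pi> (scale M c m) n = scale P c (\<pi> m n)"
    and Bil_scale_right: "\<pi> m (scale N c n) = scale P c (\<pi> m n)"
  using assms unfolding Bil_def Hom_def by auto

lemma Bil_Hom_left: "\<pi> \<in> Bil M N P \<Longrightarrow> n \<in> vspace N \<Longrightarrow> (\<lambda>m. \<pi> m n) \<in> Hom M P"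
  and Bil_Hom_right: "\<pi> \<in> Bil M N P \<Longrightarrow> m \<in> vspace M \<Longrightarrow> \<pi> m \<in> Hom N P"
  unfolding Bil_def by auto

lemma Hom_comb:
  assumes P: "witt_module P" and "f \<in> Hom M P" "g \<in> Hom M P"
  shows "(\<lambda>m. scale P c (f m) + scale P c' (g m)) \<in> Hom M P"
proof -
  interpret vector_space "scale P" by (rule witt_vector_space[OF P])
  show ?thesis using assms unfolding Hom_def
    by (auto intro: witt_add witt_scale simp: scale_right_distrib mult.commute add_ac)
qed

lemma Bil_comb:
  assumes P: "witt_module P" and "\<pi> \<in> Bil M N P" "\<rho> \<in> Bil M N P"
  shows "(\<lambda>m n. scale P c (\<pi> m n) + scale P c' (\<rho> m n)) \<in> Bil M N P"
  using assms unfolding Bil_def by (auto intro: Hom_comb)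

lemma Bil_zero: "witt_module P \<Longrightarrow> (\<lambda>m n. 0) \<in> Bil M N P"
proof -
  assume P: "witt_module P"
  interpret vector_space "scale P" by (rule witt_vector_space[OF P])
  show ?thesis unfolding Bil_def Hom_def using witt_zero[OF P] by auto
qed

lemma upper_antimono:
  assumes "witt_module M" "x \<le> y"
  shows "upper M y \<subseteq> upper M x"
proof -
  interpret vector_space "scale M" by (rule witt_vector_space[OF assms(1)])
  show ?thesis unfolding upper_def by (rule span_mono) (use assms(2) in force)
qed

lemma wt_subset_vspace: "wt_space M s \<subseteq> vspace M"
  unfolding wt_space_def by auto

lemma upper_subset_vspace:
  assumes "witt_module M"
  shows "upper M x \<subseteq> vspace M"
proof -
  interpret vector_space "scale M" by (rule witt_vector_space[OF assms(1)])
  show ?thesis unfolding upper_def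
    by (rule span_minimal[OF _ witt_subspace[OF assms]]) (use wt_subset_vspace in blast)
qed

lemma wt_subset_upper:
  assumes "witt_module M" "x \<le> Re s"
  shows "wt_space M s \<subseteq> upper M x"
proof -
  interpret vector_space "scale M" by (rule witt_vector_space[OF assms(1)])
  show ?thesis unfolding upper_def
    by (rule order_trans[OF _ span_superset]) (use assms(2) in auto)
qed

lemma Bil0_subset_Bil: "\<pi> \<in> Bil0 M N P \<Longrightarrow> \<pi> \<in> Bil M N P"
  unfolding Bil0_def by auto

lemma Bil0_comb:
  assumes M: "witt_module M" and N: "witt_module N" and P: "witt_module P" and "\<pi> \<in> Bil0 M N P" "\<rho> \<in> Bil0 M N P"
  shows "(\<lambda>m n. scale P c (\<pi> m n) + scale P c' (\<rho> m n)) \<in> Bil0 M N P"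
proof -
  interpret vector_space "scale P" by (rule witt_vector_space[OF P])
  obtain x y where x: "\<forall>m\<in>upper M x. \<forall>n\<in>upper N x. \<pi> m n = 0" and y: "\<forall>m\<in>upper M y. \<forall>n\<in>upper N y. \<rho> m n = 0"
    using assms(4,5) unfolding Bil0_def by auto
  have "\<forall>m\<in>upper M (max x y). \<forall>n\<in>upper N (max x y). scale P c (\<pi> m n) + scale P c' (\<rho> m n) = 0"
    using x y upper_antimono[OF M, of _ "max x y"] upper_antimono[OF N, of _ "max x y"] by (simp add: subset_iff)
  then show ?thesis
    using Bil_comb[OF P] assms(4,5) unfolding Bil0_def by blast
qed

lemma Bil0_zero: "witt_module P \<Longrightarrow> (\<lambda>m n. 0) \<in> Bil0 M N P"
  unfolding Bil0_def using Bil_zero[of P M N] by simp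

lemma Bil0_add:
  assumes "witt_module M" "witt_module N" "witt_module P" "\<pi> \<in> Bil0 M N P" "\<rho> \<in> Bil0 M N P"
  shows "\<pi> + \<rho> \<in> Bil0 M N P"
proof -
  interpret vector_space "scale P" by (rule witt_vector_space[OF assms(3)])
  show ?thesis using Bil0_comb[OF assms, of 1 1] by (simp add: plus_fun_def)
qed

lemma Bil0_diff:
  assumes "witt_module M" "witt_module N" "witt_module P" "\<pi> \<in> Bil0 M N P" "\<rho> \<in> Bil0 M N P"
  shows "\<pi> - \<rho> \<in> Bil0 M N P"
proof -
  interpret vector_space "scale P" by (rule witt_vector_space[OF assms(3)])
  show ?thesis using Bil0_comb[OF assms, of 1 "-1"] by (simp add: fun_diff_def)
qed

lemma Bil0_scale:
  assumes "witt_module M" "witt_module N" "witt_module P" "\<pi> \<in> Bil0 M N P"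
  shows "(\<lambda>m n. scale P c (\<pi> m n)) \<in> Bil0 M N P"
proof -
  interpret vector_space "scale P" by (rule witt_vector_space[OF assms(3)])
  show ?thesis using Bil0_comb[OF assms(1-4) assms(4), of c 0] by simp
qed

section \<open>The quotient of the invariant maps by \<open>Bil0\<close>\<close>

text \<open>The representatives of the elements of \<open>G_W\<close>. Arguments run on
  representatives, because cosets with elementwise operations are not literally a vector
  space.\<close>

definition Inv_W :: "'a::ab_group_add wmod \<Rightarrow> 'b::ab_group_add wmod \<Rightarrow> 'c::ab_group_add wmod
    \<Rightarrow> ('a \<Rightarrow> 'b \<Rightarrow> 'c) set" where
  "Inv_W M N P = {\<pi> \<in> Bil M N P. \<forall>X. bil_act M N P X \<pi> \<in> Bil0 M N P}"

lemma bgerm_eqI: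
  assumes "witt_module M" "witt_module N" "witt_module P" "\<pi> - \<rho> \<in> Bil0 M N P"
  shows "bgerm M N P \<pi> = bgerm M N P \<rho>"
proof -
  have "\<exists>\<beta>'\<in>Bil0 M N P. \<pi> + \<beta> = \<rho> + \<beta>'" if "\<beta> \<in> Bil0 M N P" for \<beta>
    using Bil0_add[OF assms(1-4) that] by (intro bexI[of _ "\<pi> - \<rho> + \<beta>"]) auto
  moreover have "\<exists>\<beta>'\<in>Bil0 M N P. \<rho> + \<beta> = \<pi> + \<beta>'" if "\<beta> \<in> Bil0 M N P" for \<beta>
    using Bil0_diff[OF assms(1-3) that assms(4)] by (intro bexI[of _ "\<beta> - (\<pi> - \<rho>)"]) auto
  ultimately show ?thesis unfolding bgerm_def elt_set_plus_def by blast
qed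

lemma bgerm_eqD:
  assumes "witt_module P" "bgerm M N P \<pi> = bgerm M N P \<rho>"
  shows "\<pi> - \<rho> \<in> Bil0 M N P"
proof -
  have "\<pi> + 0 \<in> bgerm M N P \<pi>"
    unfolding bgerm_def elt_set_plus_def using Bil0_zero[OF assms(1), of M N] by (auto simp: zero_fun_def intro!: bexI)
  then obtain \<beta> where "\<beta> \<in> Bil0 M N P" "\<pi> + 0 = \<rho> + \<beta>" unfolding assms(2) unfolding bgerm_def elt_set_plus_def by auto
  then show ?thesis by simp
qed

definition lin_comb :: "'c::ab_group_add wmod \<Rightarrow> complex list \<Rightarrow> ('a \<Rightarrow> 'b \<Rightarrow> 'c) list \<Rightarrow> ('a \<Rightarrow> 'b \<Rightarrow> 'c)" where
  "lin_comb P cs \<rho>s = (\<lambda>m n. \<Sum>i<length \<rho>s. scale P (cs ! i) ((\<rho>s ! i) m n))"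

text \<open>Induction on the number of summands: the leading \<open>Bil0\<close> absorbs the
  \<open>Bil0\<close> part of each scaled coset, also when the scalar is 0 and the coset collapses
  to {0}.\<close>

lemma germ_comb_eq:
  assumes M: "witt_module M" and N: "witt_module N" and P: "witt_module P"
  shows "germ_comb M N P cs (map (bgerm M N P) \<rho>s) = bgerm M N P (lin_comb P cs \<rho>s)"
proof -
  interpret vector_space "scale P" by (rule witt_vector_space[OF P])
  define A where "A i = (\<lambda>\<pi> m n. scale P (cs ! i) (\<pi> m n)) ` (bgerm M N P (\<rho>s ! i))" for i
  define S where "S k = (\<lambda>m n. \<Sum>i<k. scale P (cs ! i) ((\<rho>s ! i) m n))" for k
  note B0 = Bil0_zero[OF P, of M N, folded zero_fun_def]
  have "Bil0 M N P + (\<Sum>i<k. A i) = S k +o Bil0 M N P" for k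
  proof (induction k)
    case 0
    then show ?case by (simp add: S_def flip: zero_fun_def)
  next
    case (Suc k)
    have "Bil0 M N P + (\<Sum>i<Suc k. A i) = (S k +o Bil0 M N P) + A k"
      using Suc by (simp add: add.assoc[symmetric])
    also have "\<dots> = S (Suc k) +o Bil0 M N P"
    proof (intro set_eqI iffI)
      fix \<phi> assume "\<phi> \<in> (S k +o Bil0 M N P) + A k"
      then obtain \<beta> \<beta>' where b: "\<beta> \<in> Bil0 M N P" "\<beta>' \<in> Bil0 M N P"
        "\<phi> = (S k + \<beta>) + (\<lambda>m n. scale P (cs ! k) ((\<rho>s ! k + \<beta>') m n))"
        unfolding set_plus_def elt_set_plus_def A_def bgerm_def by auto
      have "\<phi> = S (Suc k) + (\<beta> + (\<lambda>m n. scale P (cs ! k) (\<beta>' m n)))"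
        unfolding b(3) S_def by (auto simp: fun_eq_iff scale_right_distrib add_ac)
      then show "\<phi> \<in> S (Suc k) +o Bil0 M N P"
        using Bil0_add[OF M N P b(1) Bil0_scale[OF M N P b(2)]] unfolding elt_set_plus_def by blast
    next
      fix \<phi> assume "\<phi> \<in> S (Suc k) +o Bil0 M N P"
      then obtain \<beta> where b: "\<beta> \<in> Bil0 M N P" "\<phi> = S (Suc k) + \<beta>" unfolding elt_set_plus_def by auto
      have "\<phi> = (S k + \<beta>) + (\<lambda>m n. scale P (cs ! k) ((\<rho>s ! k + (\<lambda>m n. 0)) m n))"
        unfolding b(2) S_def by (auto simp: fun_eq_iff add_ac)
      moreover have "S k + \<beta> \<in> S k +o Bil0 M N P" using b(1) unfolding elt_set_plus_def by blast
      moreover have "(\<lambda>m n. scale P (cs ! k) ((\<rho>s ! k + (\<lambda>m n. 0)) m n)) \<in> A k"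
        unfolding A_def bgerm_def elt_set_plus_def using Bil0_zero[OF P, of M N] by (intro imageI) blast
      ultimately show "\<phi> \<in> (S k +o Bil0 M N P) + A k" unfolding set_plus_def by blast
    qed
    finally show ?case .
  qed
  moreover have "germ_comb M N P cs (map (bgerm M N P) \<rho>s) = Bil0 M N P + (\<Sum>i<length \<rho>s. A i)"
    unfolding germ_comb_def A_def by simp
  moreover have "bgerm M N P (lin_comb P cs \<rho>s) = S (length \<rho>s) +o Bil0 M N P"
    unfolding bgerm_def S_def lin_comb_def ..
  ultimately show ?thesis by simp
qed

text \<open>A basis of the quotient of \<open>Inv_W\<close> by \<open>Bil0\<close> in terms of
  representatives, which can be composed with other maps directly.\<close>

definition germ_basis :: "'a::ab_group_add wmod \<Rightarrow> 'b::ab_group_add wmod \<Rightarrow> 'c::ab_group_add wmod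
    \<Rightarrow> ('a \<Rightarrow> 'b \<Rightarrow> 'c) list \<Rightarrow> bool" where
  "germ_basis M N P \<rho>s \<longleftrightarrow> set \<rho>s \<subseteq> Inv_W M N P \<and>
    (\<forall>\<pi>\<in>Inv_W M N P. \<exists>cs. length cs = length \<rho>s \<and> \<pi> - lin_comb P cs \<rho>s \<in> Bil0 M N P) \<and>
    (\<forall>cs. length cs = length \<rho>s \<longrightarrow> lin_comb P cs \<rho>s \<in> Bil0 M N P \<longrightarrow> (\<forall>i<length \<rho>s. cs ! i = 0))"

lemma G_W_alt: "G_W M N P = bgerm M N P ` Inv_W M N P"
  unfolding G_W_def Inv_W_def by auto

lemma is_basis_G_W_if_germ_basis:
  assumes M: "witt_module M" and N: "witt_module N" and P: "witt_module P" and b: "germ_basis M N P \<rho>s"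
  shows "is_basis_G_W M N P (map (bgerm M N P) \<rho>s)"
  unfolding is_basis_G_W_def
proof (intro conjI ballI)
  interpret vector_space "scale P" by (rule witt_vector_space[OF P])
  show "set (map (bgerm M N P) \<rho>s) \<subseteq> G_W M N P"
    using b unfolding germ_basis_def G_W_alt by auto
  fix g assume "g \<in> G_W M N P"
  then obtain \<pi> where \<pi>: "\<pi> \<in> Inv_W M N P" "g = bgerm M N P \<pi>" unfolding G_W_alt by auto
  then obtain cs where cs: "length cs = length \<rho>s" "\<pi> - lin_comb P cs \<rho>s \<in> Bil0 M N P"
    using b unfolding germ_basis_def by blast
  show "\<exists>!cs. length cs = length (map (bgerm M N P) \<rho>s) \<and> g = germ_comb M N P cs (map (bgerm M N P) \<rho>s)"
  proof (rule ex1I[of _ cs])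
    show "length cs = length (map (bgerm M N P) \<rho>s) \<and> g = germ_comb M N P cs (map (bgerm M N P) \<rho>s)"
      using cs(1) bgerm_eqI[OF M N P cs(2)] \<pi>(2) germ_comb_eq[OF M N P] by simp
    fix ds assume ds: "length ds = length (map (bgerm M N P) \<rho>s) \<and> g = germ_comb M N P ds (map (bgerm M N P) \<rho>s)"
    then have "bgerm M N P (lin_comb P ds \<rho>s) = bgerm M N P (lin_comb P cs \<rho>s)"
      using germ_comb_eq[OF M N P] bgerm_eqI[OF M N P cs(2)] \<pi>(2) by simp
    from bgerm_eqD[OF P this] have "lin_comb P ds \<rho>s - lin_comb P cs \<rho>s \<in> Bil0 M N P" .
    also have "lin_comb P ds \<rho>s - lin_comb P cs \<rho>s = lin_comb P (map2 (-) ds cs) \<rho>s"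
      unfolding lin_comb_def using ds cs(1)
      by (auto simp: fun_eq_iff scale_left_diff_distrib sum_subtractf[symmetric] intro!: sum.cong)
    finally have "\<forall>i<length \<rho>s. map2 (-) ds cs ! i = 0"
      using b ds cs(1) unfolding germ_basis_def by simp
    then show "ds = cs" using ds cs(1) by (auto intro!: nth_equalityI)
  qed
qed

lemma G_W_trivial:
  assumes "witt_module M" "witt_module N" "witt_module P" "Inv_W M N P \<subseteq> Bil0 M N P"
  shows "G_W M N P = {bgerm M N P 0}"
proof -
  have "bgerm M N P \<pi> = bgerm M N P 0" if "\<pi> \<in> Inv_W M N P" for \<pi>
    by (rule bgerm_eqI[OF assms(1-3)]) (use that assms(4) in auto)
  moreover have "(0 :: 'a \<Rightarrow> 'b \<Rightarrow> 'c) \<in> Inv_W M N P"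
    using Bil_zero[OF assms(3), of M N] Bil0_zero[OF assms(3), of M N] Hom_zero[OF witt_act_Hom assms(3), OF assms(3)]
    unfolding Inv_W_def bil_act_def zero_fun_def by simp
  ultimately show ?thesis unfolding G_W_alt by blast
qed

section \<open>Equivariant maps far to the right\<close>

text \<open>The filter form allows the bounds of several germs to be combined by
  \<open>eventually_elim\<close>.\<close>

lemma eventually_upper:
  assumes "witt_module M" "\<exists>x. \<forall>m\<in>upper M x. Q m"
  shows "\<forall>\<^sub>F x in at_top. \<forall>m\<in>upper M x. Q m"
proof -
  obtain x where "\<forall>m\<in>upper M x. Q m" using assms(2) by blast
  then have "\<forall>m\<in>upper M y. Q m" if "x \<le> y" for y
    using upper_antimono[OF assms(1) that] by blast
  then show ?thesis unfolding eventually_at_top_linorder by blast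
qed

lemma eventually_upper2:
  assumes "witt_module M" "witt_module N" "\<exists>x. \<forall>m\<in>upper M x. \<forall>n\<in>upper N x. Q m n"
  shows "\<forall>\<^sub>F x in at_top. \<forall>m\<in>upper M x. \<forall>n\<in>upper N x. Q m n"
proof -
  obtain x where "\<forall>m\<in>upper M x. \<forall>n\<in>upper N x. Q m n" using assms(3) by blast
  then have "\<forall>m\<in>upper M y. \<forall>n\<in>upper N y. Q m n" if "x \<le> y" for y
    using upper_antimono[OF assms(1) that] upper_antimono[OF assms(2) that] by blast
  then show ?thesis unfolding eventually_at_top_linorder by blast
qed

lemma Hom_upper_subset:
  assumes M: "witt_module M" and N: "witt_module N" and f: "f \<in> Hom M N" and U: "module.subspace (scale N) U"
    and wt: "\<And>s m. x \<le> Re s \<Longrightarrow> m \<in> wt_space M s \<Longrightarrow> f m \<in> U" and m: "m \<in> upper M x"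
  shows "f m \<in> U"
proof -
  interpret M: vector_space "scale M" by (rule witt_vector_space[OF M])
  interpret N: vector_space "scale N" by (rule witt_vector_space[OF N])
  have "M.subspace {m \<in> vspace M. f m \<in> U}"
    unfolding M.subspace_def
    using witt_zero[OF M] witt_add[OF M] witt_scale[OF M] Hom_zero[OF f M] Hom_add[OF f] Hom_scale[OF f]
      N.subspace_0[OF U] N.subspace_add[OF U] N.subspace_scale[OF U] by auto
  moreover have "(\<Union>s\<in>{s. x \<le> Re s}. wt_space M s) \<subseteq> {m \<in> vspace M. f m \<in> U}"
    using wt wt_subset_vspace[of M] by blast
  ultimately have "upper M x \<subseteq> {m \<in> vspace M. f m \<in> U}"
    unfolding upper_def by (rule M.span_minimal[rotated])
  then show ?thesis using m by blast
qed

lemma subspace_upper: "witt_module M \<Longrightarrow> module.subspace (scale M) (upper M x)"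
proof -
  assume "witt_module M"
  then interpret M: vector_space "scale M" by (rule witt_vector_space)
  show ?thesis unfolding upper_def by (rule M.subspace_span)
qed

lemma Hom_W_equivariant:
  assumes "witt_module M" "f \<in> Hom_W M N"
  shows "\<forall>\<^sub>F x in at_top. \<forall>m\<in>upper M x. act N X (f m) = f (act M X m)"
proof (rule eventually_upper[OF assms(1)])
  have "(\<lambda>m. act N X (f m) - f (act M X m)) \<in> Hom0 M N"
    using assms(2) unfolding Hom_W_def by blast
  then show "\<exists>x. \<forall>m\<in>upper M x. act N X (f m) = f (act M X m)"
    unfolding Hom0_def by auto
qed

text \<open>Invariance of the germ under \<open>L 0\<close> means that weights are preserved far to
  the right. Hence vectors far to the right stay there, which makes the composition with a further
  germ well defined.\<close>

lemma Hom_W_upper: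
  assumes M: "witt_module M" and N: "witt_module N" and f: "f \<in> Hom_W M N"
  shows "\<forall>\<^sub>F x in at_top. \<forall>m\<in>upper M x. f m \<in> upper N x"
proof -
  have fH: "f \<in> Hom M N" using f unfolding Hom_W_def by blast
  obtain x where x: "\<forall>m\<in>upper M x. act N (L 0) (f m) = f (act M (L 0) m)"
    using Hom_W_equivariant[OF M f, of "L 0"] unfolding eventually_at_top_linorder by blast
  have "f m \<in> upper N y" if y: "x \<le> y" and m: "m \<in> upper M y" for y m
  proof (rule Hom_upper_subset[OF M N fH subspace_upper[OF N] _ m])
    fix s m assume s: "y \<le> Re s" and m: "m \<in> wt_space M s"
    have "m \<in> upper M x" using wt_subset_upper[OF M, of x s] y s m by auto
    then have "act N (L 0) (f m) = f (scale M s m)" using x m unfolding wt_space_def by auto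
    then have "f m \<in> wt_space N s"
      using m Hom_scale[OF fH, of m s] Hom_closed[OF fH, of m] unfolding wt_space_def by auto
    then show "f m \<in> upper N y" using wt_subset_upper[OF N s] by blast
  qed
  then show ?thesis unfolding eventually_at_top_linorder by blast
qed

lemma Bil_bil_act:
  assumes M: "witt_module M" and N: "witt_module N" and P: "witt_module P" and \<pi>: "\<pi> \<in> Bil M N P"
  shows "bil_act M N P X \<pi> \<in> Bil M N P"
proof -
  interpret P: vector_space "scale P" by (rule witt_vector_space[OF P])
  have sub: "(\<lambda>m. f m - g m) \<in> Hom Q P" if "f \<in> Hom Q P" "g \<in> Hom Q P" for f g and Q :: "'d::ab_group_add wmod"
    using Hom_comb[OF P that, of 1 "-1"] by simp
  have 1: "(\<lambda>n. bil_act M N P X \<pi> m n) \<in> Hom N P" if "m \<in> vspace M" for m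
    unfolding bil_act_def
    using \<pi> that M by (intro sub Hom_comp[OF Bil_Hom_right witt_act_Hom[OF P]] Hom_comp[OF witt_act_Hom[OF N] Bil_Hom_right] Bil_Hom_right)
      (auto intro: witt_act)
  have 2: "(\<lambda>m. bil_act M N P X \<pi> m n) \<in> Hom M P" if "n \<in> vspace N" for n
    unfolding bil_act_def
    by (intro sub Hom_comp[OF Bil_Hom_left[OF \<pi>] witt_act_Hom[OF P]] Hom_comp[OF witt_act_Hom[OF M] Bil_Hom_left[OF \<pi>]] Bil_Hom_left[OF \<pi>])
      (use that witt_act[OF N] in auto)
  show ?thesis unfolding Bil_def using 1 2 by blast
qed

lemma Inv_W_upper:
  assumes M: "witt_module M" and N: "witt_module N" and P: "witt_module P" and \<pi>: "\<pi> \<in> Inv_W M N P"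
  shows "\<forall>\<^sub>F x in at_top. \<forall>m\<in>upper M x. \<forall>n\<in>upper N x. \<pi> m n \<in> upper P x"
proof -
  interpret P: vector_space "scale P" by (rule witt_vector_space[OF P])
  have b: "\<pi> \<in> Bil M N P" using \<pi> unfolding Inv_W_def by blast
  obtain x where x: "\<forall>m\<in>upper M x. \<forall>n\<in>upper N x. bil_act M N P (L 0) \<pi> m n = 0"
    using \<pi> unfolding Inv_W_def Bil0_def by blast
  \<comment> \<open>The image has weight s + t, whose real part is at least y because both real
    parts are and y \<ge> 0; hence the \<open>max x 0\<close>.\<close>
  have wt: "\<pi> m n \<in> upper P y" if y: "max x 0 \<le> y" "y \<le> Re s" "y \<le> Re t" and m: "m \<in> wt_space M s" and n: "n \<in> wt_space N t"
    for y s t m n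
  proof -
    have mn: "m \<in> upper M x" "n \<in> upper N x"
      using wt_subset_upper[OF M, of x s] wt_subset_upper[OF N, of x t] y m n by auto
    have v: "m \<in> vspace M" "n \<in> vspace N" using m n unfolding wt_space_def by auto
    have "act P (L 0) (\<pi> m n) = \<pi> (scale M s m) n + \<pi> m (scale N t n)"
      using x mn m n unfolding bil_act_def wt_space_def by (auto simp: algebra_simps)
    also have "\<dots> = scale P (s + t) (\<pi> m n)"
      using Bil_scale_left[OF b v] Bil_scale_right[OF b v] by (simp add: P.scale_left_distrib)
    finally have "\<pi> m n \<in> wt_space P (s + t)" using Bil_closed[OF b v] unfolding wt_space_def by auto
    moreover have "y \<le> Re (s + t)" using y by simp
    ultimately show ?thesis using wt_subset_upper[OF P] by blast
  qed
  have "\<pi> m n \<in> upper P y" if y: "max x 0 \<le> y" and m: "m \<in> upper M y" and n: "n \<in> upper N y" for y m n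
  proof (rule Hom_upper_subset[OF M P Bil_Hom_left[OF b] subspace_upper[OF P] _ m])
    show nv: "n \<in> vspace N" using n upper_subset_vspace[OF N] by blast
    fix s m assume s: "y \<le> Re s" "m \<in> wt_space M s"
    then have mv: "m \<in> vspace M" unfolding wt_space_def by blast
    show "\<pi> m n \<in> upper P y"
      by (rule Hom_upper_subset[OF N P Bil_Hom_right[OF b mv] subspace_upper[OF P] _ n])
        (use wt[OF y s(1) _ s(2)] in blast)
  qed
  then show ?thesis unfolding eventually_at_top_linorder by blast
qed

section \<open>Composition with germs of linear maps\<close>

lemma Bil_comp2:
  assumes "f \<in> Hom M M'" "g \<in> Hom N N'" "h \<in> Hom P' P" "\<rho> \<in> Bil M' N' P'"
  shows "comp2 h \<rho> f g \<in> Bil M N P"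
  using assms unfolding Bil_def comp2_def Hom_def by simp

lemma Inv_W_comp2:
  assumes M: "witt_module M" and N: "witt_module N" and P: "witt_module P"
    and M': "witt_module M'" and N': "witt_module N'" and P': "witt_module P'"
    and f: "f \<in> Hom_W M M'" and g: "g \<in> Hom_W N N'" and h: "h \<in> Hom_W P' P" and \<rho>: "\<rho> \<in> Inv_W M' N' P'"
  shows "comp2 h \<rho> f g \<in> Inv_W M N P"
proof -
  have H: "f \<in> Hom M M'" "g \<in> Hom N N'" "h \<in> Hom P' P" "\<rho> \<in> Bil M' N' P'"
    using f g h \<rho> unfolding Hom_W_def Inv_W_def by auto
  have B: "comp2 h \<rho> f g \<in> Bil M N P" by (rule Bil_comp2[OF H])
  have "bil_act M N P X (comp2 h \<rho> f g) \<in> Bil0 M N P" for X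
  proof -
    have "\<exists>x. \<forall>m\<in>upper M' x. \<forall>n\<in>upper N' x. bil_act M' N' P' X \<rho> m n = 0"
      using \<rho> unfolding Inv_W_def Bil0_def by blast
    from eventually_upper2[OF M' N' this] Hom_W_equivariant[OF M f, of X] Hom_W_equivariant[OF N g, of X]
      Hom_W_equivariant[OF P' h, of X] Hom_W_upper[OF M M' f] Hom_W_upper[OF N N' g] Inv_W_upper[OF M' N' P' \<rho>]
    have "\<forall>\<^sub>F x in at_top. \<forall>m\<in>upper M x. \<forall>n\<in>upper N x. bil_act M N P X (comp2 h \<rho> f g) m n = 0"
    proof eventually_elim
      case (elim x)
      show ?case
      proof (intro ballI)
        fix m n assume m: "m \<in> upper M x" and n: "n \<in> upper N x"
        have v: "m \<in> vspace M" "n \<in> vspace N" using m n upper_subset_vspace[OF M] upper_subset_vspace[OF N] by auto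
        have v': "f m \<in> vspace M'" "g n \<in> vspace N'" using v Hom_closed H by auto
        have 1: "act P X (h (\<rho> (f m) (g n))) = h (act P' X (\<rho> (f m) (g n)))" using elim m n by blast
        have 2: "f (act M X m) = act M' X (f m)" "g (act N X n) = act N' X (g n)" using elim m n by auto
        have 3: "bil_act M' N' P' X \<rho> (f m) (g n) = 0" using elim m n by blast
        have w: "act P' X (\<rho> (f m) (g n)) \<in> vspace P'" "\<rho> (act M' X (f m)) (g n) \<in> vspace P'" "\<rho> (f m) (act N' X (g n)) \<in> vspace P'"
          using v' witt_act[OF M'] witt_act[OF N'] witt_act[OF P'] Bil_closed[OF H(4)] by auto
        have "bil_act M N P X (comp2 h \<rho> f g) m n = h (bil_act M' N' P' X \<rho> (f m) (g n))"
          unfolding bil_act_def comp2_def 1 2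
          using w by (simp add: Hom_diff[OF H(3) P'] witt_diff[OF P'])
        then show "bil_act M N P X (comp2 h \<rho> f g) m n = 0" using 3 Hom_zero[OF H(3) P'] by simp
      qed
    qed
    then have "\<exists>x. \<forall>m\<in>upper M x. \<forall>n\<in>upper N x. bil_act M N P X (comp2 h \<rho> f g) m n = 0"
      unfolding eventually_at_top_linorder by blast
    then show ?thesis unfolding Bil0_def using Bil_bil_act[OF M N P B] by blast
  qed
  then show ?thesis unfolding Inv_W_def using B by blast
qed

lemma Bil0_comp2:
  assumes M: "witt_module M" and N: "witt_module N" and M': "witt_module M'" and N': "witt_module N'" and P': "witt_module P'"
    and f: "f \<in> Hom_W M M'" and g: "g \<in> Hom_W N N'" and h: "h \<in> Hom P' P" and \<rho>: "\<rho> \<in> Bil0 M' N' P'"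
  shows "comp2 h \<rho> f g \<in> Bil0 M N P"
proof -
  have H: "f \<in> Hom M M'" "g \<in> Hom N N'" "\<rho> \<in> Bil M' N' P'"
    using f g \<rho> unfolding Hom_W_def Bil0_def by auto
  have "\<exists>x. \<forall>m\<in>upper M' x. \<forall>n\<in>upper N' x. \<rho> m n = 0" using \<rho> unfolding Bil0_def by blast
  from eventually_upper2[OF M' N' this] Hom_W_upper[OF M M' f] Hom_W_upper[OF N N' g]
  have "\<forall>\<^sub>F x in at_top. \<forall>m\<in>upper M x. \<forall>n\<in>upper N x. comp2 h \<rho> f g m n = 0"
    by eventually_elim (simp add: comp2_def Hom_zero[OF h P'])
  then show ?thesis
    unfolding Bil0_def eventually_at_top_linorder using Bil_comp2[OF H(1,2) h H(3)] by blast
qed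

lemma Bil_cong:
  assumes "\<phi> \<in> Bil M N P" "witt_module M" "witt_module N"
    "\<And>m n. m \<in> vspace M \<Longrightarrow> n \<in> vspace N \<Longrightarrow> \<phi> m n = \<psi> m n"
  shows "\<psi> \<in> Bil M N P"
  using assms(1,4) witt_add[OF assms(2)] witt_scale[OF assms(2)] witt_add[OF assms(3)] witt_scale[OF assms(3)]
  unfolding Bil_def Hom_def by simp

text \<open>Values outside the underlying spaces are arbitrary, so composites can be compared on
  \<open>vspace M\<close> and \<open>vspace N\<close> only; membership in \<open>Bil0\<close> does
  not see the difference.\<close>

lemma Bil0_cong:
  assumes "\<phi> \<in> Bil0 M N P" "witt_module M" "witt_module N"
    "\<And>m n. m \<in> vspace M \<Longrightarrow> n \<in> vspace N \<Longrightarrow> \<phi> m n = \<psi> m n"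
  shows "\<psi> \<in> Bil0 M N P"
proof -
  have "\<psi> \<in> Bil M N P" using Bil_cong[OF Bil0_subset_Bil[OF assms(1)] assms(2-4)] .
  moreover obtain x where "\<forall>m\<in>upper M x. \<forall>n\<in>upper N x. \<phi> m n = 0" using assms(1) unfolding Bil0_def by blast
  then have "\<forall>m\<in>upper M x. \<forall>n\<in>upper N x. \<psi> m n = 0"
    using assms(4) upper_subset_vspace[OF assms(2), of x] upper_subset_vspace[OF assms(3), of x] by (metis subsetD)
  ultimately show ?thesis unfolding Bil0_def by blast
qed

lemma comp2_roundtrip:
  assumes M: "witt_module M" and N: "witt_module N" and P: "witt_module P"
    and M': "witt_module M'" and N': "witt_module N'" and P': "witt_module P'"
    and f: "f \<in> Hom_W M M'" "f' \<in> Hom_W M' M" "(\<lambda>m. f' (f m) - m) \<in> Hom0 M M"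
    and g: "g \<in> Hom_W N N'" "g' \<in> Hom_W N' N" "(\<lambda>m. g' (g m) - m) \<in> Hom0 N N"
    and h: "h \<in> Hom_W P' P" "h' \<in> Hom_W P P'" "(\<lambda>m. h (h' m) - m) \<in> Hom0 P P"
    and \<pi>: "\<pi> \<in> Inv_W M N P"
  shows "\<pi> - comp2 h (comp2 h' \<pi> f' g') f g \<in> Bil0 M N P"
proof -
  interpret P: vector_space "scale P" by (rule witt_vector_space[OF P])
  have B: "\<pi> \<in> Bil M N P" "comp2 h (comp2 h' \<pi> f' g') f g \<in> Bil M N P"
    using \<pi> Inv_W_comp2[OF M N P M' N' P' f(1) g(1) h(1) Inv_W_comp2[OF M' N' P' M N P f(2) g(2) h(2) \<pi>]]
    unfolding Inv_W_def by auto
  have "\<exists>x. \<forall>m\<in>upper M x. f' (f m) = m" "\<exists>x. \<forall>m\<in>upper N x. g' (g m) = m" "\<exists>x. \<forall>m\<in>upper P x. h (h' m) = m"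
    using f(3) g(3) h(3) unfolding Hom0_def by auto
  from eventually_upper[OF M this(1)] eventually_upper[OF N this(2)] eventually_upper[OF P this(3)] Inv_W_upper[OF M N P \<pi>]
  have "\<forall>\<^sub>F x in at_top. \<forall>m\<in>upper M x. \<forall>n\<in>upper N x. (\<pi> - comp2 h (comp2 h' \<pi> f' g') f g) m n = 0"
    by eventually_elim (simp add: comp2_def)
  moreover have "\<pi> - comp2 h (comp2 h' \<pi> f' g') f g \<in> Bil M N P"
    using Bil_comb[OF P B, of 1 "-1"] by (simp add: fun_diff_def)
  ultimately show ?thesis unfolding Bil0_def eventually_at_top_linorder by blast
qed

lemma lin_comb_comp2:
  assumes P': "witt_module P'" and h: "h \<in> Hom P' P"
    and \<rho>s: "set \<rho>s \<subseteq> Bil M' N' P'" and f: "f m \<in> vspace M'" and g: "g n \<in> vspace N'"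
  shows "comp2 h (lin_comb P' cs \<rho>s) f g m n = lin_comb P cs (map (\<lambda>\<rho>. comp2 h \<rho> f g) \<rho>s) m n"
proof -
  have b: "(\<rho>s ! i) (f m) (g n) \<in> vspace P'" if "i < length \<rho>s" for i
    using Bil_closed[OF _ f g] \<rho>s that nth_mem by blast
  have "h (\<Sum>i<length \<rho>s. scale P' (cs ! i) ((\<rho>s ! i) (f m) (g n))) = (\<Sum>i<length \<rho>s. h (scale P' (cs ! i) ((\<rho>s ! i) (f m) (g n))))"
    by (rule Hom_sum[OF h P']) (use b witt_scale[OF P'] in auto)
  also have "\<dots> = (\<Sum>i<length \<rho>s. scale P (cs ! i) (h ((\<rho>s ! i) (f m) (g n))))"
    by (rule sum.cong) (use Hom_scale[OF h] b in auto)
  finally show ?thesis unfolding comp2_def lin_comb_def by simp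
qed

lemma sum_in_Bil:
  fixes k :: nat
  assumes P: "witt_module P" and "\<And>i. i < k \<Longrightarrow> \<phi> i \<in> Bil M N P"
  shows "(\<lambda>m n. \<Sum>i<k. scale P (c i) (\<phi> i m n)) \<in> Bil M N P"
proof -
  interpret P: vector_space "scale P" by (rule witt_vector_space[OF P])
  show ?thesis using assms(2)
  proof (induction k)
    case 0
    then show ?case using Bil_zero[OF P, of M N] by simp
  next
    case (Suc k)
    then show ?case using Bil_comb[OF P Suc.IH[OF Suc.prems] Suc.prems[of k], of 1 "c k"] by simp
  qed
qed

lemma sum_in_Bil0:
  fixes k :: nat
  assumes M: "witt_module M" and N: "witt_module N" and P: "witt_module P" and "\<And>i. i < k \<Longrightarrow> \<phi> i \<in> Bil0 M N P"
  shows "(\<lambda>m n. \<Sum>i<k. scale P (c i) (\<phi> i m n)) \<in> Bil0 M N P"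
proof -
  interpret P: vector_space "scale P" by (rule witt_vector_space[OF P])
  show ?thesis using assms(4)
  proof (induction k)
    case 0
    then show ?case using Bil0_zero[OF P, of M N] by simp
  next
    case (Suc k)
    then show ?case using Bil0_comb[OF M N P Suc.IH[OF Suc.prems] Suc.prems[of k], of 1 "c k"] by simp
  qed
qed

lemma Inv_W_lin_comb:
  assumes M: "witt_module M" and N: "witt_module N" and P: "witt_module P" and \<rho>s: "set \<rho>s \<subseteq> Inv_W M N P"
  shows "lin_comb P cs \<rho>s \<in> Inv_W M N P"
proof -
  interpret P: vector_space "scale P" by (rule witt_vector_space[OF P])
  have \<rho>: "\<rho>s ! i \<in> Bil M N P" "bil_act M N P X (\<rho>s ! i) \<in> Bil0 M N P" if "i < length \<rho>s" for i X
    using \<rho>s nth_mem[OF that] unfolding Inv_W_def by auto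
  have "bil_act M N P X (lin_comb P cs \<rho>s) \<in> Bil0 M N P" for X
  proof (rule Bil0_cong[OF sum_in_Bil0[OF M N P, of "length \<rho>s" "\<lambda>i. bil_act M N P X (\<rho>s ! i)" "\<lambda>i. cs ! i"] M N])
    fix m n assume mn: "m \<in> vspace M" "n \<in> vspace N"
    have v: "(\<rho>s ! i) m n \<in> vspace P" if "i < length \<rho>s" for i by (rule Bil_closed[OF \<rho>(1)[OF that] mn])
    have "act P X (\<Sum>i<length \<rho>s. scale P (cs ! i) ((\<rho>s ! i) m n)) = (\<Sum>i<length \<rho>s. act P X (scale P (cs ! i) ((\<rho>s ! i) m n)))"
      by (rule Hom_sum[OF witt_act_Hom[OF P] P]) (use v witt_scale[OF P] in auto)
    also have "\<dots> = (\<Sum>i<length \<rho>s. scale P (cs ! i) (act P X ((\<rho>s ! i) m n)))"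
      by (rule sum.cong) (use Hom_scale[OF witt_act_Hom[OF P]] v in auto)
    finally show "(\<Sum>i<length \<rho>s. scale P (cs ! i) (bil_act M N P X (\<rho>s ! i) m n)) = bil_act M N P X (lin_comb P cs \<rho>s) m n"
      unfolding bil_act_def lin_comb_def by (simp add: P.scale_right_diff_distrib sum_subtractf)
  qed (use \<rho> in auto)
  moreover have "lin_comb P cs \<rho>s \<in> Bil M N P"
    unfolding lin_comb_def by (rule sum_in_Bil[OF P]) (use \<rho> in auto)
  ultimately show ?thesis unfolding Inv_W_def by blast
qed

text \<open>Pulling a map back along the inverse germs, expanding it there and pushing it forward
  again changes it only by an element of \<open>Bil0\<close>. The opposite round trip carries
  independence over.\<close>

lemma germ_basis_transport:
  assumes M: "witt_module M" and N: "witt_module N" and P: "witt_module P"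
    and M': "witt_module M'" and N': "witt_module N'" and P': "witt_module P'"
    and f: "f \<in> germ_iso M M'" and g: "g \<in> germ_iso N N'" and h: "h \<in> germ_iso P' P"
    and basis: "germ_basis M' N' P' \<rho>s"
  shows "germ_basis M N P (map (\<lambda>\<rho>. comp2 h \<rho> f g) \<rho>s)"
proof -
  obtain f' where f': "f \<in> Hom_W M M'" "f' \<in> Hom_W M' M" "(\<lambda>m. f' (f m) - m) \<in> Hom0 M M" "(\<lambda>m. f (f' m) - m) \<in> Hom0 M' M'"
    using f unfolding germ_iso_def by blast
  obtain g' where g': "g \<in> Hom_W N N'" "g' \<in> Hom_W N' N" "(\<lambda>m. g' (g m) - m) \<in> Hom0 N N" "(\<lambda>m. g (g' m) - m) \<in> Hom0 N' N'"
    using g unfolding germ_iso_def by blast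
  obtain h' where h': "h \<in> Hom_W P' P" "h' \<in> Hom_W P P'" "(\<lambda>m. h (h' m) - m) \<in> Hom0 P P" "(\<lambda>m. h' (h m) - m) \<in> Hom0 P' P'"
    using h unfolding germ_iso_def by blast
  have H: "f \<in> Hom M M'" "g \<in> Hom N N'" "h \<in> Hom P' P" "h' \<in> Hom P P'"
    using f' g' h' unfolding Hom_W_def by auto
  interpret P: vector_space "scale P" by (rule witt_vector_space[OF P])
  interpret P': vector_space "scale P'" by (rule witt_vector_space[OF P'])
  have inv: "set \<rho>s \<subseteq> Inv_W M' N' P'" using basis unfolding germ_basis_def by blast
  then have bil: "set \<rho>s \<subseteq> Bil M' N' P'" unfolding Inv_W_def by blast
  have comb: "comp2 h (lin_comb P' cs \<rho>s) f g m n = lin_comb P cs (map (\<lambda>\<rho>. comp2 h \<rho> f g) \<rho>s) m n"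
    if "m \<in> vspace M" "n \<in> vspace N" for cs m n
    by (rule lin_comb_comp2[OF P' H(3) bil]) (use that Hom_closed H in auto)
  show ?thesis
    unfolding germ_basis_def
  proof (intro conjI ballI allI impI)
    show "set (map (\<lambda>\<rho>. comp2 h \<rho> f g) \<rho>s) \<subseteq> Inv_W M N P"
      using inv Inv_W_comp2[OF M N P M' N' P' f'(1) g'(1) h'(1)] by auto
    fix \<pi> assume \<pi>: "\<pi> \<in> Inv_W M N P"
    define \<rho> where "\<rho> = comp2 h' \<pi> f' g'"
    have \<rho>: "\<rho> \<in> Inv_W M' N' P'"
      unfolding \<rho>_def by (rule Inv_W_comp2[OF M' N' P' M N P f'(2) g'(2) h'(2) \<pi>])
    then obtain cs where cs: "length cs = length \<rho>s" "\<rho> - lin_comb P' cs \<rho>s \<in> Bil0 M' N' P'"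
      using basis unfolding germ_basis_def by blast
    have 1: "\<pi> - comp2 h \<rho> f g \<in> Bil0 M N P"
      unfolding \<rho>_def by (rule comp2_roundtrip[OF M N P M' N' P' f'(1-3) g'(1-3) h'(1-3) \<pi>])
    have 2: "comp2 h (\<rho> - lin_comb P' cs \<rho>s) f g \<in> Bil0 M N P"
      by (rule Bil0_comp2[OF M N M' N' P' f'(1) g'(1) H(3) cs(2)])
    have "\<pi> - lin_comb P cs (map (\<lambda>\<rho>. comp2 h \<rho> f g) \<rho>s) \<in> Bil0 M N P"
    proof (rule Bil0_cong[OF Bil0_add[OF M N P 1 2] M N])
      fix m n assume mn: "m \<in> vspace M" "n \<in> vspace N"
      then have v: "f m \<in> vspace M'" "g n \<in> vspace N'" using Hom_closed H by auto
      have "lin_comb P' cs \<rho>s (f m) (g n) \<in> vspace P'"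
        unfolding lin_comb_def using bil v by (intro witt_sum[OF P'] witt_scale[OF P']) (auto intro!: Bil_closed[where M = M' and N = N'])
      moreover have "\<rho> (f m) (g n) \<in> vspace P'" using \<rho> v Bil_closed unfolding Inv_W_def by blast
      ultimately have "comp2 h (\<rho> - lin_comb P' cs \<rho>s) f g m n = comp2 h \<rho> f g m n - comp2 h (lin_comb P' cs \<rho>s) f g m n"
        unfolding comp2_def by (simp add: Hom_diff[OF H(3) P'])
      then show "(\<pi> - comp2 h \<rho> f g + comp2 h (\<rho> - lin_comb P' cs \<rho>s) f g) m n = (\<pi> - lin_comb P cs (map (\<lambda>\<rho>. comp2 h \<rho> f g) \<rho>s)) m n"
        using comb[OF mn] by simp
    qed
    then show "\<exists>cs. length cs = length (map (\<lambda>\<rho>. comp2 h \<rho> f g) \<rho>s) \<and> \<pi> - lin_comb P cs (map (\<lambda>\<rho>. comp2 h \<rho> f g) \<rho>s) \<in> Bil0 M N P"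
      using cs(1) by auto
  next
    fix cs i
    assume cs: "length cs = length (map (\<lambda>\<rho>. comp2 h \<rho> f g) \<rho>s)" "lin_comb P cs (map (\<lambda>\<rho>. comp2 h \<rho> f g) \<rho>s) \<in> Bil0 M N P"
      and i: "i < length (map (\<lambda>\<rho>. comp2 h \<rho> f g) \<rho>s)"
    define \<sigma> where "\<sigma> = lin_comb P' cs \<rho>s"
    have "comp2 h \<sigma> f g \<in> Bil0 M N P"
      by (rule Bil0_cong[OF cs(2) M N]) (simp add: \<sigma>_def comb)
    then have 1: "comp2 h' (comp2 h \<sigma> f g) f' g' \<in> Bil0 M' N' P'"
      by (rule Bil0_comp2[OF M' N' M N P f'(2) g'(2) H(4)])
    have "\<sigma> \<in> Inv_W M' N' P'"
      unfolding \<sigma>_def by (rule Inv_W_lin_comb[OF M' N' P' inv])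
    then have 2: "\<sigma> - comp2 h' (comp2 h \<sigma> f g) f' g' \<in> Bil0 M' N' P'"
      by (rule comp2_roundtrip[OF M' N' P' M N P f'(2,1,4) g'(2,1,4) h'(2,1,4)])
    have "\<sigma> \<in> Bil0 M' N' P'" using Bil0_add[OF M' N' P' 2 1] by simp
    then show "cs ! i = 0" using basis cs(1) i unfolding germ_basis_def \<sigma>_def by simp
  qed
qed

section \<open>Germs on the modules \<open>\<Omega>\<close>\<close>

lemma lookup_pm_scale [simp]: "Poly_Mapping.lookup (pm_scale c p) i = c * Poly_Mapping.lookup p i"
  unfolding pm_scale_def by (simp add: Poly_Mapping.map.rep_eq when_def)

lemma keys_pm_scale: "Poly_Mapping.keys (pm_scale c p) \<subseteq> Poly_Mapping.keys p"
  by (auto simp: in_keys_iff)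

lemma vector_space_pm_scale: "vector_space pm_scale"
  by unfold_locales (auto intro!: poly_mapping_eqI simp: lookup_add algebra_simps)

interpretation pm: vector_space pm_scale by (rule vector_space_pm_scale)

lemma lookup_e: "Poly_Mapping.lookup (e x) y = (if x = y then 1 else 0)"
  unfolding e_def by (simp add: lookup_single when_def)

lemma keys_e [simp]: "Poly_Mapping.keys (e x) = {x}"
  by (auto simp: in_keys_iff lookup_e split: if_splits)

lemma lookup_sum_pm: "Poly_Mapping.lookup (\<Sum>i\<in>S. f i) x = (\<Sum>i\<in>S. Poly_Mapping.lookup (f i) x)"
  by (induction S rule: infinite_finite_induct) (auto simp: lookup_add)

lemma pm_expand: "p = (\<Sum>i\<in>Poly_Mapping.keys p. pm_scale (Poly_Mapping.lookup p i) (Poly_Mapping.single i 1))"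
proof (rule poly_mapping_eqI)
  fix k
  have "(\<Sum>i\<in>Poly_Mapping.keys p. Poly_Mapping.lookup (pm_scale (Poly_Mapping.lookup p i) (Poly_Mapping.single i 1)) k)
    = (\<Sum>i\<in>Poly_Mapping.keys p. if i = k then Poly_Mapping.lookup p k else 0)"
    by (rule sum.cong) (auto simp: lookup_single when_def)
  also have "\<dots> = Poly_Mapping.lookup p k" by (simp add: in_keys_iff)
  finally show "Poly_Mapping.lookup p k = Poly_Mapping.lookup (\<Sum>i\<in>Poly_Mapping.keys p. pm_scale (Poly_Mapping.lookup p i) (Poly_Mapping.single i 1)) k"
    unfolding lookup_sum_pm by simp
qed

text \<open>Serves both for vectors of \<open>Omega\<close>, with keys in a coset, and for elements
  of the Witt algebra.\<close>

lemma pm_span_induct [consumes 1, case_names zero single add]: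
  assumes "Poly_Mapping.keys p \<subseteq> u" "Q 0" "\<And>c i. i \<in> u \<Longrightarrow> Q (pm_scale c (Poly_Mapping.single i 1))"
    "\<And>p q. Poly_Mapping.keys p \<subseteq> u \<Longrightarrow> Poly_Mapping.keys q \<subseteq> u \<Longrightarrow> Q p \<Longrightarrow> Q q \<Longrightarrow> Q (p + q)"
  shows "Q p"
proof -
  have "Q (\<Sum>i\<in>S. pm_scale (Poly_Mapping.lookup p i) (Poly_Mapping.single i 1)) \<and>
    Poly_Mapping.keys (\<Sum>i\<in>S. pm_scale (Poly_Mapping.lookup p i) (Poly_Mapping.single i 1)) \<subseteq> u"
    if "finite S" "S \<subseteq> u" for S
    using that
  proof (induction S rule: finite_induct)
    case empty
    then show ?case using assms(2) by simp
  next
    case (insert x F)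
    have k: "Poly_Mapping.keys (pm_scale (Poly_Mapping.lookup p x) (Poly_Mapping.single x 1)) \<subseteq> u"
      using insert.prems by (auto simp: in_keys_iff lookup_single when_def split: if_splits)
    have IH: "Q (\<Sum>i\<in>F. pm_scale (Poly_Mapping.lookup p i) (Poly_Mapping.single i 1))"
      "Poly_Mapping.keys (\<Sum>i\<in>F. pm_scale (Poly_Mapping.lookup p i) (Poly_Mapping.single i 1)) \<subseteq> u"
      using insert by auto
    show ?case
      unfolding sum.insert[OF insert.hyps]
      using assms(4)[OF k IH(2) assms(3) IH(1)] insert.prems order_trans[OF keys_add Un_least[OF k IH(2)]] by auto
  qed
  from this[of "Poly_Mapping.keys p"] show ?thesis using pm_expand[of p] assms(1) by simp
qed

lemma pm_linear_superset:
  assumes "finite A" "Poly_Mapping.keys p \<subseteq> A"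
  shows "pm_linear b p = (\<Sum>i\<in>A. pm_scale (Poly_Mapping.lookup p i) (b i))"
  unfolding pm_linear_def
  by (rule sum.mono_neutral_left) (use assms in \<open>auto simp: in_keys_iff\<close>)

lemma pm_linear_add: "pm_linear b (p + q) = pm_linear b p + pm_linear b q"
proof -
  let ?A = "Poly_Mapping.keys p \<union> Poly_Mapping.keys q"
  have "pm_linear b (p + q) = (\<Sum>i\<in>?A. pm_scale (Poly_Mapping.lookup (p + q) i) (b i))"
    by (rule pm_linear_superset) (use keys_add[of p q] in auto)
  also have "\<dots> = (\<Sum>i\<in>?A. pm_scale (Poly_Mapping.lookup p i) (b i)) + (\<Sum>i\<in>?A. pm_scale (Poly_Mapping.lookup q i) (b i))"
    by (simp add: lookup_add pm.scale_left_distrib sum.distrib)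
  also have "(\<Sum>i\<in>?A. pm_scale (Poly_Mapping.lookup p i) (b i)) = pm_linear b p"
    by (rule pm_linear_superset[symmetric]) auto
  also have "(\<Sum>i\<in>?A. pm_scale (Poly_Mapping.lookup q i) (b i)) = pm_linear b q"
    by (rule pm_linear_superset[symmetric]) auto
  finally show ?thesis .
qed

lemma pm_linear_scale: "pm_linear b (pm_scale c p) = pm_scale c (pm_linear b p)"
  using pm_linear_superset[of "Poly_Mapping.keys p" "pm_scale c p" b] keys_pm_scale[of c p]
  by (simp add: pm_linear_def pm.scale_sum_right)

lemma pm_linear_single [simp]: "pm_linear b (Poly_Mapping.single i 1) = b i"
  using pm_linear_superset[of "{i}" "Poly_Mapping.single i 1" b] by simp

lemma pm_linear_e [simp]: "pm_linear b (e i) = b i"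
  unfolding e_def by simp

lemma pm_linear_zero [simp]: "pm_linear b 0 = 0"
  unfolding pm_linear_def by simp

lemma pm_linear_fun_add: "pm_linear (\<lambda>i. b i + b' i) p = pm_linear b p + pm_linear b' p"
  unfolding pm_linear_def by (simp add: pm.scale_right_distrib sum.distrib)

lemma pm_linear_fun_scale: "pm_linear (\<lambda>i. pm_scale c (b i)) p = pm_scale c (pm_linear b p)"
  unfolding pm_linear_def by (simp add: pm.scale_sum_right mult.commute)

lemma keys_pm_linear:
  assumes "\<And>i. i \<in> Poly_Mapping.keys p \<Longrightarrow> Poly_Mapping.keys (b i) \<subseteq> v"
  shows "Poly_Mapping.keys (pm_linear b p) \<subseteq> v"
proof -
  have "Poly_Mapping.keys (\<Sum>i\<in>S. pm_scale (Poly_Mapping.lookup p i) (b i)) \<subseteq> v" if "finite S" "S \<subseteq> Poly_Mapping.keys p" for S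
    using that
  proof (induction S rule: finite_induct)
    case (insert x F)
    then show ?case
      using assms[of x] keys_pm_scale[of "Poly_Mapping.lookup p x" "b x"]
      by (auto dest!: keys_add[THEN subsetD])
  qed simp
  then show ?thesis unfolding pm_linear_def by simp
qed

lemma pm_bilinear_simps:
  "pm_bilinear b (p + p') q = pm_bilinear b p q + pm_bilinear b p' q"
  "pm_bilinear b p (q + q') = pm_bilinear b p q + pm_bilinear b p q'"
  "pm_bilinear b (pm_scale c p) q = pm_scale c (pm_bilinear b p q)"
  "pm_bilinear b p (pm_scale c q) = pm_scale c (pm_bilinear b p q)"
  unfolding pm_bilinear_def
  by (simp_all add: pm_linear_add pm_linear_scale pm_linear_fun_add pm_linear_fun_scale)

lemma pm_bilinear_zero [simp]: "pm_bilinear b 0 q = 0" "pm_bilinear b p 0 = 0"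
  unfolding pm_bilinear_def by (simp_all add: pm_linear_def)

lemma pm_bilinear_single [simp]: "pm_bilinear b (Poly_Mapping.single i 1) (Poly_Mapping.single j 1) = b i j"
  unfolding pm_bilinear_def by simp

lemma keys_pm_bilinear:
  assumes "\<And>i j. i \<in> Poly_Mapping.keys p \<Longrightarrow> j \<in> Poly_Mapping.keys q \<Longrightarrow> Poly_Mapping.keys (b i j) \<subseteq> v"
  shows "Poly_Mapping.keys (pm_bilinear b p q) \<subseteq> v"
  unfolding pm_bilinear_def by (intro keys_pm_linear assms)

section \<open>The modules \<open>Omega\<close>\<close>

lemma Omega_simps [simp]:
  "vspace (Omega \<delta> u) = {p. Poly_Mapping.keys p \<subseteq> u}" "scale (Omega \<delta> u) = pm_scale"
  unfolding Omega_def by simp_all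

lemma act_Omega_L_e [simp]:
  "act (Omega \<delta> u) (L m) (e x) = pm_scale (of_int m * \<delta> + x) (e (x + of_int m))"
  unfolding Omega_def L_def e_def by simp

lemma act_Omega_scale: "act (Omega \<delta> u) X (pm_scale c p) = pm_scale c (act (Omega \<delta> u) X p)"
  and act_Omega_add: "act (Omega \<delta> u) X (p + q) = act (Omega \<delta> u) X p + act (Omega \<delta> u) X q"
  and act_Omega_add_left: "act (Omega \<delta> u) (X + Y) p = act (Omega \<delta> u) X p + act (Omega \<delta> u) Y p"
  and act_Omega_scale_left: "act (Omega \<delta> u) (pm_scale c X) p = pm_scale c (act (Omega \<delta> u) X p)"
  unfolding Omega_def by (simp_all add: pm_bilinear_simps)

lemma bracket_simps:
  "bracket (X + X') Y = bracket X Y + bracket X' Y" "bracket X (Y + Y') = bracket X Y + bracket X Y'"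
  "bracket (pm_scale c X) Y = pm_scale c (bracket X Y)" "bracket X (pm_scale c Y) = pm_scale c (bracket X Y)"
  "bracket (L m) (L n) = pm_scale (of_int (n - m)) (L (m + n))"
  "bracket 0 Y = 0" "bracket X 0 = 0"
  unfolding bracket_def L_def by (simp_all add: pm_bilinear_simps)

lemma int_coset_shift:
  assumes "u \<in> int_cosets" "x \<in> u"
  shows "x + of_int m \<in> u"
  using assms unfolding int_cosets_def elt_set_plus_def by (auto simp: add.assoc)

lemma keys_act_Omega:
  assumes u: "u \<in> int_cosets" and p: "Poly_Mapping.keys p \<subseteq> u"
  shows "Poly_Mapping.keys (act (Omega \<delta> u) X p) \<subseteq> u"
proof -
  have "Poly_Mapping.keys (pm_scale c (e (x + of_int m))) \<subseteq> u" if "x \<in> Poly_Mapping.keys p" for c x m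
    using order_trans[OF keys_pm_scale, of "e (x + of_int m)" u c] int_coset_shift[OF u, of x m] that p by auto
  then show ?thesis
    unfolding Omega_def by (simp add: keys_pm_bilinear)
qed

text \<open>Checked on \<open>L m\<close>, \<open>L n\<close> and \<open>e x\<close>, then extended
  by linearity in the vector and in each algebra element in turn.\<close>

lemma act_Omega_bracket:
  "act (Omega \<delta> u) (bracket X Y) p = act (Omega \<delta> u) X (act (Omega \<delta> u) Y p) - act (Omega \<delta> u) Y (act (Omega \<delta> u) X p)"
proof -
  have zero: "act (Omega \<delta> u) 0 p = 0" "act (Omega \<delta> u) X 0 = 0" for X p unfolding Omega_def by simp_all
  note s = act_Omega_add act_Omega_scale act_Omega_add_left act_Omega_scale_left bracket_simps zero
  have basis: "act (Omega \<delta> u) (bracket (L m) (L n)) (e x) =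
    act (Omega \<delta> u) (L m) (act (Omega \<delta> u) (L n) (e x)) - act (Omega \<delta> u) (L n) (act (Omega \<delta> u) (L m) (e x))" for m n x
  proof -
    have 1: "act (Omega \<delta> u) (bracket (L m) (L n)) (e x) =
      pm_scale (of_int (n - m) * (of_int (m + n) * \<delta> + x)) (e (x + of_int (m + n)))"
      by (simp add: s del: of_int_add of_int_diff)
    have 2: "act (Omega \<delta> u) (L k) (act (Omega \<delta> u) (L l) (e x)) =
      pm_scale ((of_int l * \<delta> + x) * (of_int k * \<delta> + (x + of_int l))) (e (x + of_int (k + l)))" for k l
      by (simp add: s add_ac)
    have "of_int (n - m) * (of_int (m + n) * \<delta> + x) =
      (of_int n * \<delta> + x) * (of_int m * \<delta> + (x + of_int n)) - (of_int m * \<delta> + x) * (of_int n * \<delta> + (x + of_int m))"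
      unfolding of_int_add of_int_diff by algebra
    then show ?thesis
      unfolding 1 2 add.commute[of n m] by (simp add: pm.scale_left_diff_distrib)
  qed
  have "Poly_Mapping.keys p \<subseteq> UNIV" by simp
  then have 1: "act (Omega \<delta> u) (bracket (L m) (L n)) p =
    act (Omega \<delta> u) (L m) (act (Omega \<delta> u) (L n) p) - act (Omega \<delta> u) (L n) (act (Omega \<delta> u) (L m) p)" for m n
  proof (induction p rule: pm_span_induct)
    case zero
    show ?case by (simp only: s diff_self pm.scale_zero_right)
  next
    case (single c x)
    show ?case unfolding e_def[symmetric] act_Omega_scale basis pm.scale_right_diff_distrib ..
  next
    case (add p q)
    then show ?case by (simp only: act_Omega_add diff_add_eq add_diff_add)
  qed
  have "Poly_Mapping.keys Y \<subseteq> UNIV" by simp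
  then have 2: "act (Omega \<delta> u) (bracket (L m) Y) p = act (Omega \<delta> u) (L m) (act (Omega \<delta> u) Y p) - act (Omega \<delta> u) Y (act (Omega \<delta> u) (L m) p)" for m
  proof (induction Y rule: pm_span_induct)
    case zero
    show ?case by (simp only: s diff_self pm.scale_zero_right)
  next
    case (single c n)
    show ?case unfolding L_def[symmetric] bracket_simps(4) act_Omega_scale_left 1 act_Omega_scale pm.scale_right_diff_distrib ..
  next
    case (add p q)
    then show ?case by (simp only: act_Omega_add act_Omega_add_left bracket_simps(2) add_diff_add)
  qed
  have "Poly_Mapping.keys X \<subseteq> UNIV" by simp
  then show ?thesis
  proof (induction X rule: pm_span_induct)
    case zero
    show ?case by (simp only: s diff_self pm.scale_zero_right)
  next
    case (single c n)
    show ?case unfolding L_def[symmetric] bracket_simps(3) act_Omega_scale_left 2 act_Omega_scale pm.scale_right_diff_distrib ..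
  next
    case (add p q)
    then show ?case by (simp only: act_Omega_add act_Omega_add_left bracket_simps(1) add_diff_add)
  qed
qed

lemma witt_module_Omega:
  assumes u: "u \<in> int_cosets"
  shows "witt_module (Omega \<delta> u)"
proof -
  have "pm.subspace {p. Poly_Mapping.keys p \<subseteq> u}"
    unfolding pm.subspace_def
  proof (intro conjI ballI allI)
    fix p q :: omega assume "p \<in> {p. Poly_Mapping.keys p \<subseteq> u}" "q \<in> {p. Poly_Mapping.keys p \<subseteq> u}"
    then show "p + q \<in> {p. Poly_Mapping.keys p \<subseteq> u}" using keys_add[of p q] by auto
  next
    fix c and p :: omega assume "p \<in> {p. Poly_Mapping.keys p \<subseteq> u}"
    then show "pm_scale c p \<in> {p. Poly_Mapping.keys p \<subseteq> u}" using keys_pm_scale[of c p] by auto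
  qed simp
  moreover have "act (Omega \<delta> u) X \<in> Hom (Omega \<delta> u) (Omega \<delta> u)" for X
    unfolding Hom_def using keys_act_Omega[OF u] by (simp add: act_Omega_add act_Omega_scale)
  ultimately show ?thesis
    unfolding witt_module_def using vector_space_pm_scale act_Omega_bracket
    by (simp add: act_Omega_add_left act_Omega_scale_left)
qed

lemma lookup_act_L0_Omega: "Poly_Mapping.lookup (act (Omega \<delta> u) (L 0) p) x = x * Poly_Mapping.lookup p x"
proof -
  have "Poly_Mapping.keys p \<subseteq> UNIV" by simp
  then show ?thesis
  proof (induction p rule: pm_span_induct)
    case zero
    show ?case unfolding Omega_def by simp
  next
    case (single c y)
    show ?case unfolding e_def[symmetric] act_Omega_scale act_Omega_L_e by (simp add: lookup_e)
  next
    case (add p q)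
    then show ?case by (simp add: act_Omega_add lookup_add distrib_left)
  qed
qed

lemma wt_space_Omega: "wt_space (Omega \<delta> u) s = {p. Poly_Mapping.keys p \<subseteq> u \<inter> {s}}"
proof -
  have "act (Omega \<delta> u) (L 0) p = pm_scale s p \<longleftrightarrow> Poly_Mapping.keys p \<subseteq> {s}" for p
  proof
    assume a: "act (Omega \<delta> u) (L 0) p = pm_scale s p"
    show "Poly_Mapping.keys p \<subseteq> {s}"
    proof
      fix x assume "x \<in> Poly_Mapping.keys p"
      then have "Poly_Mapping.lookup p x \<noteq> 0" by (simp add: in_keys_iff)
      moreover have "x * Poly_Mapping.lookup p x = s * Poly_Mapping.lookup p x"
        using arg_cong[OF a, of "\<lambda>p. Poly_Mapping.lookup p x"] by (simp add: lookup_act_L0_Omega)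
      ultimately show "x \<in> {s}" by simp
    qed
  next
    assume "Poly_Mapping.keys p \<subseteq> {s}"
    then have "x * Poly_Mapping.lookup p x = s * Poly_Mapping.lookup p x" for x
      by (cases "x = s") (auto simp: in_keys_iff)
    then show "act (Omega \<delta> u) (L 0) p = pm_scale s p"
      by (intro poly_mapping_eqI) (simp add: lookup_act_L0_Omega)
  qed
  then show ?thesis unfolding wt_space_def Omega_simps by auto
qed

lemma e_in_wt_space_Omega: "x \<in> u \<Longrightarrow> e x \<in> wt_space (Omega \<delta> u) x"
  unfolding wt_space_Omega by simp

lemma Supp_Omega: "Supp (Omega \<delta> u) = u"
proof -
  have "wt_space (Omega \<delta> u) s \<noteq> {0} \<longleftrightarrow> s \<in> u" for s
  proof
    assume "wt_space (Omega \<delta> u) s \<noteq> {0}"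
    moreover have "0 \<in> wt_space (Omega \<delta> u) s" unfolding wt_space_Omega by simp
    ultimately obtain p where "p \<in> wt_space (Omega \<delta> u) s" "p \<noteq> 0" by blast
    then have "Poly_Mapping.keys p \<subseteq> u \<inter> {s}" "Poly_Mapping.keys p \<noteq> {}" unfolding wt_space_Omega by auto
    then show "s \<in> u" by blast
  next
    assume "s \<in> u"
    moreover have "e s \<noteq> 0" using keys_e[of s] by fastforce
    ultimately show "wt_space (Omega \<delta> u) s \<noteq> {0}" using e_in_wt_space_Omega[of s u \<delta>] by blast
  qed
  then show ?thesis unfolding Supp_def by auto
qed

lemma upper_Omega:
  assumes u: "u \<in> int_cosets"
  shows "upper (Omega \<delta> u) r = {p. Poly_Mapping.keys p \<subseteq> u \<inter> {x. r \<le> Re x}}"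
proof
  have "pm.subspace {p. Poly_Mapping.keys p \<subseteq> u \<inter> {x. r \<le> Re x}}"
    unfolding pm.subspace_def
  proof (intro conjI ballI allI)
    fix p q :: omega assume "p \<in> {p. Poly_Mapping.keys p \<subseteq> u \<inter> {x. r \<le> Re x}}" "q \<in> {p. Poly_Mapping.keys p \<subseteq> u \<inter> {x. r \<le> Re x}}"
    then show "p + q \<in> {p. Poly_Mapping.keys p \<subseteq> u \<inter> {x. r \<le> Re x}}" using keys_add[of p q] by auto
  next
    fix c and p :: omega assume "p \<in> {p. Poly_Mapping.keys p \<subseteq> u \<inter> {x. r \<le> Re x}}"
    then show "pm_scale c p \<in> {p. Poly_Mapping.keys p \<subseteq> u \<inter> {x. r \<le> Re x}}" using keys_pm_scale[of c p] by auto
  qed simp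
  moreover have "(\<Union>s\<in>{s. r \<le> Re s}. wt_space (Omega \<delta> u) s) \<subseteq> {p. Poly_Mapping.keys p \<subseteq> u \<inter> {x. r \<le> Re x}}"
    unfolding wt_space_Omega by auto
  ultimately show "upper (Omega \<delta> u) r \<subseteq> {p. Poly_Mapping.keys p \<subseteq> u \<inter> {x. r \<le> Re x}}"
    unfolding upper_def Omega_simps by (rule pm.span_minimal[rotated])
next
  have sub: "pm.subspace (upper (Omega \<delta> u) r)"
    using subspace_upper[OF witt_module_Omega[OF u]] by simp
  show "{p. Poly_Mapping.keys p \<subseteq> u \<inter> {x. r \<le> Re x}} \<subseteq> upper (Omega \<delta> u) r"
  proof
    fix p :: omega assume "p \<in> {p. Poly_Mapping.keys p \<subseteq> u \<inter> {x. r \<le> Re x}}"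
    then have "Poly_Mapping.keys p \<subseteq> u \<inter> {x. r \<le> Re x}" by blast
    then show "p \<in> upper (Omega \<delta> u) r"
    proof (induction p rule: pm_span_induct)
      case (single c x)
      then have "e x \<in> upper (Omega \<delta> u) r"
        using wt_subset_upper[OF witt_module_Omega[OF u], of r x] e_in_wt_space_Omega[of x u \<delta>] by blast
      then show ?case unfolding e_def[symmetric] by (rule pm.subspace_scale[OF sub])
    qed (auto intro: pm.subspace_0[OF sub] pm.subspace_add[OF sub])
  qed
qed

lemma e_in_upper_Omega: "u \<in> int_cosets \<Longrightarrow> x \<in> u \<Longrightarrow> r \<le> Re x \<Longrightarrow> e x \<in> upper (Omega \<delta> u) r"
  unfolding upper_Omega by simp

lemma Bil0_OmegaI:
  assumes u: "u \<in> int_cosets" and v: "v \<in> int_cosets" and P: "witt_module P" and \<pi>: "\<pi> \<in> Bil (Omega \<delta>1 u) (Omega \<delta>2 v) P"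
    and 0: "\<And>x y. x \<in> u \<Longrightarrow> y \<in> v \<Longrightarrow> r \<le> Re x \<Longrightarrow> r \<le> Re y \<Longrightarrow> \<pi> (e x) (e y) = 0"
  shows "\<pi> \<in> Bil0 (Omega \<delta>1 u) (Omega \<delta>2 v) P"
proof -
  interpret P: vector_space "scale P" by (rule witt_vector_space[OF P])
  have M: "witt_module (Omega \<delta>1 u)" "witt_module (Omega \<delta>2 v)" using witt_module_Omega u v by auto
  have "\<pi> m n = 0" if m: "m \<in> upper (Omega \<delta>1 u) r" and n: "n \<in> upper (Omega \<delta>2 v) r" for m n
  proof -
    have n': "Poly_Mapping.keys n \<subseteq> v \<inter> {x. r \<le> Re x}" using n unfolding upper_Omega[OF v] by blast
    have ex: "\<pi> (e x) n = 0" if x: "x \<in> u" "r \<le> Re x" for x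
    proof -
      have H: "\<pi> (e x) \<in> Hom (Omega \<delta>2 v) P" by (rule Bil_Hom_right[OF \<pi>]) (use x in simp)
      show ?thesis using n'
      proof (induction n rule: pm_span_induct)
        case zero
        show ?case by (rule Hom_zero[OF H M(2)])
      next
        case (single c y)
        then show ?case using Hom_scale[OF H, of "e y" c] 0[of x y] x unfolding e_def[symmetric] by simp
      next
        case (add p q)
        then show ?case using Hom_add[OF H, of p q] by auto
      qed
    qed
    have H: "(\<lambda>m. \<pi> m n) \<in> Hom (Omega \<delta>1 u) P" by (rule Bil_Hom_left[OF \<pi>]) (use n' in auto)
    have "Poly_Mapping.keys m \<subseteq> u \<inter> {x. r \<le> Re x}" using m unfolding upper_Omega[OF u] by blast
    then show ?thesis
    proof (induction m rule: pm_span_induct)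
      case zero
      show ?case by (rule Hom_zero[OF H M(1)])
    next
      case (single c y)
      then show ?case using Hom_scale[OF H, of "e y" c] ex[of y] unfolding e_def[symmetric] by simp
    next
      case (add p q)
      then show ?case using Hom_add[OF H, of p q] by auto
    qed
  qed
  then show ?thesis unfolding Bil0_def using \<pi> by blast
qed

lemma Bil0_OmegaD:
  assumes u: "u \<in> int_cosets" and v: "v \<in> int_cosets" and \<pi>: "\<pi> \<in> Bil0 (Omega \<delta>1 u) (Omega \<delta>2 v) P"
  shows "\<exists>r. \<forall>x\<in>u. \<forall>y\<in>v. r \<le> Re x \<longrightarrow> r \<le> Re y \<longrightarrow> \<pi> (e x) (e y) = 0"
proof -
  obtain r where "\<forall>m\<in>upper (Omega \<delta>1 u) r. \<forall>n\<in>upper (Omega \<delta>2 v) r. \<pi> m n = 0" using \<pi> unfolding Bil0_def by blast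
  then show ?thesis using e_in_upper_Omega[OF u] e_in_upper_Omega[OF v] by blast
qed

text \<open>An element of the Witt algebra is a finite combination of the \<open>L m\<close>, so
  only finitely many bounds have to be combined.\<close>

lemma Inv_W_I:
  assumes M: "witt_module M" and N: "witt_module N" and P: "witt_module P" and \<pi>: "\<pi> \<in> Bil M N P"
    and L: "\<And>m. bil_act M N P (L m) \<pi> \<in> Bil0 M N P"
  shows "\<pi> \<in> Inv_W M N P"
proof -
  interpret P: vector_space "scale P" by (rule witt_vector_space[OF P])
  have scale: "bil_act M N P (pm_scale c X) \<pi> \<in> Bil0 M N P" if "bil_act M N P X \<pi> \<in> Bil0 M N P" for c X
  proof (rule Bil0_cong[OF Bil0_scale[OF M N P that, of c] M N])
    fix m n assume mn: "m \<in> vspace M" "n \<in> vspace N"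
    show "scale P c (bil_act M N P X \<pi> m n) = bil_act M N P (pm_scale c X) \<pi> m n"
      unfolding bil_act_def witt_act_scale_left[OF M mn(1)] witt_act_scale_left[OF N mn(2)]
        witt_act_scale_left[OF P Bil_closed[OF \<pi> mn]] Bil_scale_left[OF \<pi> witt_act[OF M mn(1)] mn(2)]
        Bil_scale_right[OF \<pi> mn(1) witt_act[OF N mn(2)]]
      by (simp add: P.scale_right_diff_distrib)
  qed
  have add: "bil_act M N P (X + Y) \<pi> \<in> Bil0 M N P"
    if "bil_act M N P X \<pi> \<in> Bil0 M N P" "bil_act M N P Y \<pi> \<in> Bil0 M N P" for X Y
  proof (rule Bil0_cong[OF Bil0_add[OF M N P that] M N])
    fix m n assume mn: "m \<in> vspace M" "n \<in> vspace N"
    show "(bil_act M N P X \<pi> + bil_act M N P Y \<pi>) m n = bil_act M N P (X + Y) \<pi> m n"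
      unfolding bil_act_def plus_fun_apply witt_act_add_left[OF M mn(1)] witt_act_add_left[OF N mn(2)]
        witt_act_add_left[OF P Bil_closed[OF \<pi> mn]]
        Bil_add_left[OF \<pi> witt_act[OF M mn(1)] mn(2) witt_act[OF M mn(1)]]
        Bil_add_right[OF \<pi> mn(1) witt_act[OF N mn(2)] witt_act[OF N mn(2)]]
      by simp
  qed
  have "bil_act M N P X \<pi> \<in> Bil0 M N P" for X
  proof -
    have "Poly_Mapping.keys X \<subseteq> UNIV" by simp
    then show ?thesis
    proof (induction X rule: pm_span_induct)
      case zero
      show ?case using scale[OF L, of 0 0] by simp
    next
      case (single c n)
      show ?case unfolding L_def[symmetric] by (rule scale[OF L])
    qed (rule add)
  qed
  then show ?thesis unfolding Inv_W_def using \<pi> by blast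
qed

lemma sum_int_cosets:
  assumes "u \<in> int_cosets" "v \<in> int_cosets"
  shows "u + v \<in> int_cosets"
proof -
  obtain r t where rt: "u = r +o \<int>" "v = t +o \<int>" using assms unfolding int_cosets_def by auto
  have "u + v = (r + t) +o \<int>"
  proof (intro set_eqI iffI)
    fix x assume "x \<in> u + v"
    then obtain i j where "i \<in> \<int>" "j \<in> \<int>" "x = (r + i) + (t + j)" unfolding rt set_plus_def elt_set_plus_def by auto
    then show "x \<in> (r + t) +o \<int>" unfolding elt_set_plus_def by (auto intro!: bexI[of _ "i + j"])
  next
    fix x assume "x \<in> (r + t) +o \<int>"
    then obtain i where i: "i \<in> \<int>" "x = (r + i) + (t + 0)" unfolding elt_set_plus_def by auto
    have "r + i \<in> u" "t + 0 \<in> v" unfolding rt elt_set_plus_def using i(1) Ints_0 by blast+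
    then show "x \<in> u + v" unfolding i(2) by (rule set_plus_intro)
  qed
  then show ?thesis unfolding int_cosets_def by blast
qed

lemma int_coset_above:
  assumes "u \<in> int_cosets"
  obtains a where "a \<in> u" "r \<le> Re a"
proof -
  obtain t where t: "u = t +o \<int>" using assms unfolding int_cosets_def by auto
  have "t + 0 \<in> u" unfolding t elt_set_plus_def by auto
  then have "t + of_int \<lceil>r - Re t\<rceil> \<in> u" using int_coset_shift[OF assms] by fastforce
  moreover have "r \<le> Re (t + of_int \<lceil>r - Re t\<rceil>)" by simp linarith
  ultimately show ?thesis using that by blast
qed

lemma int_coset_nat:
  assumes "u \<in> int_cosets" "a \<in> u" "x \<in> u" "Re a \<le> Re x"
  obtains i :: nat where "x = a + of_nat i"
proof -
  obtain t where t: "u = t +o \<int>" using assms unfolding int_cosets_def by auto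
  obtain k l where kl: "x = t + of_int k" "a = t + of_int l" using assms(2,3) unfolding t elt_set_plus_def by (auto elim!: Ints_cases)
  then have "l \<le> k" using assms(4) by simp
  then have "x = a + of_nat (nat (k - l))" using kl by simp
  then show ?thesis using that by blast
qed

lemma int_coset_add_nat: "u \<in> int_cosets \<Longrightarrow> a \<in> u \<Longrightarrow> a + of_nat i \<in> u"
  using int_coset_shift[of u a "int i"] by simp

section \<open>Coefficient functions of germs on \<open>Omega\<close>\<close>

text \<open>\<open>L 0\<close> forces the value at \<open>e x\<close>, \<open>e y\<close> into the
  one-dimensional weight space of x + y and so provides the coefficient; \<open>L 1\<close> and
  \<open>L 2\<close> give the equations for all m. Three bounds have a common maximum
  \<open>r\<close>.\<close>

lemma Inv_W_Omega_sol:
  assumes u: "u \<in> int_cosets" and v: "v \<in> int_cosets" and \<pi>: "\<pi> \<in> Inv_W (Omega \<delta>1 u) (Omega \<delta>2 v) (Omega \<gamma> (u + v))"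
  shows "\<exists>r. \<forall>a\<in>u. \<forall>b\<in>v. r \<le> Re a \<longrightarrow> r \<le> Re b \<longrightarrow> (\<exists>c. sol \<delta>1 \<delta>2 \<gamma> a b c \<and>
    (\<forall>i j. \<pi> (e (a + of_nat i)) (e (b + of_nat j)) = pm_scale (c i j) (e (a + of_nat i + (b + of_nat j)))))"
proof -
  let ?M = "Omega \<delta>1 u" and ?N = "Omega \<delta>2 v" and ?P = "Omega \<gamma> (u + v)"
  have W: "witt_module ?M" "witt_module ?N" "witt_module ?P"
    using witt_module_Omega u v sum_int_cosets[OF u v] by auto
  have B: "\<pi> \<in> Bil ?M ?N ?P" using \<pi> unfolding Inv_W_def by blast
  have "\<exists>x. \<forall>m\<in>upper ?M x. \<forall>n\<in>upper ?N x. bil_act ?M ?N ?P (L k) \<pi> m n = 0" for k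
    using \<pi> unfolding Inv_W_def Bil0_def by blast
  from eventually_upper2[OF W(1,2) this[of 0]] eventually_upper2[OF W(1,2) this[of 1]] eventually_upper2[OF W(1,2) this[of 2]]
  have "\<forall>\<^sub>F x in at_top. \<forall>m\<in>upper ?M x. \<forall>n\<in>upper ?N x. \<forall>k\<in>{0, 1, 2}. bil_act ?M ?N ?P (L k) \<pi> m n = 0"
    by eventually_elim blast
  then obtain r where r: "\<And>m n k. m \<in> upper ?M r \<Longrightarrow> n \<in> upper ?N r \<Longrightarrow> k \<in> {0, 1, 2} \<Longrightarrow> bil_act ?M ?N ?P (L k) \<pi> m n = 0"
    unfolding eventually_at_top_linorder by blast
  show ?thesis
  proof (intro exI[of _ r] ballI impI)
    fix a b assume a: "a \<in> u" "r \<le> Re a" and b: "b \<in> v" "r \<le> Re b"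
    define X Y where "X i = a + of_nat i" and "Y j = b + of_nat j" for i j
    have uv: "X i \<in> u" "Y i \<in> v" for i unfolding X_def Y_def using int_coset_add_nat u v a b by auto
    have Re: "r \<le> Re (X i)" "r \<le> Re (Y i)" for i unfolding X_def Y_def using a b by simp_all
    define c where "c i j = Poly_Mapping.lookup (\<pi> (e (X i)) (e (Y j))) (X i + Y j)" for i j
    have act: "act ?P (L k) (\<pi> (e (X i)) (e (Y j))) =
      pm_scale (of_int k * \<delta>1 + X i) (\<pi> (e (X i + of_int k)) (e (Y j))) + pm_scale (of_int k * \<delta>2 + Y j) (\<pi> (e (X i)) (e (Y j + of_int k)))"
      if "k \<in> {0, 1, 2}" for k i j
    proof -
      have "bil_act ?M ?N ?P (L k) \<pi> (e (X i)) (e (Y j)) = 0"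
        using r[OF e_in_upper_Omega[OF u uv(1) Re(1)] e_in_upper_Omega[OF v uv(2) Re(2)] that] .
      moreover have "\<pi> (pm_scale c (e (X i + of_int k))) (e (Y j)) = pm_scale c (\<pi> (e (X i + of_int k)) (e (Y j)))" for c
        using Bil_scale_left[OF B, of "e (X i + of_int k)" "e (Y j)"] uv int_coset_shift[OF u uv(1)] by simp
      moreover have "\<pi> (e (X i)) (pm_scale c (e (Y j + of_int k))) = pm_scale c (\<pi> (e (X i)) (e (Y j + of_int k)))" for c
        using Bil_scale_right[OF B, of "e (X i)" "e (Y j + of_int k)"] uv int_coset_shift[OF v uv(2)] by simp
      moreover have "A = B + C" if "A - B - C = 0" for A B C :: omega using that by (simp add: algebra_simps)
      ultimately show ?thesis unfolding bil_act_def act_Omega_L_e by metis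
    qed
    have val: "\<pi> (e (X i)) (e (Y j)) = pm_scale (c i j) (e (X i + Y j))" for i j
    proof -
      have "act ?P (L 0) (\<pi> (e (X i)) (e (Y j))) = pm_scale (X i + Y j) (\<pi> (e (X i)) (e (Y j)))"
        using act[of 0 i j] by (simp add: pm.scale_left_distrib)
      then have "\<pi> (e (X i)) (e (Y j)) \<in> wt_space ?P (X i + Y j)"
        using Bil_closed[OF B, of "e (X i)" "e (Y j)"] uv unfolding wt_space_def by simp
      then have k: "Poly_Mapping.keys (\<pi> (e (X i)) (e (Y j))) \<subseteq> {X i + Y j}" unfolding wt_space_Omega by blast
      show ?thesis
      proof (rule poly_mapping_eqI)
        fix z
        show "Poly_Mapping.lookup (\<pi> (e (X i)) (e (Y j))) z = Poly_Mapping.lookup (pm_scale (c i j) (e (X i + Y j))) z"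
          using k by (cases "z = X i + Y j") (auto simp: c_def lookup_e in_keys_iff)
      qed
    qed
    have eq: "(X i + Y j + of_nat k * \<gamma>) * c i j = (X i + of_nat k * \<delta>1) * c (i + k) j + (Y j + of_nat k * \<delta>2) * c i (j + k)"
      if k: "k \<in> {1, 2}" for i j k
    proof -
      have "int k \<in> {0, 1, 2}" using k by auto
      note A = act[OF this, of i j]
      have s: "X i + of_int (int k) = X (i + k)" "Y j + of_int (int k) = Y (j + k)" unfolding X_def Y_def by simp_all
      have "Poly_Mapping.lookup (act ?P (L (int k)) (\<pi> (e (X i)) (e (Y j)))) (X i + Y j + of_nat k) = c i j * (of_nat k * \<gamma> + (X i + Y j))"
        unfolding val act_Omega_scale act_Omega_L_e by (simp add: lookup_e)
      moreover have "Poly_Mapping.lookup (\<pi> (e (X (i + k))) (e (Y j))) (X i + Y j + of_nat k) = c (i + k) j"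
        unfolding val by (simp add: lookup_e X_def)
      moreover have "Poly_Mapping.lookup (\<pi> (e (X i)) (e (Y (j + k)))) (X i + Y j + of_nat k) = c i (j + k)"
        unfolding val by (simp add: lookup_e Y_def)
      ultimately show ?thesis
        using arg_cong[OF A, of "\<lambda>p. Poly_Mapping.lookup p (X i + Y j + of_nat k)"] unfolding s lookup_add lookup_pm_scale
        by (simp add: algebra_simps)
    qed
    have "sol \<delta>1 \<delta>2 \<gamma> a b c"
      by (rule sol_from_generators) (use eq[of 1] eq[of 2] in \<open>simp_all add: X_def Y_def\<close>)
    then show "\<exists>c. sol \<delta>1 \<delta>2 \<gamma> a b c \<and> (\<forall>i j. \<pi> (e (a + of_nat i)) (e (b + of_nat j)) = pm_scale (c i j) (e (a + of_nat i + (b + of_nat j))))"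
      using val unfolding X_def Y_def by blast
  qed
qed

lemma Inv_W_OmegaI:
  assumes u: "u \<in> int_cosets" and v: "v \<in> int_cosets" and Q: "Q \<in> Bil (Omega \<delta>1 u) (Omega \<delta>2 v) (Omega \<gamma> (u + v))"
    and q: "\<And>x y. Q (e x) (e y) = pm_scale (q x y) (e (x + y))"
    and eq: "\<And>x y m. 0 < Re x \<Longrightarrow> 0 < Re y \<Longrightarrow> 0 < Re (x + m) \<Longrightarrow> 0 < Re (y + m) \<Longrightarrow>
      (x + y + m * \<gamma>) * q x y = (x + m * \<delta>1) * q (x + m) y + (y + m * \<delta>2) * q x (y + m)"
  shows "Q \<in> Inv_W (Omega \<delta>1 u) (Omega \<delta>2 v) (Omega \<gamma> (u + v))"
proof -
  let ?M = "Omega \<delta>1 u" and ?N = "Omega \<delta>2 v" and ?P = "Omega \<gamma> (u + v)"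
  have W: "witt_module ?M" "witt_module ?N" "witt_module ?P"
    using witt_module_Omega u v sum_int_cosets[OF u v] by auto
  show ?thesis
  proof (rule Inv_W_I[OF W Q])
    fix m
    \<comment> \<open>The bound 1 + |m| keeps x + m and y + m in the right half plane also for
      negative m; \<open>eq\<close> is assumed only there.\<close>
    show "bil_act ?M ?N ?P (L m) Q \<in> Bil0 ?M ?N ?P"
    proof (rule Bil0_OmegaI[OF u v W(3) Bil_bil_act[OF W Q], where r = "1 + \<bar>real_of_int m\<bar>"])
      fix x y assume x: "x \<in> u" and y: "y \<in> v" and R: "1 + \<bar>real_of_int m\<bar> \<le> Re x" "1 + \<bar>real_of_int m\<bar> \<le> Re y"
      have l: "Q (pm_scale c (e (x + of_int m))) (e y) = pm_scale c (Q (e (x + of_int m)) (e y))" for c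
        using Bil_scale_left[OF Q, of "e (x + of_int m)" "e y"] x y int_coset_shift[OF u] by simp
      have r: "Q (e x) (pm_scale c (e (y + of_int m))) = pm_scale c (Q (e x) (e (y + of_int m)))" for c
        using Bil_scale_right[OF Q, of "e x" "e (y + of_int m)"] x y int_coset_shift[OF v] by simp
      have eq': "(x + y + of_int m * \<gamma>) * q x y = (x + of_int m * \<delta>1) * q (x + of_int m) y + (y + of_int m * \<delta>2) * q x (y + of_int m)"
        by (rule eq) (use R in auto)
      have s: "x + of_int m + y = x + y + of_int m" "x + (y + of_int m) = x + y + of_int m" by simp_all
      show "bil_act ?M ?N ?P (L m) Q (e x) (e y) = 0"
        unfolding bil_act_def act_Omega_L_e l r q act_Omega_scale s
        by (rule poly_mapping_eqI, unfold lookup_minus lookup_pm_scale lookup_e Poly_Mapping.lookup_zero)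
          (use eq' in \<open>simp add: algebra_simps\<close>)
    qed
  qed
qed

section \<open>The operators of the table\<close>

lemma pm_linear_Hom:
  assumes "\<And>x. x \<in> u \<Longrightarrow> Poly_Mapping.keys (b x) \<subseteq> v"
  shows "pm_linear b \<in> Hom (Omega \<delta> u) (Omega \<delta>' v)"
proof -
  have "Poly_Mapping.keys (pm_linear b p) \<subseteq> v" if "Poly_Mapping.keys p \<subseteq> u" for p
    by (rule keys_pm_linear) (use assms that in blast)
  then show ?thesis unfolding Hom_def by (simp add: pm_linear_add pm_linear_scale)
qed

lemma pm_bilinear_Bil:
  assumes "\<And>x y. x \<in> u \<Longrightarrow> y \<in> v \<Longrightarrow> Poly_Mapping.keys (b x y) \<subseteq> w"
  shows "pm_bilinear b \<in> Bil (Omega \<delta>1 u) (Omega \<delta>2 v) (Omega \<gamma> w)"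
proof -
  have "Poly_Mapping.keys (pm_bilinear b p q) \<subseteq> w" if "Poly_Mapping.keys p \<subseteq> u" "Poly_Mapping.keys q \<subseteq> v" for p q
    by (rule keys_pm_bilinear) (use assms that in blast)
  then show ?thesis unfolding Bil_def Hom_def by (simp add: pm_bilinear_simps)
qed

lemma keys_pm_scale_e: "x \<in> u \<Longrightarrow> Poly_Mapping.keys (pm_scale c (e x)) \<subseteq> u"
  using keys_pm_scale[of c "e x"] by auto

lemma op_Bil:
  "op_P \<in> Bil (Omega \<delta>1 u) (Omega \<delta>2 v) (Omega \<gamma> (u + v))"
  "op_B \<delta> \<delta>' \<in> Bil (Omega \<delta>1 u) (Omega \<delta>2 v) (Omega \<gamma> (u + v))"
  "op_G \<in> Bil (Omega \<delta>1 u) (Omega \<delta>2 v) (Omega \<gamma> (u + v))"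
proof -
  have k: "Poly_Mapping.keys (pm_scale c (e (x + y))) \<subseteq> u + v" if "x \<in> u" "y \<in> v" for c x y
    by (rule keys_pm_scale_e[OF set_plus_intro[OF that]])
  have k1: "Poly_Mapping.keys (e (x + y)) \<subseteq> u + v" if "x \<in> u" "y \<in> v" for x y
    using k[OF that, of 1] by simp
  show "op_P \<in> Bil (Omega \<delta>1 u) (Omega \<delta>2 v) (Omega \<gamma> (u + v))"
    unfolding op_P_def by (rule pm_bilinear_Bil[OF k1])
  show "op_B \<delta> \<delta>' \<in> Bil (Omega \<delta>1 u) (Omega \<delta>2 v) (Omega \<gamma> (u + v))"
    unfolding op_B_def by (rule pm_bilinear_Bil[OF k])
  show "op_G \<in> Bil (Omega \<delta>1 u) (Omega \<delta>2 v) (Omega \<gamma> (u + v))"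
    unfolding op_G_def by (rule pm_bilinear_Bil[OF k])
qed

lemma op_Hom:
  "op_d \<in> Hom (Omega \<delta> u) (Omega \<delta>' u)" "op_dinv \<in> Hom (Omega \<delta> u) (Omega \<delta>' u)" "id \<in> Hom (Omega \<delta> u) (Omega \<delta>' u)"
  unfolding op_d_def op_dinv_def by (intro pm_linear_Hom keys_pm_scale_e; assumption)+ (simp add: Hom_def)

lemma comp2_op_Bil:
  assumes "h \<in> {op_d, op_dinv, id}" "f \<in> {op_d, op_dinv, id}" "g \<in> {op_d, op_dinv, id}"
    "Q \<in> Bil (Omega \<delta>1 u) (Omega \<delta>2 v) (Omega \<gamma> (u + v))"
  shows "comp2 h Q f g \<in> Bil (Omega \<delta>1 u) (Omega \<delta>2 v) (Omega \<gamma> (u + v))"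
  by (rule Bil_comp2[OF _ _ _ assms(4)]) (use assms(1-3) op_Hom in auto)

lemma op_e:
  "op_P (e x) (e y) = e (x + y)"
  "op_B \<delta> \<delta>' (e x) (e y) = pm_scale (\<delta>' * x - \<delta> * y) (e (x + y))"
  "op_G (e x) (e y) = pm_scale ((x - y) * (2 * x + y) * (x + 2 * y)) (e (x + y))"
  "op_d (e x) = pm_scale x (e x)" "op_dinv (e x) = pm_scale (inverse x) (e x)"
  unfolding op_P_def op_B_def op_G_def op_d_def op_dinv_def pm_bilinear_def by simp_all

lemma op_scale:
  "op_P (pm_scale c p) q = pm_scale c (op_P p q)" "op_P p (pm_scale c q) = pm_scale c (op_P p q)"
  "op_B \<delta> \<delta>' (pm_scale c p) q = pm_scale c (op_B \<delta> \<delta>' p q)" "op_B \<delta> \<delta>' p (pm_scale c q) = pm_scale c (op_B \<delta> \<delta>' p q)"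
  "op_d (pm_scale c p) = pm_scale c (op_d p)" "op_dinv (pm_scale c p) = pm_scale c (op_dinv p)"
  unfolding op_P_def op_B_def op_d_def op_dinv_def by (simp_all add: pm_bilinear_simps pm_linear_scale)

text \<open>The half plane avoids the poles of the entries with \<open>op_dinv\<close>. A
  coefficient may vanish at a single point, as x - y does on the diagonal; three neighbouring points
  detect that no linear factor is identically 0.\<close>

lemma table_coefficients:
  assumes "table (\<delta>1, \<delta>2, \<gamma>) Q"
  shows "Q \<in> Bil (Omega \<delta>1 u) (Omega \<delta>2 v) (Omega \<gamma> (u + v)) \<and>
    (\<exists>q. (\<forall>x y. Q (e x) (e y) = pm_scale (q x y) (e (x + y))) \<and>
      (\<forall>x y m. 0 < Re x \<longrightarrow> 0 < Re y \<longrightarrow> 0 < Re (x + m) \<longrightarrow> 0 < Re (y + m) \<longrightarrow>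
        (x + y + m * \<gamma>) * q x y = (x + m * \<delta>1) * q (x + m) y + (y + m * \<delta>2) * q x (y + m)) \<and>
      (\<not> {\<delta>1, \<delta>2, \<gamma>} \<subseteq> {0, 1} \<longrightarrow> (\<forall>x y. 0 < Re x \<longrightarrow> 0 < Re y \<longrightarrow> q x y \<noteq> 0 \<or> q (x + 1) y \<noteq> 0 \<or> q x (y + 1) \<noteq> 0)))"
proof -
  have nz: "x \<noteq> 0" if "0 < Re x" for x using that by auto
  define C where "C Q q \<longleftrightarrow> Q \<in> Bil (Omega \<delta>1 u) (Omega \<delta>2 v) (Omega \<gamma> (u + v)) \<and>
    (\<forall>x y. Q (e x) (e y) = pm_scale (q x y) (e (x + y))) \<and>
      (\<forall>x y m. 0 < Re x \<longrightarrow> 0 < Re y \<longrightarrow> 0 < Re (x + m) \<longrightarrow> 0 < Re (y + m) \<longrightarrow>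
        (x + y + m * \<gamma>) * q x y = (x + m * \<delta>1) * q (x + m) y + (y + m * \<delta>2) * q x (y + m)) \<and>
      (\<not> {\<delta>1, \<delta>2, \<gamma>} \<subseteq> {0, 1} \<longrightarrow> (\<forall>x y. 0 < Re x \<longrightarrow> 0 < Re y \<longrightarrow> q x y \<noteq> 0 \<or> q (x + 1) y \<noteq> 0 \<or> q x (y + 1) \<noteq> 0))"
    for Q and q :: "complex \<Rightarrow> complex \<Rightarrow> complex"
  note val = op_e op_scale comp2_def
  have CI: "C Q q" if "Q \<in> Bil (Omega \<delta>1 u) (Omega \<delta>2 v) (Omega \<gamma> (u + v))"
    "\<And>x y. Q (e x) (e y) = pm_scale (q x y) (e (x + y))"
    "\<And>x y m. 0 < Re x \<Longrightarrow> 0 < Re y \<Longrightarrow> 0 < Re (x + m) \<Longrightarrow> 0 < Re (y + m) \<Longrightarrow>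
        (x + y + m * \<gamma>) * q x y = (x + m * \<delta>1) * q (x + m) y + (y + m * \<delta>2) * q x (y + m)"
    "\<And>x y. \<not> {\<delta>1, \<delta>2, \<gamma>} \<subseteq> {0, 1} \<Longrightarrow> 0 < Re x \<Longrightarrow> 0 < Re y \<Longrightarrow> q x y \<noteq> 0 \<or> q (x + 1) y \<noteq> 0 \<or> q x (y + 1) \<noteq> 0"
    for Q q using that unfolding C_def by blast
  have pos: "2 * x + y \<noteq> 0" "x + 2 * y \<noteq> 0" "x + y \<noteq> 0" "- 2 * x - y \<noteq> 0" "x + 1 + y \<noteq> 0" "x + (y + 1) \<noteq> 0"
    "2 * (x + 1) + y \<noteq> 0" "x + 1 + 2 * y \<noteq> 0" "x \<noteq> 0" "x + 1 \<noteq> 0" "y \<noteq> 0" "y + 1 \<noteq> 0"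
    if "0 < Re x" "0 < Re y" for x y :: complex
  proof -
    have "0 < Re (2 * x + y)" "0 < Re (x + 2 * y)" "0 < Re (x + y)" "0 < Re (- (- 2 * x - y))" "0 < Re (x + 1 + y)" "0 < Re (x + (y + 1))"
      "0 < Re (2 * (x + 1) + y)" "0 < Re (x + 1 + 2 * y)" "0 < Re (x + 1)" "0 < Re (y + 1)"
      using that by auto
    then show "2 * x + y \<noteq> 0" "x + 2 * y \<noteq> 0" "x + y \<noteq> 0" "- 2 * x - y \<noteq> 0" "x + 1 + y \<noteq> 0" "x + (y + 1) \<noteq> 0"
      "2 * (x + 1) + y \<noteq> 0" "x + 1 + 2 * y \<noteq> 0" "x \<noteq> 0" "x + 1 \<noteq> 0" "y \<noteq> 0" "y + 1 \<noteq> 0"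
      using that nz by (force dest: nz)+
  qed
  have frac: "x + m \<noteq> 0" "y + m \<noteq> 0" "x + m + y \<noteq> 0" "x + (y + m) \<noteq> 0" "x + y \<noteq> 0" "x \<noteq> 0" "y \<noteq> 0"
    if "0 < Re x" "0 < Re y" "0 < Re (x + m)" "0 < Re (y + m)" for x y m :: complex
    using that pos(3)[of "x + m" y] pos(3)[of x "y + m"] nz[of "x + m"] nz[of "y + m"] pos[of x y] by auto
  have "\<exists>q. C Q q"
    using assms
  proof cases
    case 1
    then have d: "\<delta>1 = - 2 / 3" "\<delta>2 = - 2 / 3" "\<gamma> = 5 / 3" and Q: "Q = op_G" by simp_all
    have "C Q (\<lambda>x y. (x - y) * (2 * x + y) * (x + 2 * y))"
      unfolding Q
    proof (rule CI, goal_cases)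
      case 1 show ?case by (rule op_Bil)
    next
      case (2 x y) show ?case by (simp add: val mult_ac)
    next
      case (3 x y m)
      \<comment> \<open>Denominators are cleared, so that an identity with integral coefficients
        remains.\<close>
      have "3 * \<delta>1 = - 2" "3 * \<delta>2 = - 2" "3 * \<gamma> = 5" unfolding d by simp_all
      then show ?case by algebra
    next
      case (4 x y) then show ?case using pos[of x y] by auto
    qed
    then show ?thesis by blast
  next
    case 2
    then have d: "\<delta>1 = 0" "\<delta>2 = 0" "\<gamma> = 3" and Q: "Q = comp2 id (op_B 1 1) op_d op_d" by simp_all
    have "C Q (\<lambda>x y. x * y * (x - y))"
      unfolding Q
    proof (rule CI, goal_cases)
      case 1 show ?case by (rule comp2_op_Bil[OF _ _ _ op_Bil(2)]) auto
    next
      case (2 x y) show ?case by (simp add: val mult_ac)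
    next
      case (3 x y m) show ?case unfolding d by algebra
    next
      case (4 x y)
      show ?case
      proof (rule ccontr)
        assume "\<not> ?case"
        then have *: "x - y = 0" "x + 1 - y = 0"
          using pos[of x y] 4 by auto
        show False using * by algebra
      qed
    qed
    then show ?thesis by blast
  next
    case 3
    then have d: "\<delta>1 = 0" "\<delta>2 = - 2" "\<gamma> = 1" and Q: "Q = comp2 op_d (op_B 1 (- 2)) op_d id" by simp_all
    have "C Q (\<lambda>x y. x * (- 2 * x - y) * (x + y))"
      unfolding Q
    proof (rule CI, goal_cases)
      case 1 show ?case by (rule comp2_op_Bil[OF _ _ _ op_Bil(2)]) auto
    next
      case (2 x y) show ?case by (simp add: val mult_ac)
    next
      case (3 x y m) show ?case unfolding d by algebra
    next
      case (4 x y) then show ?case using pos[of x y] by auto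
    qed
    then show ?thesis by blast
  next
    case 4
    then have d: "\<delta>1 = - 2" "\<delta>2 = 0" "\<gamma> = 1" and Q: "Q = comp2 op_d (op_B (- 2) 1) id op_d" by simp_all
    have "C Q (\<lambda>x y. y * (x + 2 * y) * (x + y))"
      unfolding Q
    proof (rule CI, goal_cases)
      case 1 show ?case by (rule comp2_op_Bil[OF _ _ _ op_Bil(2)]) auto
    next
      case (2 x y) show ?case by (simp add: val mult_ac)
    next
      case (3 x y m) show ?case unfolding d by algebra
    next
      case (4 x y) then show ?case using pos[of x y] by auto
    qed
    then show ?thesis by blast
  next
    case 5
    then have d: "\<delta>1 = 0" "\<gamma> = \<delta>2 + 2" and Q: "Q = comp2 id (op_B 1 \<delta>2) op_d id" by simp_all
    have "C Q (\<lambda>x y. x * (\<delta>2 * x - y))"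
      unfolding Q
    proof (rule CI, goal_cases)
      case 1 show ?case by (rule comp2_op_Bil[OF _ _ _ op_Bil(2)]) auto
    next
      case (2 x y) show ?case by (simp add: val mult_ac)
    next
      case (3 x y m) show ?case unfolding d by algebra
    next
      case (4 x y)
      show ?case
      proof (rule ccontr)
        assume "\<not> ?case"
        then have *: "\<delta>2 * x - y = 0" "\<delta>2 * x - (y + 1) = 0"
          using pos[of x y] 4 by auto
        show False using * by algebra
      qed
    qed
    then show ?thesis by blast
  next
    case 6
    then have d: "\<delta>2 = 0" "\<gamma> = \<delta>1 + 2" and Q: "Q = comp2 id (op_B \<delta>1 1) id op_d" by simp_all
    have "C Q (\<lambda>x y. y * (x - \<delta>1 * y))"
      unfolding Q
    proof (rule CI, goal_cases)
      case 1 show ?case by (rule comp2_op_Bil[OF _ _ _ op_Bil(2)]) auto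
    next
      case (2 x y) show ?case by (simp add: val mult_ac)
    next
      case (3 x y m) show ?case unfolding d by algebra
    next
      case (4 x y)
      show ?case
      proof (rule ccontr)
        assume "\<not> ?case"
        then have *: "x - \<delta>1 * y = 0" "x + 1 - \<delta>1 * y = 0"
          using pos[of x y] 4 by auto
        show False using * by algebra
      qed
    qed
    then show ?thesis by blast
  next
    case 7
    then have d: "\<delta>2 = - \<delta>1 - 1" "\<gamma> = 1" and Q: "Q = comp2 op_d (op_B \<delta>1 (- \<delta>1 - 1)) id id" by simp_all
    have "C Q (\<lambda>x y. ((- \<delta>1 - 1) * x - \<delta>1 * y) * (x + y))"
      unfolding Q
    proof (rule CI, goal_cases)
      case 1 show ?case by (rule comp2_op_Bil[OF _ _ _ op_Bil(2)]) auto
    next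
      case (2 x y) show ?case by (simp add: val mult_ac)
    next
      case (3 x y m) show ?case unfolding d by algebra
    next
      case (4 x y)
      show ?case
      proof (rule ccontr)
        assume "\<not> ?case"
        then have *: "(- \<delta>1 - 1) * x - \<delta>1 * y = 0" "(- \<delta>1 - 1) * (x + 1) - \<delta>1 * y = 0" "(- \<delta>1 - 1) * x - \<delta>1 * (y + 1) = 0"
          using pos[of x y] 4 by auto
        show False using * by algebra
      qed
    qed
    then show ?thesis by blast
  next
    case 8
    then have d: "\<gamma> = \<delta>1 + \<delta>2 + 1" and Q: "Q = op_B \<delta>1 \<delta>2" by simp_all
    have "C Q (\<lambda>x y. \<delta>2 * x - \<delta>1 * y)"
      unfolding Q
    proof (rule CI, goal_cases)
      case 1 show ?case by (rule op_Bil)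
    next
      case (2 x y) show ?case by (simp add: val mult_ac)
    next
      case (3 x y m) show ?case unfolding d by algebra
    next
      case (4 x y)
      show ?case
      proof (rule ccontr)
        assume "\<not> ?case"
        then have *: "\<delta>2 * x - \<delta>1 * y = 0" "\<delta>2 * (x + 1) - \<delta>1 * y = 0" "\<delta>2 * x - \<delta>1 * (y + 1) = 0"
          using pos[of x y] 4 by auto
        \<comment> \<open>Vanishing at the three points forces \<delta>1 = \<delta>2 = 0 and hence
          \<gamma> = 1, a triple inside {0, 1}.\<close>
        have "\<delta>1 = 0" "\<delta>2 = 0" using * by algebra+
        then show False using 4(1) d by simp
      qed
    qed
    then show ?thesis by blast
  next
    case 9
    then have d: "\<gamma> = \<delta>1 + \<delta>2" and Q: "Q = op_P" by simp_all
    have "C Q (\<lambda>x y. 1)"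
      unfolding Q
    proof (rule CI, goal_cases)
      case 1 show ?case by (rule op_Bil)
    next
      case (2 x y) show ?case by (simp add: val mult_ac)
    next
      case (3 x y m) show ?case unfolding d by algebra
    next
      case (4 x y) then show ?case using pos[of x y] by auto
    qed
    then show ?thesis by blast
  next
    case 10
    then have d: "\<delta>1 = 1" "\<gamma> = \<delta>2" and Q: "Q = comp2 id op_P op_dinv id" by simp_all
    have "C Q (\<lambda>x y. inverse x)"
      unfolding Q
    proof (rule CI, goal_cases)
      case 1 show ?case by (rule comp2_op_Bil[OF _ _ _ op_Bil(1)]) auto
    next
      case (2 x y) show ?case by (simp add: val mult_ac)
    next
      case (3 x y m) show ?case
        unfolding d using frac[OF 3] by (simp add: divide_simps; algebra?)
    next
      case (4 x y) then show ?case using pos[of x y] by auto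
    qed
    then show ?thesis by blast
  next
    case 11
    then have d: "\<delta>2 = 1" "\<gamma> = \<delta>1" and Q: "Q = comp2 id op_P id op_dinv" by simp_all
    have "C Q (\<lambda>x y. inverse y)"
      unfolding Q
    proof (rule CI, goal_cases)
      case 1 show ?case by (rule comp2_op_Bil[OF _ _ _ op_Bil(1)]) auto
    next
      case (2 x y) show ?case by (simp add: val mult_ac)
    next
      case (3 x y m) show ?case
        unfolding d using frac[OF 3] by (simp add: divide_simps; algebra?)
    next
      case (4 x y) then show ?case using pos[of x y] by auto
    qed
    then show ?thesis by blast
  next
    case 12
    then have d: "\<delta>2 = 1 - \<delta>1" "\<gamma> = 0" and Q: "Q = comp2 op_dinv op_P id id" by simp_all
    have "C Q (\<lambda>x y. inverse (x + y))"
      unfolding Q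
    proof (rule CI, goal_cases)
      case 1 show ?case by (rule comp2_op_Bil[OF _ _ _ op_Bil(1)]) auto
    next
      case (2 x y) show ?case by (simp add: val mult_ac)
    next
      case (3 x y m) show ?case
        unfolding d using frac[OF 3] by (simp add: divide_simps; algebra?)
    next
      case (4 x y) then show ?case using pos[of x y] by auto
    qed
    then show ?thesis by blast
  qed
  then show ?thesis unfolding C_def by blast
qed

section \<open>Bases of the spaces of germs on \<open>Omega\<close>\<close>

lemma Bil0_Omega_quadrant:
  assumes u: "u \<in> int_cosets" and v: "v \<in> int_cosets" and P: "witt_module P" and \<pi>: "\<pi> \<in> Bil (Omega \<delta>1 u) (Omega \<delta>2 v) P"
    and a: "a \<in> u" and b: "b \<in> v"
    and 0: "\<And>i j. k \<le> i \<Longrightarrow> k \<le> j \<Longrightarrow> \<pi> (e (a + of_nat i)) (e (b + of_nat j)) = 0"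
  shows "\<pi> \<in> Bil0 (Omega \<delta>1 u) (Omega \<delta>2 v) P"
proof (rule Bil0_OmegaI[OF u v P \<pi>, where r = "max (Re a + real k) (Re b + real k)"])
  fix x y assume x: "x \<in> u" "max (Re a + real k) (Re b + real k) \<le> Re x" and y: "y \<in> v" "max (Re a + real k) (Re b + real k) \<le> Re y"
  obtain i where i: "x = a + of_nat i" by (rule int_coset_nat[OF u a x(1)]) (use x in auto)
  obtain j where j: "y = b + of_nat j" by (rule int_coset_nat[OF v b y(1)]) (use y in auto)
  have "k \<le> i" "k \<le> j" using x(2) y(2) unfolding i j by auto
  then show "\<pi> (e x) (e y) = 0" unfolding i j by (rule 0)
qed

lemma Inv_W_Omega_far:
  assumes u: "u \<in> int_cosets" and v: "v \<in> int_cosets" and \<pi>: "\<pi> \<in> Inv_W (Omega \<delta>1 u) (Omega \<delta>2 v) (Omega \<gamma> (u + v))"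
  obtains a b c where "a \<in> u" "b \<in> v" "0 < Re a" "0 < Re b" "sol \<delta>1 \<delta>2 \<gamma> a b c"
    "\<And>i j. \<pi> (e (a + of_nat i)) (e (b + of_nat j)) = pm_scale (c i j) (e (a + of_nat i + (b + of_nat j)))"
proof -
  obtain r where r: "\<forall>a\<in>u. \<forall>b\<in>v. r \<le> Re a \<longrightarrow> r \<le> Re b \<longrightarrow> (\<exists>c. sol \<delta>1 \<delta>2 \<gamma> a b c \<and>
    (\<forall>i j. \<pi> (e (a + of_nat i)) (e (b + of_nat j)) = pm_scale (c i j) (e (a + of_nat i + (b + of_nat j)))))"
    using Inv_W_Omega_sol[OF u v \<pi>] by blast
  obtain a where a: "a \<in> u" "max r 1 \<le> Re a" using int_coset_above[OF u] by blast
  obtain b where b: "b \<in> v" "max r 1 \<le> Re b" using int_coset_above[OF v] by blast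
  have "0 < Re a" "0 < Re b" using a b by auto
  then show ?thesis using that r[rule_format, OF a(1) b(1)] a b by auto
qed

lemma germ_basis_Omega_table:
  assumes u: "u \<in> int_cosets" and v: "v \<in> int_cosets" and triple: "\<not> {\<delta>1, \<delta>2, \<gamma>} \<subseteq> {0, 1}"
    and Q: "table (\<delta>1, \<delta>2, \<gamma>) Q"
  shows "germ_basis (Omega \<delta>1 u) (Omega \<delta>2 v) (Omega \<gamma> (u + v)) [Q]"
proof -
  let ?M = "Omega \<delta>1 u" and ?N = "Omega \<delta>2 v" and ?P = "Omega \<gamma> (u + v)"
  have W: "witt_module ?M" "witt_module ?N" "witt_module ?P"
    using witt_module_Omega u v sum_int_cosets[OF u v] by auto
  obtain q where B: "Q \<in> Bil ?M ?N ?P" and q: "\<And>x y. Q (e x) (e y) = pm_scale (q x y) (e (x + y))"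
    and eq: "\<And>x y m. 0 < Re x \<Longrightarrow> 0 < Re y \<Longrightarrow> 0 < Re (x + m) \<Longrightarrow> 0 < Re (y + m) \<Longrightarrow>
        (x + y + m * \<gamma>) * q x y = (x + m * \<delta>1) * q (x + m) y + (y + m * \<delta>2) * q x (y + m)"
    and nz: "\<And>x y. 0 < Re x \<Longrightarrow> 0 < Re y \<Longrightarrow> q x y \<noteq> 0 \<or> q (x + 1) y \<noteq> 0 \<or> q x (y + 1) \<noteq> 0"
    using table_coefficients[OF Q, of u v] triple by blast
  have inv: "Q \<in> Inv_W ?M ?N ?P" by (rule Inv_W_OmegaI[OF u v B q eq])
  have lc: "lin_comb ?P [\<kappa>] [Q] = (\<lambda>m n. pm_scale \<kappa> (Q m n))" for \<kappa> unfolding lin_comb_def by simp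
  have lcB: "lin_comb ?P [\<kappa>] [Q] \<in> Bil ?M ?N ?P" for \<kappa>
    using Inv_W_lin_comb[OF W, of "[Q]" "[\<kappa>]"] inv unfolding Inv_W_def by auto
  have span: "\<exists>\<kappa>. \<pi> - lin_comb ?P [\<kappa>] [Q] \<in> Bil0 ?M ?N ?P" if \<pi>: "\<pi> \<in> Inv_W ?M ?N ?P" for \<pi>
  proof -
    obtain a b c where a: "a \<in> u" and b: "b \<in> v" and ab: "0 < Re a" "0 < Re b" and c: "sol \<delta>1 \<delta>2 \<gamma> a b c"
      "\<And>i j. \<pi> (e (a + of_nat i)) (e (b + of_nat j)) = pm_scale (c i j) (e (a + of_nat i + (b + of_nat j)))"
      using Inv_W_Omega_far[OF u v \<pi>] by blast
    have sq: "sol \<delta>1 \<delta>2 \<gamma> a b (\<lambda>i j. q (a + of_nat i) (b + of_nat j))"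
      unfolding sol_def
    proof (intro allI impI)
      fix m i j :: nat
      show "(a + of_nat i + (b + of_nat j) + of_nat m * \<gamma>) * q (a + of_nat i) (b + of_nat j) =
        (a + of_nat i + of_nat m * \<delta>1) * q (a + of_nat (i + m)) (b + of_nat j) +
        (b + of_nat j + of_nat m * \<delta>2) * q (a + of_nat i) (b + of_nat (j + m))"
        using eq[of "a + of_nat i" "b + of_nat j" "of_nat m"] ab by (simp add: add.assoc)
    qed
    obtain i0 j0 where ij: "q (a + of_nat i0) (b + of_nat j0) \<noteq> 0" "5 \<le> i0" "5 \<le> j0"
    proof -
      \<comment> \<open>All three points lie in the range i, j \<ge> 5, where the polynomial normal
        form holds.\<close>
      have "q (a + of_nat 5) (b + of_nat 5) \<noteq> 0 \<or> q (a + of_nat 6) (b + of_nat 5) \<noteq> 0 \<or> q (a + of_nat 5) (b + of_nat 6) \<noteq> 0"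
        using nz[of "a + 5" "b + 5"] ab by (simp add: add.assoc)
      then show ?thesis using that[of 5 5] that[of 6 5] that[of 5 6] by auto
    qed
    obtain \<kappa> where \<kappa>: "\<And>i j. 5 \<le> i \<Longrightarrow> 5 \<le> j \<Longrightarrow> c i j = \<kappa> * q (a + of_nat i) (b + of_nat j)"
      using sol_proportional[OF c(1) sq ab triple ij] by blast
    have "\<pi> - lin_comb ?P [\<kappa>] [Q] \<in> Bil0 ?M ?N ?P"
    proof (rule Bil0_Omega_quadrant[OF u v W(3) _ a b, where k = 5])
      have "\<pi> \<in> Bil ?M ?N ?P" using \<pi> unfolding Inv_W_def by blast
      from Bil_comb[OF W(3) this lcB[of \<kappa>], of 1 "-1"] show "\<pi> - lin_comb ?P [\<kappa>] [Q] \<in> Bil ?M ?N ?P"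
        by (simp add: fun_diff_def)
      show "(\<pi> - lin_comb ?P [\<kappa>] [Q]) (e (a + of_nat i)) (e (b + of_nat j)) = 0" if "5 \<le> i" "5 \<le> j" for i j
        unfolding lc using c(2)[of i j] \<kappa>[OF that] q by simp
    qed
    then show ?thesis by blast
  qed
  have indep: "\<kappa> = 0" if z: "lin_comb ?P [\<kappa>] [Q] \<in> Bil0 ?M ?N ?P" for \<kappa>
  proof -
    obtain r where r: "\<And>x y. x \<in> u \<Longrightarrow> y \<in> v \<Longrightarrow> r \<le> Re x \<Longrightarrow> r \<le> Re y \<Longrightarrow> lin_comb ?P [\<kappa>] [Q] (e x) (e y) = 0"
      using Bil0_OmegaD[OF u v z] by blast
    have k: "\<kappa> * q x y = 0" if "x \<in> u" "y \<in> v" "r \<le> Re x" "r \<le> Re y" for x y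
      using arg_cong[OF r[OF that], of "\<lambda>p. Poly_Mapping.lookup p (x + y)"] unfolding lc q by (simp add: lookup_e)
    obtain a where a: "a \<in> u" "max r 1 \<le> Re a" using int_coset_above[OF u] by blast
    obtain b where b: "b \<in> v" "max r 1 \<le> Re b" using int_coset_above[OF v] by blast
    have "a + 1 \<in> u" "b + 1 \<in> v" using int_coset_add_nat[OF u a(1), of 1] int_coset_add_nat[OF v b(1), of 1] by auto
    then have "\<kappa> * q a b = 0" "\<kappa> * q (a + 1) b = 0" "\<kappa> * q a (b + 1) = 0" using k a b by auto
    then show ?thesis using nz[of a b] a b by auto
  qed
  show ?thesis
    unfolding germ_basis_def
  proof (intro conjI ballI allI impI)
    show "set [Q] \<subseteq> Inv_W ?M ?N ?P" using inv by simp
    show "\<exists>cs. length cs = length [Q] \<and> \<pi> - lin_comb ?P cs [Q] \<in> Bil0 ?M ?N ?P" if \<pi>: "\<pi> \<in> Inv_W ?M ?N ?P" for \<pi>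
    proof -
      obtain \<kappa> where "\<pi> - lin_comb ?P [\<kappa>] [Q] \<in> Bil0 ?M ?N ?P" using span[OF \<pi>] by blast
      then show ?thesis by (intro exI[of _ "[\<kappa>]"]) simp
    qed
    fix cs :: "complex list" and i assume cs: "length cs = length [Q]" "lin_comb ?P cs [Q] \<in> Bil0 ?M ?N ?P" "i < length [Q]"
    then obtain \<kappa> where "cs = [\<kappa>]" by (auto simp: length_Suc_conv)
    then show "cs ! i = 0" using indep cs by simp
  qed
qed

lemma germ_basis_Omega_empty:
  assumes u: "u \<in> int_cosets" and v: "v \<in> int_cosets" and triple: "\<not> {\<delta>1, \<delta>2, \<gamma>} \<subseteq> {0, 1}"
    and z: "(\<delta>1, \<delta>2, \<gamma>) \<notin> zset"
  shows "germ_basis (Omega \<delta>1 u) (Omega \<delta>2 v) (Omega \<gamma> (u + v)) []"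
proof -
  let ?M = "Omega \<delta>1 u" and ?N = "Omega \<delta>2 v" and ?P = "Omega \<gamma> (u + v)"
  have W: "witt_module ?P" using witt_module_Omega sum_int_cosets[OF u v] by auto
  have "\<pi> \<in> Bil0 ?M ?N ?P" if \<pi>: "\<pi> \<in> Inv_W ?M ?N ?P" for \<pi>
  proof -
    obtain a b c where a: "a \<in> u" and b: "b \<in> v" and ab: "0 < Re a" "0 < Re b" and c: "sol \<delta>1 \<delta>2 \<gamma> a b c"
      "\<And>i j. \<pi> (e (a + of_nat i)) (e (b + of_nat j)) = pm_scale (c i j) (e (a + of_nat i + (b + of_nat j)))"
      using Inv_W_Omega_far[OF u v \<pi>] by blast
    have "c i j = 0" if "5 \<le> i" "5 \<le> j" for i j
      using sol_in_zset[OF c(1) ab triple _ that] z by blast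
    then show ?thesis
      using Bil0_Omega_quadrant[OF u v W _ a b, of \<pi> \<delta>1 \<delta>2 5] \<pi> c(2) unfolding Inv_W_def by simp
  qed
  then show ?thesis unfolding germ_basis_def lin_comb_def by (auto simp: fun_diff_def)
qed

lemma germ_basis_Omega_0_0_1:
  assumes u: "u \<in> int_cosets" and v: "v \<in> int_cosets"
  shows "germ_basis (Omega 0 u) (Omega 0 v) (Omega 1 (u + v)) [comp2 id op_P id op_d, comp2 id op_P op_d id]"
proof -
  let ?M = "Omega 0 u" and ?N = "Omega 0 v" and ?P = "Omega 1 (u + v)"
  let ?Q = "comp2 id op_P id op_d" and ?R = "comp2 id op_P op_d id"
  have W: "witt_module ?M" "witt_module ?N" "witt_module ?P"
    using witt_module_Omega u v sum_int_cosets[OF u v] by auto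
  have B: "?Q \<in> Bil ?M ?N ?P" "?R \<in> Bil ?M ?N ?P"
    by (rule comp2_op_Bil[OF _ _ _ op_Bil(1)]; simp)+
  have Q: "?Q (e x) (e y) = pm_scale y (e (x + y))" "?R (e x) (e y) = pm_scale x (e (x + y))" for x y
    by (simp_all add: comp2_def op_e op_scale)
  have inv: "?Q \<in> Inv_W ?M ?N ?P" "?R \<in> Inv_W ?M ?N ?P"
    by (rule Inv_W_OmegaI[OF u v B(1) Q(1)], algebra, rule Inv_W_OmegaI[OF u v B(2) Q(2)], algebra)
  have lc: "lin_comb ?P [k, l] [?Q, ?R] = (\<lambda>m n. pm_scale k (?Q m n) + pm_scale l (?R m n))" for k l
    unfolding lin_comb_def by (simp add: numeral_2_eq_2)
  have lcB: "lin_comb ?P [k, l] [?Q, ?R] \<in> Bil ?M ?N ?P" for k l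
    using Inv_W_lin_comb[OF W, of "[?Q, ?R]" "[k, l]"] inv unfolding Inv_W_def by auto
  have span: "\<exists>k l. \<pi> - lin_comb ?P [k, l] [?Q, ?R] \<in> Bil0 ?M ?N ?P" if \<pi>: "\<pi> \<in> Inv_W ?M ?N ?P" for \<pi>
  proof -
    obtain a b c where a: "a \<in> u" and b: "b \<in> v" and ab: "0 < Re a" "0 < Re b" and c: "sol 0 0 1 a b c"
      "\<And>i j. \<pi> (e (a + of_nat i)) (e (b + of_nat j)) = pm_scale (c i j) (e (a + of_nat i + (b + of_nat j)))"
      using Inv_W_Omega_far[OF u v \<pi>] by blast
    \<comment> \<open>The first operator applies \<open>op_d\<close> to the second argument, so its
      coordinate \<open>k\<close> belongs to y and \<open>l\<close> to x.\<close>
    obtain l k where kl: "\<And>i j. 5 \<le> i \<Longrightarrow> 5 \<le> j \<Longrightarrow> c i j = l * (a + of_nat i) + k * (b + of_nat j)"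
      using sol_linear[OF c(1) ab] by blast
    have "\<pi> - lin_comb ?P [k, l] [?Q, ?R] \<in> Bil0 ?M ?N ?P"
    proof (rule Bil0_Omega_quadrant[OF u v W(3) _ a b, where k = 5])
      have "\<pi> \<in> Bil ?M ?N ?P" using \<pi> unfolding Inv_W_def by blast
      from Bil_comb[OF W(3) this lcB[of k l], of 1 "-1"] show "\<pi> - lin_comb ?P [k, l] [?Q, ?R] \<in> Bil ?M ?N ?P"
        by (simp add: fun_diff_def)
      show "(\<pi> - lin_comb ?P [k, l] [?Q, ?R]) (e (a + of_nat i)) (e (b + of_nat j)) = 0" if "5 \<le> i" "5 \<le> j" for i j
        unfolding lc fun_diff_def c(2) kl[OF that] Q
        by (simp add: pm.scale_left_distrib pm.scale_right_distrib distrib_left add_ac)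
    qed
    then show ?thesis by blast
  qed
  have indep: "k = 0 \<and> l = 0" if z: "lin_comb ?P [k, l] [?Q, ?R] \<in> Bil0 ?M ?N ?P" for k l
  proof -
    obtain r where r: "\<And>x y. x \<in> u \<Longrightarrow> y \<in> v \<Longrightarrow> r \<le> Re x \<Longrightarrow> r \<le> Re y \<Longrightarrow> lin_comb ?P [k, l] [?Q, ?R] (e x) (e y) = 0"
      using Bil0_OmegaD[OF u v z] by blast
    have k: "k * y + l * x = 0" if "x \<in> u" "y \<in> v" "r \<le> Re x" "r \<le> Re y" for x y
      using arg_cong[OF r[OF that], of "\<lambda>p. Poly_Mapping.lookup p (x + y)"] unfolding lc Q by (simp add: lookup_e lookup_add)
    obtain a where a: "a \<in> u" "max r 1 \<le> Re a" using int_coset_above[OF u] by blast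
    obtain b where b: "b \<in> v" "max r 1 \<le> Re b" using int_coset_above[OF v] by blast
    have "a + 1 \<in> u" "b + 1 \<in> v" using int_coset_add_nat[OF u a(1), of 1] int_coset_add_nat[OF v b(1), of 1] by auto
    \<comment> \<open>The differences of these values are \<open>k\<close> and \<open>l\<close>
      themselves.\<close>
    then have "k * b + l * a = 0" "k * (b + 1) + l * a = 0" "k * b + l * (a + 1) = 0" using k a b by auto
    then show ?thesis by algebra
  qed
  show ?thesis
    unfolding germ_basis_def
  proof (intro conjI ballI allI impI)
    show "set [?Q, ?R] \<subseteq> Inv_W ?M ?N ?P" using inv by simp
    show "\<exists>cs. length cs = length [?Q, ?R] \<and> \<pi> - lin_comb ?P cs [?Q, ?R] \<in> Bil0 ?M ?N ?P" if \<pi>: "\<pi> \<in> Inv_W ?M ?N ?P" for \<pi>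
    proof -
      obtain k l where "\<pi> - lin_comb ?P [k, l] [?Q, ?R] \<in> Bil0 ?M ?N ?P" using span[OF \<pi>] by blast
      then show ?thesis by (intro exI[of _ "[k, l]"]) simp
    qed
    fix cs :: "complex list" and i assume cs: "length cs = length [?Q, ?R]" "lin_comb ?P cs [?Q, ?R] \<in> Bil0 ?M ?N ?P" "i < length [?Q, ?R]"
    then obtain k l where kl: "cs = [k, l]" by (auto simp: length_Suc_conv)
    then have "k = 0 \<and> l = 0" using indep[of k l] cs(2) by simp
    moreover have "i = 0 \<or> i = 1" using cs(3) by auto
    ultimately show "cs ! i = 0" using kl by auto
  qed
qed

lemma table_exists:
  assumes "(\<delta>1, \<delta>2, \<gamma>) \<in> zset_star"
  shows "\<exists>Q. table (\<delta>1, \<delta>2, \<gamma>) Q"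
proof -
  have t7: "\<exists>Q. table (\<delta>, - 1 - \<delta>, 1) Q" for \<delta>
    using table.intros(7)[of \<delta>] by (auto simp: minus_diff_commute)
  \<comment> \<open>The point (1, 1, 0) is the only one listed in \<open>zset\<close> without a row
    in the table; its entries lie in {0, 1}.\<close>
  from assms have "(\<delta>1, \<delta>2, \<gamma>) \<in> zset" "(\<delta>1, \<delta>2, \<gamma>) \<noteq> (1, 1, 0)" unfolding zset_star_def by auto
  then show ?thesis
    unfolding zset_iff using table.intros t7 by (elim disjE conjE) (simp, blast)+
qed

section \<open>Germs of the modules of the class S\<close>

text \<open>Structure constants \<open>L\<^sub>m v\<^sub>i = f m i v\<^bsub>i + m\<^esub>\<close>, the weight of \<open>v\<^sub>i\<close> being \<open>a + i\<close>.\<close>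

definition struct_const :: "complex \<Rightarrow> (int \<Rightarrow> int \<Rightarrow> complex) \<Rightarrow> bool" where
  "struct_const a f \<longleftrightarrow> (\<forall>m n i. f m (i + n) * f n i - f n (i + m) * f m i = (of_int n - of_int m) * f (m + n) i)
     \<and> (\<forall>i. f 0 i = a + of_int i)"

text \<open>The structure constants after replacing each basis vector v_i by v_i / c_i.\<close>

definition rescale :: "(int \<Rightarrow> complex) \<Rightarrow> (int \<Rightarrow> int \<Rightarrow> complex) \<Rightarrow> int \<Rightarrow> int \<Rightarrow> complex" where
  "rescale c f m i = f m i * c (i + m) / c i"

text \<open>The structure constants of \<open>Omega\<close>. Bounding both the source and the target
  index admits negative m as long as they do not lead out of the region.\<close>

definition standard_from :: "complex \<Rightarrow> complex \<Rightarrow> int \<Rightarrow> (int \<Rightarrow> int \<Rightarrow> complex) \<Rightarrow> bool" where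
  "standard_from a \<delta> k f \<longleftrightarrow> (\<forall>m i. k \<le> i \<longrightarrow> k \<le> i + m \<longrightarrow> f m i = of_int m * \<delta> + (a + of_int i))"

lemma struct_const_rel:
  assumes "struct_const a f"
  shows "f m (i + n) * f n i - f n (i + m) * f m i = (of_int n - of_int m) * f (m + n) i"
  using assms unfolding struct_const_def by blast

lemma struct_const_rescale:
  assumes f: "struct_const a f" and c: "\<And>i. c i \<noteq> 0"
  shows "struct_const a (rescale c f)"
  unfolding struct_const_def
proof (intro conjI allI)
  fix m n i
  have "rescale c f m (i + n) * rescale c f n i - rescale c f n (i + m) * rescale c f m i
    = (f m (i + n) * f n i - f n (i + m) * f m i) * c (i + (m + n)) / c i"
    unfolding rescale_def using c[of i] c[of "i + n"] c[of "i + m"]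
    by (simp add: field_simps add_ac)
  then show "rescale c f m (i + n) * rescale c f n i - rescale c f n (i + m) * rescale c f m i
    = (of_int n - of_int m) * rescale c f (m + n) i"
    unfolding struct_const_rel[OF f] rescale_def by simp
qed (use f c in \<open>auto simp: struct_const_def rescale_def\<close>)

lemma rescale_rescale:
  assumes "\<And>i. c i \<noteq> 0" "\<And>i. c' i \<noteq> 0"
  shows "rescale c' (rescale c f) = rescale (\<lambda>i. c i * c' i) f"
  unfolding rescale_def by (intro ext) (use assms in \<open>simp add: field_simps\<close>)

lemma struct_const_step:
  assumes f: "struct_const a f"
  shows "f (- k) (i + k) * f k i - f (- k) i * f k (i - k) = 2 * of_int k * (a + of_int i)"
proof -
  have "f (- k) (i + k) * f k i - f k (i + - k) * f (- k) i = (of_int k - of_int (- k)) * f (- k + k) i"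
    by (rule struct_const_rel[OF f])
  moreover have "f 0 i = a + of_int i" using f unfolding struct_const_def by blast
  ultimately show ?thesis by (simp add: mult.commute)
qed

text \<open>By [L_(-1), L_1] = 2 L_0 the difference between L_(-1) L_1 and x (x + 1) does not depend
  on the weight x. Writing this Casimir value as \<delta> (1 - \<delta>) gives the factorisation,
  with \<delta> determined up to exchange with 1 - \<delta>.\<close>

lemma struct_const_casimir:
  assumes f: "struct_const a f"
  obtains \<delta> where "\<And>i. f (- 1) (i + 1) * f 1 i = (a + of_int i + \<delta>) * (a + of_int i + 1 - \<delta>)"
proof -
  define p where "p i = f (- 1) (i + 1) * f 1 i - (a + of_int i) * (a + of_int i + 1)" for i
  have step: "p i = p (i - 1)" for i
    using struct_const_step[OF f, of 1 i] unfolding p_def by (simp add: algebra_simps)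
  have p: "p i = p 0" for i
  proof (induction i rule: int_induct[where k = 0])
    case (step1 i)
    then show ?case using step[of "i + 1"] by simp
  next
    case (step2 i)
    then show ?case using step[of i] by simp
  qed simp
  define \<delta> where "\<delta> = (1 + csqrt (1 - 4 * p 0)) / 2"
  have "4 * (\<delta> * (1 - \<delta>)) = (1 + csqrt (1 - 4 * p 0)) * (1 - csqrt (1 - 4 * p 0))"
    unfolding \<delta>_def by (simp add: field_simps)
  also have "\<dots> = 1 - (csqrt (1 - 4 * p 0))\<^sup>2" by (simp add: algebra_simps power2_eq_square)
  also have "\<dots> = 4 * p 0" by simp
  finally have "p 0 = \<delta> * (1 - \<delta>)" by simp
  then have "f (- 1) (i + 1) * f 1 i = (a + of_int i + \<delta>) * (a + of_int i + 1 - \<delta>)" for i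
    using p[of i] unfolding p_def by (simp add: algebra_simps)
  then show ?thesis using that by blast
qed

lemma nonneg_rescaling:
  fixes q :: "int \<Rightarrow> complex"
  assumes "\<And>i. 0 \<le> i \<Longrightarrow> q i \<noteq> 0"
  obtains c where "\<And>i. c i \<noteq> 0" "\<And>i. 0 \<le> i \<Longrightarrow> c (i + 1) = q i * c i"
proof
  define C where "C = rec_nat (1::complex) (\<lambda>n z. q (int n) * z)"
  have C: "C 0 = 1" "C (Suc n) = q (int n) * C n" for n unfolding C_def by simp_all
  have "C n \<noteq> 0" for n by (induction n) (use C assms in auto)
  then show "(if 0 \<le> i then C (nat i) else 1) \<noteq> 0" for i by simp
  show "(if 0 \<le> i + 1 then C (nat (i + 1)) else 1) = q i * (if 0 \<le> i then C (nat i) else 1)" if "0 \<le> i" for i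
    using C(2)[of "nat i"] that by (simp add: nat_add_distrib)
qed

text \<open>The relations [L_1, L_n] = (n - 1) L_(n+1) and [L_(-1), L_(-n)] = (1 - n) L_(-n-1)
  produce all other operators, and the intermediate indices stay nonnegative.\<close>

lemma standard_from_generators:
  assumes f: "struct_const a f"
    and 1: "\<And>i. 0 \<le> i \<Longrightarrow> f 1 i = a + of_int i + \<delta>" "\<And>i. 0 \<le> i \<Longrightarrow> f (- 1) (i + 1) = a + of_int i + 1 - \<delta>"
    and 2: "\<And>i. 0 \<le> i \<Longrightarrow> f 2 i = a + of_int i + 2 * \<delta>" "\<And>i. 0 \<le> i \<Longrightarrow> f (- 2) (i + 2) = a + of_int i + 2 - 2 * \<delta>"
  shows "standard_from a \<delta> 0 f"
proof -
  have pos: "\<forall>i\<ge>0. f (int (Suc n)) i = of_int (int (Suc n)) * \<delta> + (a + of_int i)" for n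
  proof (induction n rule: less_induct)
    case (less n)
    consider "n = 0" | "n = 1" | k where "n = Suc k" "1 \<le> k" by (metis One_nat_def Suc_leI neq0_conv not0_implies_Suc)
    then show ?case
    proof cases
      case 3
      define N where "N = (of_nat n :: complex)"
      have IH: "f (int n) i = N * \<delta> + (a + of_int i)" if "0 \<le> i" for i using less[of k] 3 that unfolding N_def by simp
      have N1: "N - 1 \<noteq> 0" using 3 unfolding N_def by auto
      show ?thesis
      proof (intro allI impI)
        fix i :: int assume i: "0 \<le> i"
        have "f 1 (i + int n) * f (int n) i - f (int n) (i + 1) * f 1 i = (N - 1) * f (1 + int n) i"
          using struct_const_rel[OF f, of 1 i "int n"] unfolding N_def by simp
        moreover have "f 1 (i + int n) = a + of_int i + N + \<delta>" using 1(1)[of "i + int n"] i unfolding N_def by simp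
        ultimately have "(N - 1) * f (1 + int n) i = (N - 1) * ((N + 1) * \<delta> + (a + of_int i))"
          using IH[OF i] IH[of "i + 1"] 1(1)[OF i] i by (simp add: algebra_simps)
        then show "f (int (Suc n)) i = of_int (int (Suc n)) * \<delta> + (a + of_int i)"
          using N1 unfolding N_def by (simp add: add_ac)
      qed
    qed (use 1(1) 2(1) in \<open>auto simp: add_ac\<close>)
  qed
  have neg: "\<forall>i\<ge>0. f (- int (Suc n)) (i + int (Suc n)) = - of_int (int (Suc n)) * \<delta> + (a + of_int i + of_int (int (Suc n)))" for n
  proof (induction n rule: less_induct)
    case (less n)
    consider "n = 0" | "n = 1" | k where "n = Suc k" "1 \<le> k" by (metis One_nat_def Suc_leI neq0_conv not0_implies_Suc)
    then show ?case
    proof cases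
      case 3
      define N where "N = (of_nat n :: complex)"
      have IH: "f (- int n) (i + int n) = - N * \<delta> + (a + of_int i + N)" if "0 \<le> i" for i using less[of k] 3 that unfolding N_def by simp
      have N1: "N - 1 \<noteq> 0" using 3 unfolding N_def by auto
      show ?thesis
      proof (intro allI impI)
        fix i :: int assume i: "0 \<le> i"
        have e: "f (- 1) (i + 1) * f (- int n) (i + 1 + int n) - f (- int n) (i + int n) * f (- 1) (i + int n + 1)
          = (1 - N) * f (- int (Suc n)) (i + int (Suc n))"
          using struct_const_rel[OF f, of "- 1" "i + int n + 1" "- int n"] unfolding N_def by (simp add: add_ac)
        have v: "f (- 1) (i + int n + 1) = a + of_int i + N + 1 - \<delta>" using 1(2)[of "i + int n"] i unfolding N_def by simp
        have v': "f (- int n) (i + 1 + int n) = - N * \<delta> + (a + of_int i + 1 + N)" using IH[of "i + 1"] i by (simp add: add_ac)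
        have "(N - 1) * f (- int (Suc n)) (i + int (Suc n)) = (N - 1) * (- (N + 1) * \<delta> + (a + of_int i + (N + 1)))"
          using e unfolding v v' IH[OF i] 1(2)[OF i] by algebra
        then have "f (- int (Suc n)) (i + int (Suc n)) = - (N + 1) * \<delta> + (a + of_int i + (N + 1))"
          using N1 mult_left_cancel by blast
        then show "f (- int (Suc n)) (i + int (Suc n)) = - of_int (int (Suc n)) * \<delta> + (a + of_int i + of_int (int (Suc n)))"
          unfolding N_def by (simp add: add_ac)
      qed
    qed (use 1(2) 2(2) in \<open>auto simp: add_ac algebra_simps\<close>)
  qed
  show ?thesis
    unfolding standard_from_def
  proof (intro allI impI)
    fix m i :: int assume mi: "0 \<le> i" "0 \<le> i + m"
    consider "m = 0" | "m > 0" | "m < 0" by linarith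
    then show "f m i = of_int m * \<delta> + (a + of_int i)"
    proof cases
      case 1
      then show ?thesis using f unfolding struct_const_def by simp
    next
      case 2
      then show ?thesis using pos[of "nat (m - 1)"] mi by (simp add: add_ac)
    next
      case 3
      then have "int (Suc (nat (- m - 1))) = - m" by simp
      then show ?thesis using neg[of "nat (- m - 1)"] mi by (metis (no_types, lifting) add.inverse_inverse add_diff_cancel_right' diff_minus_eq_add of_int_minus add.assoc of_int_add add_minus_cancel)
    qed
  qed
qed

text \<open>The relations with \<open>L\<^sub>1\<close> and \<open>L\<^bsub>-1\<^esub>\<close> determine \<open>f 2\<close> up to a constant \<open>\<kappa>\<close>. The relation between \<open>L\<^sub>2\<close> and \<open>L\<^bsub>-2\<^esub>\<close>
  leaves two values of \<open>\<kappa>\<close>, which correspond to the two roots \<open>\<delta>\<close> and \<open>1 - \<delta>\<close> of the Casimir equation.\<close>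

lemma standard_germ_from_casimir:
  assumes f: "struct_const a f" and far: "Re a > cmod \<delta> + 5"
    and 1: "\<And>i. 0 \<le> i \<Longrightarrow> f 1 i = a + of_int i + \<delta>" "\<And>i. 0 \<le> i \<Longrightarrow> f (- 1) (i + 1) = a + of_int i + 1 - \<delta>"
  shows "\<exists>\<delta>' c. (\<forall>i. c i \<noteq> 0) \<and> standard_from a \<delta>' 0 (rescale c f)"
proof -
  define x where "x i = a + of_int i" for i
  have xs: "x (i + k) = x i + of_int k" "x (i - k) = x i - of_int k" for i k unfolding x_def by simp_all
  \<comment> \<open>The margin 5 in \<open>far\<close> pays for an index down to -2 and a further
    shift of the argument by -3, on top of the size of \<delta>.\<close>
  have nz: "x i + z \<noteq> 0" if "- 2 \<le> i" "- cmod \<delta> - 3 \<le> Re z" for i z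
  proof -
    have "real_of_int i \<ge> - 2" using that(1) by simp
    then have "Re (x i + z) > 0" unfolding x_def using far that(2) by simp
    then show ?thesis by (metis less_irrefl zero_complex.sel(1))
  qed
  have re: "- cmod \<delta> \<le> Re \<delta>" "- cmod \<delta> \<le> Re (- \<delta>)" using abs_Re_le_cmod[of \<delta>] by auto
  have nz1: "x i + of_int k + \<delta> \<noteq> 0" "x i + of_int k - \<delta> \<noteq> 0" if "- 2 \<le> i" "- 3 \<le> k" for i k
    using nz[OF that(1), of "of_int k + \<delta>"] nz[OF that(1), of "of_int k - \<delta>"] re that(2) by (simp_all add: add_ac add_diff_eq)
  \<comment> \<open>The deviation of \<open>f 2\<close> from its standard value, times the factor
    that makes it independent of \<open>i\<close> by [L_(-1), L_2] = 3 L_1.\<close>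
  define W where "W i = (f 2 i - (x i + 2 * \<delta>)) * (x i + 2 - \<delta>) * (x i + 1 - \<delta>)" for i
  have W: "W (int n) = W 0" for n
  proof (induction n)
    case (Suc n)
    define i where "i = int (Suc n)"
    have i: "1 \<le> i" "i - 1 = int n" unfolding i_def by simp_all
    have "f (- 1) (i + 2) * f 2 i - f 2 (i - 1) * f (- 1) i = 3 * f 1 i"
      using struct_const_rel[OF f, of "- 1" i 2] by simp
    moreover have "f (- 1) (i + 2) = x i + 2 - \<delta>" using 1(2)[of "i + 1"] i unfolding x_def by (simp add: add_ac)
    moreover have "f (- 1) i = x i - \<delta>" using 1(2)[of "i - 1"] i(1) unfolding x_def by simp
    moreover have "f 1 i = x i + \<delta>" using 1(1)[of i] i unfolding x_def by simp
    ultimately have "(x i + 2 - \<delta>) * f 2 i - f 2 (i - 1) * (x i - \<delta>) = 3 * (x i + \<delta>)" by simp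
    then have "W i = W (i - 1)" unfolding W_def xs of_int_1 by algebra
    then show ?case using Suc i unfolding i_def by simp
  qed simp
  define \<kappa> where "\<kappa> = W 0"
  have f2: "(f 2 i - (x i + 2 * \<delta>)) * ((x i + 2 - \<delta>) * (x i + 1 - \<delta>)) = \<kappa>" if "0 \<le> i" for i
    using W[of "nat i"] that unfolding W_def \<kappa>_def by (simp add: mult.assoc)
  \<comment> \<open>The analogue for L_(-2), by [L_1, L_(-2)] = -3 L_(-1).\<close>
  define V where "V i = (f (- 2) (i + 2) - (x i + 2 - 2 * \<delta>)) * (x i + \<delta>) * (x i + 1 + \<delta>)" for i
  have V: "V (int n) = V 0" for n
  proof (induction n)
    case (Suc n)
    define i where "i = int n"
    have i: "0 \<le> i" unfolding i_def by simp
    have "f 1 i * f (- 2) (i + 2) - f (- 2) (i + 1 + 2) * f 1 (i + 2) = - 3 * f (- 1) (i + 2)"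
      using struct_const_rel[OF f, of 1 "i + 2" "- 2"] by (simp add: add_ac)
    moreover have "f 1 i = x i + \<delta>" "f 1 (i + 2) = x i + 2 + \<delta>" using 1(1)[of i] 1(1)[of "i + 2"] i unfolding x_def by (simp_all add: add_ac)
    moreover have "f (- 1) (i + 2) = x i + 2 - \<delta>" using 1(2)[of "i + 1"] i unfolding x_def by (simp add: add_ac)
    ultimately have "(x i + \<delta>) * f (- 2) (i + 2) - f (- 2) (i + 1 + 2) * (x i + 2 + \<delta>) = - 3 * (x i + 2 - \<delta>)" by simp
    then have "V (i + 1) = V i" unfolding V_def xs of_int_1 by algebra
    then show ?case using Suc unfolding i_def by (simp add: add.commute)
  qed simp
  define \<kappa>' where "\<kappa>' = V 0"
  have f2': "(f (- 2) (i + 2) - (x i + 2 - 2 * \<delta>)) * ((x i + \<delta>) * (x i + 1 + \<delta>)) = \<kappa>'" if "0 \<le> i" for i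
    using V[of "nat i"] that unfolding V_def \<kappa>'_def by (simp add: mult.assoc)
  \<comment> \<open>By [L_(-2), L_2] = 4 L_0 the deviation of the product from its standard value
    has period 2; only even indices are used below.\<close>
  define s where "s i = f (- 2) (i + 2) * f 2 i - (x i + 2 * \<delta>) * (x i + 2 - 2 * \<delta>)" for i
  have s_step: "s i = s (i - 2)" for i
  proof -
    have "f (- 2) (i + 2) * f 2 i - f (- 2) i * f 2 (i - 2) = 4 * x i"
      using struct_const_step[OF f, of 2 i] unfolding x_def by simp
    moreover have "s (i - 2) = f (- 2) i * f 2 (i - 2) - (x i - 2 + 2 * \<delta>) * (x i - 2 + 2 - 2 * \<delta>)"
      unfolding s_def xs by simp
    ultimately show ?thesis unfolding s_def[of i] by algebra
  qed
  define \<sigma> where "\<sigma> = s 0"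
  have s: "s (2 * int n) = \<sigma>" for n
  proof (induction n)
    case (Suc n)
    then show ?case using s_step[of "2 * int (Suc n)"] by simp
  qed (simp add: \<sigma>_def)
  \<comment> \<open>Inserting the values of L_2 and L_(-2) into their product and clearing
    denominators gives a polynomial relation in the weight. It holds at all even nonnegative
    indices, hence identically, and thereby decides \<kappa>, \<kappa>' and \<sigma>.\<close>
  define T where "T z = \<kappa>' * ((z + 2 * \<delta>) * ((z + (2 - \<delta>)) * (z + (1 - \<delta>)))) + \<kappa> * ((z + (2 - 2 * \<delta>)) * ((z + \<delta>) * (z + (1 + \<delta>)))) + \<kappa> * \<kappa>'
    - \<sigma> * ((z + (2 - \<delta>)) * ((z + (1 - \<delta>)) * ((z + \<delta>) * (z + (1 + \<delta>)))))" for z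
  have T0: "T (x (2 * int n)) = 0" for n
  proof -
    define i where "i = 2 * int n"
    have "(f 2 i - (x i + 2 * \<delta>)) * ((x i + 2 - \<delta>) * (x i + 1 - \<delta>)) = \<kappa>"
      "(f (- 2) (i + 2) - (x i + 2 - 2 * \<delta>)) * ((x i + \<delta>) * (x i + 1 + \<delta>)) = \<kappa>'"
      "f (- 2) (i + 2) * f 2 i - (x i + 2 * \<delta>) * (x i + 2 - 2 * \<delta>) = \<sigma>"
      using f2[of i] f2'[of i] s[of n] unfolding i_def s_def by simp_all
    moreover have "k' * (p * A) + k * (q * B) + k * k' - t * (A * B) = 0"
      if "(F - p) * A = k" "(G - q) * B = k'" "G * F - p * q = t" for F G p q A B k k' t :: complex
      unfolding that[symmetric] by (simp add: algebra_simps)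
    ultimately have "\<kappa>' * ((x i + 2 * \<delta>) * ((x i + 2 - \<delta>) * (x i + 1 - \<delta>))) + \<kappa> * ((x i + 2 - 2 * \<delta>) * ((x i + \<delta>) * (x i + 1 + \<delta>)))
      + \<kappa> * \<kappa>' - \<sigma> * (((x i + 2 - \<delta>) * (x i + 1 - \<delta>)) * ((x i + \<delta>) * (x i + 1 + \<delta>))) = 0" by blast
    then show ?thesis unfolding T_def i_def[symmetric] by (simp add: add_diff_eq add.assoc mult.assoc)
  qed
  have T: "T z = 0" for z
  proof -
    have lin: "poly_fun 1 (\<lambda>t. 2 * t + k)" for k
      using poly_fun_linear[of k 2] by (simp add: mult.commute add.commute)
    have lin2: "poly_fun 2 (\<lambda>t. (2 * t + k) * (2 * t + l))" for k l
      by (rule poly_fun_mult[OF lin lin]) simp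
    have lin3: "poly_fun 3 (\<lambda>t. (2 * t + j) * ((2 * t + k) * (2 * t + l)))" for j k l
      by (rule poly_fun_mult[OF lin lin2]) simp
    have lin4: "poly_fun 4 (\<lambda>t. (2 * t + h) * ((2 * t + j) * ((2 * t + k) * (2 * t + l))))" for h j k l
      by (rule poly_fun_mult[OF lin lin3]) simp
    \<comment> \<open>The known zeros have distance 2, while \<open>poly_fun_eqI\<close> works with
      distance 1; hence the halved variable.\<close>
    have "poly_fun 4 (\<lambda>t. T (2 * t))"
      unfolding T_def
      by (intro poly_fun_add poly_fun_diff poly_fun_const poly_fun_mono[OF poly_fun_cmult[OF lin3]] poly_fun_cmult[OF lin4]) auto
    then have "(\<lambda>t. T (2 * t)) = (\<lambda>t. 0)"
    proof (rule poly_fun_eqI[where a = "a / 2" and k = 0, OF _ poly_fun_const])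
      fix n :: nat
      show "T (2 * (a / 2 + of_nat n)) = 0" using T0[of n] unfolding x_def by simp
    qed
    from fun_cong[OF this, of "z / 2"] show ?thesis by simp
  qed
  \<comment> \<open>The fourth difference extracts the leading coefficient - \<sigma> of
    \<open>T\<close>, the third difference then gives \<kappa> + \<kappa>', and at - \<delta> one of
    the two cubics drops out.\<close>
  have "24 * \<sigma> = - (T 4 - 4 * T 3 + 6 * T 2 - 4 * T 1 + T 0)" unfolding T_def by algebra
  then have \<sigma>: "\<sigma> = 0" unfolding T by simp
  have "6 * (\<kappa> + \<kappa>') = T 3 - 3 * T 2 + 3 * T 1 - T 0" unfolding T_def \<sigma> by algebra
  then have \<kappa>': "\<kappa>' = - \<kappa>" unfolding T by (simp add: add_eq_0_iff)
  have "\<kappa> * (\<kappa> + 2 * \<delta> * (1 - \<delta>) * (1 - 2 * \<delta>)) = - T (- \<delta>)" unfolding T_def \<sigma> \<kappa>' by algebra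
  then consider (same) "\<kappa> = 0" | (dual) "\<kappa> = - (2 * \<delta> * (1 - \<delta>) * (1 - 2 * \<delta>))" unfolding T by (auto simp: add_eq_0_iff2)
  then show ?thesis
  proof cases
    case same
    have "f 2 i = a + of_int i + 2 * \<delta>" "f (- 2) (i + 2) = a + of_int i + 2 - 2 * \<delta>" if "0 \<le> i" for i
      using f2[OF that] f2'[OF that] \<kappa>' same nz1[of i 1] nz1[of i 2] nz1[of i 0] that unfolding x_def by auto
    then have "standard_from a \<delta> 0 f" using standard_from_generators[OF f 1] by blast
    moreover have "rescale (\<lambda>i. 1) f = f" by (intro ext) (simp add: rescale_def)
    ultimately show ?thesis by (intro exI[of _ \<delta>] exI[of _ "\<lambda>i. 1"]) simp
  next
    case dual
    \<comment> \<open>This ratio turns L_1 = x + \<delta> into x + 1 - \<delta>, that is, it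
      exchanges the two roots.\<close>
    define q where "q i = (x i + 1 - \<delta>) / (x i + \<delta>)" for i
    have "q i \<noteq> 0" if "0 \<le> i" for i unfolding q_def using nz1[of i 1] nz1[of i 0] that by simp
    then obtain c where c: "\<And>i. c i \<noteq> 0" "\<And>i. 0 \<le> i \<Longrightarrow> c (i + 1) = q i * c i"
      using nonneg_rescaling[of q] by blast
    have "standard_from a (1 - \<delta>) 0 (rescale c f)"
    proof (rule standard_from_generators[OF struct_const_rescale[OF f c(1)]])
      fix i :: int assume i: "0 \<le> i"
      have n: "x i + \<delta> \<noteq> 0" "x i + 1 - \<delta> \<noteq> 0" "x i + 1 + \<delta> \<noteq> 0" "x i + 2 - \<delta> \<noteq> 0" using nz1[of i 0] nz1[of i 1] nz1[of i 2] i by simp_all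
      have c1: "c (i + 1) / c i = (x i + 1 - \<delta>) / (x i + \<delta>)" "c i / c (i + 1) = (x i + \<delta>) / (x i + 1 - \<delta>)"
        using c(2)[OF i] c(1)[of i] n unfolding q_def by simp_all
      have "c (i + 2) = q (i + 1) * (q i * c i)" using c(2)[of "i + 1"] c(2)[OF i] i by (simp add: add_ac)
      then have c2: "c (i + 2) / c i = ((x i + 2 - \<delta>) * (x i + 1 - \<delta>)) / ((x i + \<delta>) * (x i + 1 + \<delta>))"
        "c i / c (i + 2) = ((x i + \<delta>) * (x i + 1 + \<delta>)) / ((x i + 2 - \<delta>) * (x i + 1 - \<delta>))"
        using c(1)[of i] n unfolding q_def xs by (simp_all add: add_ac mult_ac)
      show "rescale c f 1 i = a + of_int i + (1 - \<delta>)"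
        unfolding rescale_def times_divide_eq_right[symmetric] c1 1(1)[OF i] using n unfolding x_def by simp
      show "rescale c f (- 1) (i + 1) = a + of_int i + 1 - (1 - \<delta>)"
        using c1(2) n 1(2)[OF i] unfolding rescale_def times_divide_eq_right[symmetric] x_def by simp
      have move: "u * A = p * A + k" if "(u - p) * A = k" for u p A k :: complex
        using that by (simp add: left_diff_distrib diff_eq_eq add.commute)
      have E: "(x i + 2 * \<delta>) * ((x i + 2 - \<delta>) * (x i + 1 - \<delta>)) + \<kappa> = (x i + 2 - 2 * \<delta>) * ((x i + \<delta>) * (x i + 1 + \<delta>))"
        unfolding dual by algebra
      have "f 2 i * ((x i + 2 - \<delta>) * (x i + 1 - \<delta>)) = (x i + 2 - 2 * \<delta>) * ((x i + \<delta>) * (x i + 1 + \<delta>))"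
        using move[OF f2[OF i]] E by simp
      then have "f 2 i * (c (i + 2) / c i) = x i + 2 - 2 * \<delta>"
        unfolding c2 using n by (simp add: divide_eq_eq)
      then show "rescale c f 2 i = a + of_int i + 2 * (1 - \<delta>)"
        unfolding rescale_def x_def by (simp add: add_diff_eq)
      have "f (- 2) (i + 2) * ((x i + \<delta>) * (x i + 1 + \<delta>)) = (x i + 2 * \<delta>) * ((x i + 2 - \<delta>) * (x i + 1 - \<delta>))"
        using move[OF f2'[OF i]] unfolding \<kappa>' E[symmetric] by simp
      then have "f (- 2) (i + 2) * (c i / c (i + 2)) = x i + 2 * \<delta>"
        unfolding c2 using n by (simp add: divide_eq_eq)
      then show "rescale c f (- 2) (i + 2) = a + of_int i + 2 - 2 * (1 - \<delta>)"
        unfolding rescale_def x_def by simp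
    qed
    then show ?thesis using c(1) by blast
  qed
qed

section \<open>Continuation of the normal form to the left\<close>

text \<open>Each of x + k \<delta> = 0 and x + k (1 - \<delta>) = 0 holds for at most one k, the
  first because \<delta> \<noteq> 0, the second because \<delta> \<noteq> 1. So one of 1, 2, 3
  avoids both.\<close>

lemma exists_nonvanishing_step:
  assumes "\<delta> \<notin> {0, 1 :: complex}"
  obtains k :: int where "k \<ge> 1" "x + of_int k * \<delta> \<noteq> 0" "x + of_int k - of_int k * \<delta> \<noteq> 0"
proof -
  have "\<exists>k\<in>{1, 2, 3 :: int}. x + of_int k * \<delta> \<noteq> 0 \<and> x + of_int k - of_int k * \<delta> \<noteq> 0"
  proof (rule ccontr)
    assume "\<not> ?thesis"
    then have "x + \<delta> = 0 \<or> x + 1 - \<delta> = 0" "x + 2 * \<delta> = 0 \<or> x + 2 - 2 * \<delta> = 0" "x + 3 * \<delta> = 0 \<or> x + 3 - 3 * \<delta> = 0"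
      by auto
    moreover have "\<delta> = 0" if "x + \<delta> = 0 \<and> x + 2 * \<delta> = 0 \<or> x + \<delta> = 0 \<and> x + 3 * \<delta> = 0 \<or> x + 2 * \<delta> = 0 \<and> x + 3 * \<delta> = 0"
      using that by (elim disjE conjE) algebra+
    moreover have "\<delta> = 1" if "x + 1 - \<delta> = 0 \<and> x + 2 - 2 * \<delta> = 0 \<or> x + 1 - \<delta> = 0 \<and> x + 3 - 3 * \<delta> = 0 \<or> x + 2 - 2 * \<delta> = 0 \<and> x + 3 - 3 * \<delta> = 0"
      using that by (elim disjE conjE) algebra+
    ultimately have "\<delta> = 0 \<or> \<delta> = 1" by argo
    then show False using assms by simp
  qed
  then obtain k where "k \<in> {1, 2, 3 :: int}" "x + of_int k * \<delta> \<noteq> 0" "x + of_int k - of_int k * \<delta> \<noteq> 0" by blast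
  then show ?thesis using that[of k] by auto
qed

text \<open>The product of L_k out of the new weight and L_(-k) back is known from [L_(-k), L_k] =
  2k L_0 at the weight k places higher, and is nonzero for a suitable k. Rescaling the new vector
  makes L_k standard on it; commutators with L_k and L_(-k) then settle every operator that starts
  or ends there.\<close>

lemma standard_step_down:
  assumes f: "struct_const a f" and st: "standard_from a \<delta> K f" and \<delta>: "\<delta> \<notin> {0, 1}"
  shows "\<exists>t. t \<noteq> 0 \<and> standard_from a \<delta> (K - 1) (rescale (\<lambda>i. if i = K - 1 then t else 1) f)"
proof -
  define j where "j = K - 1"
  define x where "x = a + of_int j"
  obtain k where k: "k \<ge> 1" "x + of_int k * \<delta> \<noteq> 0" "x + of_int k - of_int k * \<delta> \<noteq> 0"
    using exists_nonvanishing_step[OF \<delta>] by blast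
  define z where "z = (of_int k :: complex)"
  have sf: "f m i = of_int m * \<delta> + (x + of_int (i - j))" if "j + 1 \<le> i" "j + 1 \<le> i + m" for m i
    using st that unfolding standard_from_def x_def j_def by simp
  have prod: "f (- k) (j + k) * f k j = (x + z * \<delta>) * (x + z - z * \<delta>)"
  proof -
    have "f (- k) (j + k + k) * f k (j + k) - f (- k) (j + k) * f k j = 2 * z * (x + z)"
      using struct_const_step[OF f, of k "j + k"] unfolding x_def z_def by (simp add: add_ac)
    moreover have "f (- k) (j + k + k) = - z * \<delta> + (x + 2 * z)" "f k (j + k) = z * \<delta> + (x + z)"
      using sf[of "j + k + k" "- k"] sf[of "j + k" k] k(1) unfolding z_def by simp_all
    ultimately show ?thesis by algebra
  qed
  define t where "t = f k j / (x + z * \<delta>)"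
  have fk: "f k j \<noteq> 0" using prod k unfolding z_def by auto
  have t: "t \<noteq> 0" unfolding t_def using fk k unfolding z_def by simp
  define g where "g = rescale (\<lambda>i. if i = j then t else 1) f"
  have g: "struct_const a g" unfolding g_def by (rule struct_const_rescale[OF f]) (use t in simp)
  have sg: "g m i = of_int m * \<delta> + (x + of_int (i - j))" if "j + 1 \<le> i" "j + 1 \<le> i + m" for m i
    using sf[OF that] that unfolding g_def rescale_def by simp
  have gk: "g k j = x + z * \<delta>"
    unfolding g_def rescale_def t_def using fk k unfolding z_def by simp
  have "g (- k) (j + k) = f (- k) (j + k) * t" unfolding g_def rescale_def using k(1) by simp
  also have "\<dots> = (f (- k) (j + k) * f k j) / (x + z * \<delta>)" unfolding t_def by simp
  also have "\<dots> = x + z - z * \<delta>" unfolding prod using k(2) unfolding z_def by simp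
  finally have gk': "g (- k) (j + k) = x + z - z * \<delta>" .
  \<comment> \<open>In [L_(-k), L_n] on the vector k places to the right every other term is
    standard, and the unknown \<open>g n j\<close> is multiplied by x + k - k \<delta>, which is
    nonzero.\<close>
  have up: "g n j = of_int n * \<delta> + x" if n: "n \<ge> 1" for n
  proof -
    define N where "N = (of_int n :: complex)"
    have "j + k + - k = j" by simp
    then have e: "g (- k) (j + k + n) * g n (j + k) - g n j * g (- k) (j + k) = (N + z) * g (- k + n) (j + k)"
      using struct_const_rel[OF g, of "- k" "j + k" n] unfolding N_def z_def by (simp del: uminus_add_conv_diff)
    have v: "g (- k) (j + k + n) = - z * \<delta> + (x + z + N)" "g n (j + k) = N * \<delta> + (x + z)" "g (- k + n) (j + k) = (N - z) * \<delta> + (x + z)"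
      using sg[of "j + k + n" "- k"] sg[of "j + k" n] sg[of "j + k" "- k + n"] n k(1) unfolding N_def z_def by simp_all
    have "(x + z - z * \<delta>) * g n j = (x + z - z * \<delta>) * (N * \<delta> + x)"
      using e v gk' by algebra
    then show ?thesis using k(3) unfolding N_def z_def by simp
  qed
  have down: "g (- n) (j + n) = - of_int n * \<delta> + (x + of_int n)" if n: "n \<ge> 1" for n
  proof -
    define N where "N = (of_int n :: complex)"
    have "j + n + - n = j" by simp
    then have e: "g k j * g (- n) (j + n) - g (- n) (j + n + k) * g k (j + n) = (- N - z) * g (k + - n) (j + n)"
      using struct_const_rel[OF g, of k "j + n" "- n"] unfolding N_def z_def by (simp del: add_uminus_conv_diff)
    have v: "g (- n) (j + n + k) = - N * \<delta> + (x + z + N)" "g k (j + n) = z * \<delta> + (x + N)" "g (k + - n) (j + n) = (z - N) * \<delta> + (x + N)"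
      using sg[of "j + n + k" "- n"] sg[of "j + n" k] sg[of "j + n" "k + - n"] n k(1) unfolding N_def z_def by simp_all
    have "(x + z * \<delta>) * g (- n) (j + n) = (x + z * \<delta>) * (- N * \<delta> + (x + N))"
      using e v gk by algebra
    then show ?thesis using k(2) unfolding N_def z_def by simp
  qed
  have "standard_from a \<delta> j g"
    unfolding standard_from_def
  proof (intro allI impI)
    fix m i assume mi: "j \<le> i" "j \<le> i + m"
    consider "j + 1 \<le> i" "j + 1 \<le> i + m" | "i = j" "m \<ge> 1" | "m \<le> - 1" "i = j + - m" | "i = j" "m = 0" using mi by linarith
    then show "g m i = of_int m * \<delta> + (a + of_int i)"
    proof cases
      case 1
      then show ?thesis using sg unfolding x_def by simp
    next
      case 2
      then show ?thesis using up unfolding x_def by simp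
    next
      case 3
      then show ?thesis using down[of "- m"] unfolding x_def by simp
    next
      case 4
      then show ?thesis using g unfolding struct_const_def by simp
    qed
  qed
  then show ?thesis using t unfolding g_def j_def by blast
qed

text \<open>Each stage alters the scaling at one new index only. So the scaling is eventually
  constant at every index, and the pointwise limit works everywhere.\<close>

lemma standard_globally:
  assumes f: "struct_const a f" and c0: "\<And>i. c0 i \<noteq> 0" and st: "standard_from a \<delta> 0 (rescale c0 f)" and \<delta>: "\<delta> \<notin> {0, 1}"
  shows "\<exists>c. (\<forall>i. c i \<noteq> 0) \<and> (\<forall>m i. rescale c f m i = of_int m * \<delta> + (a + of_int i))"
proof -
  define P where "P n c \<longleftrightarrow> (\<forall>i. c i \<noteq> 0) \<and> standard_from a \<delta> (- int n) (rescale c f)" for n c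
  have "\<exists>C. \<forall>n. P n (C n) \<and> (\<forall>i\<ge>- int n. C (Suc n) i = C n i)"
  proof (rule dependent_nat_choice[where P = P and Q = "\<lambda>n c c'. \<forall>i\<ge>- int n. c' i = c i"])
    show "\<exists>c. P 0 c" using c0 st unfolding P_def by auto
    fix c n assume P: "P n c"
    then have c: "\<And>i. c i \<noteq> 0" unfolding P_def by blast
    have sP: "standard_from a \<delta> (- int n) (rescale c f)" using P unfolding P_def by blast
    obtain t where t: "t \<noteq> 0" "standard_from a \<delta> (- int n - 1) (rescale (\<lambda>i. if i = - int n - 1 then t else 1) (rescale c f))"
      using standard_step_down[OF struct_const_rescale[OF f c] sP \<delta>] by blast
    define c' where "c' = (\<lambda>i. c i * (if i = - int n - 1 then t else 1))"
    have e: "rescale c' f = rescale (\<lambda>i. if i = - int n - 1 then t else 1) (rescale c f)"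
      unfolding c'_def by (rule rescale_rescale[symmetric]) (use c t in auto)
    have n: "- int (Suc n) = - int n - 1" by simp
    have "standard_from a \<delta> (- int (Suc n)) (rescale c' f)" unfolding e n by (rule t(2))
    moreover have "c' i \<noteq> 0" for i using c t(1) unfolding c'_def by simp
    ultimately have "P (Suc n) c'" unfolding P_def by blast
    moreover have "\<forall>i\<ge>- int n. c' i = c i" unfolding c'_def by simp
    ultimately show "\<exists>c'. P (Suc n) c' \<and> (\<forall>i\<ge>- int n. c' i = c i)" by blast
  qed
  then obtain C where C: "\<And>n. P n (C n)" "\<And>n i. i \<ge> - int n \<Longrightarrow> C (Suc n) i = C n i" by blast
  define c where "c i = C (nat (- i)) i" for i
  have c: "C (nat (- i) + l) i = c i" for i l
  proof (induction l)
    case (Suc l)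
    then show ?case using C(2)[of "nat (- i) + l" i] by simp
  qed (simp add: c_def)
  have c': "C n i = c i" if "- int n \<le> i" for n i
    using c[of i "n - nat (- i)"] that by simp
  have "rescale c f m i = of_int m * \<delta> + (a + of_int i)" for m i
  proof -
    define n where "n = nat (- i) + nat (- (i + m))"
    have n: "- int n \<le> i" "- int n \<le> i + m" unfolding n_def by simp_all
    have "rescale (C n) f m i = of_int m * \<delta> + (a + of_int i)"
      using C(1)[of n] n unfolding P_def standard_from_def by blast
    then show ?thesis unfolding rescale_def c'[OF n(1)] c'[OF n(2)] .
  qed
  moreover have "c i \<noteq> 0" for i using C(1) unfolding P_def c_def by blast
  ultimately show ?thesis by blast
qed

section \<open>Weight bases of the modules of the class S\<close>

lemma class_SD:
  assumes "M \<in> class_S"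
  shows "witt_module M" "vspace M = module.span (scale M) (\<Union>s. wt_space M s)" "Supp M \<in> int_cosets"
    "\<And>s. s \<in> Supp M \<Longrightarrow> vector_space.dim (scale M) (wt_space M s) = 1"
  using assms unfolding class_S_def by auto

lemma wt_space_scale:
  assumes M: "witt_module M" and m: "m \<in> wt_space M s"
  shows "scale M c m \<in> wt_space M s"
proof -
  interpret vector_space "scale M" by (rule witt_vector_space[OF M])
  have v: "m \<in> vspace M" "act M (L 0) m = scale M s m" using m unfolding wt_space_def by auto
  have "act M (L 0) (scale M c m) = scale M s (scale M c m)"
    using Hom_scale[OF witt_act_Hom[OF M] v(1)] v(2) by (simp add: mult.commute)
  then show ?thesis using witt_scale[OF M v(1)] unfolding wt_space_def by simp
qed

lemma class_S_weight_vectors: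
  assumes M: "M \<in> class_S"
  obtains w where "\<And>s. s \<in> Supp M \<Longrightarrow> w s \<noteq> 0" "\<And>s. s \<in> Supp M \<Longrightarrow> wt_space M s = range (\<lambda>c. scale M c (w s))"
proof -
  interpret vector_space "scale M" by (rule witt_vector_space[OF class_SD(1)[OF M]])
  have "\<exists>b. b \<noteq> 0 \<and> wt_space M s = range (\<lambda>c. scale M c b)" if s: "s \<in> Supp M" for s
  proof -
    obtain B where B: "B \<subseteq> wt_space M s" "independent B" "wt_space M s \<subseteq> span B" "card B = dim (wt_space M s)"
      using basis_exists[of "wt_space M s"] by blast
    then have "card B = 1" using class_SD(4)[OF M s] by simp
    then obtain b where b: "B = {b}" by (auto simp: card_1_singleton_iff)
    have "b \<noteq> 0" using B(2) b dependent_zero by blast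
    moreover have "wt_space M s \<subseteq> range (\<lambda>c. scale M c b)" using B(3) unfolding b span_singleton .
    moreover have "range (\<lambda>c. scale M c b) \<subseteq> wt_space M s"
      using wt_space_scale[OF class_SD(1)[OF M]] B(1) b by blast
    ultimately show ?thesis by blast
  qed
  then have "\<exists>w. \<forall>s. s \<in> Supp M \<longrightarrow> w s \<noteq> 0 \<and> wt_space M s = range (\<lambda>c. scale M c (w s))" by metis
  then show ?thesis using that by blast
qed

lemma act_L_wt_space:
  assumes M: "witt_module M" and m: "m \<in> wt_space M s"
  shows "act M (L n) m \<in> wt_space M (s + of_int n)"
proof -
  interpret vector_space "scale M" by (rule witt_vector_space[OF M])
  have v: "m \<in> vspace M" "act M (L 0) m = scale M s m" using m unfolding wt_space_def by auto
  have "act M (bracket (L 0) (L n)) m = scale M (of_int n) (act M (L n) m)"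
    unfolding bracket_simps(5) using witt_act_scale_left[OF M v(1)] by simp
  moreover have "act M (bracket (L 0) (L n)) m = act M (L 0) (act M (L n) m) - scale M s (act M (L n) m)"
    unfolding witt_act_bracket[OF M v(1)] v(2) Hom_scale[OF witt_act_Hom[OF M] v(1)] ..
  ultimately have "act M (L 0) (act M (L n) m) = scale M (s + of_int n) (act M (L n) m)"
    by (simp add: scale_left_distrib algebra_simps)
  then show ?thesis using witt_act[OF M v(1)] unfolding wt_space_def by simp
qed

lemma class_S_struct_const:
  assumes M: "M \<in> class_S" and w: "\<And>s. s \<in> Supp M \<Longrightarrow> w s \<noteq> 0" "\<And>s. s \<in> Supp M \<Longrightarrow> wt_space M s = range (\<lambda>c. scale M c (w s))"
    and a: "a \<in> Supp M"
  obtains f where "struct_const a f"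
    "\<And>m i. act M (L m) (w (a + of_int i)) = scale M (f m i) (w (a + of_int (i + m)))"
proof -
  note W = class_SD(1)[OF M]
  interpret vector_space "scale M" by (rule witt_vector_space[OF W])
  have s: "a + of_int i \<in> Supp M" for i by (rule int_coset_shift[OF class_SD(3)[OF M] a])
  have wt: "w (a + of_int i) \<in> wt_space M (a + of_int i)" for i
    unfolding w(2)[OF s] by (rule range_eqI[of _ _ 1]) simp
  then have v: "w (a + of_int i) \<in> vspace M" for i using wt_subset_vspace[of M] by blast
  have "\<exists>c. act M (L m) (w (a + of_int i)) = scale M c (w (a + of_int (i + m)))" for m i
    using act_L_wt_space[OF W wt[of i], of m] w(2)[OF s[of "i + m"]] by (auto simp: add.assoc)
  then obtain f where f: "\<And>m i. act M (L m) (w (a + of_int i)) = scale M (f m i) (w (a + of_int (i + m)))" by metis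
  have f2: "act M (L m) (act M (L n) (w (a + of_int i))) = scale M (f m (i + n) * f n i) (w (a + of_int (i + n + m)))" for m n i
    unfolding f Hom_scale[OF witt_act_Hom[OF W] v] by (simp add: mult.commute)
  have "struct_const a f"
    unfolding struct_const_def
  proof (intro conjI allI)
    fix m n i
    have "scale M ((of_int n - of_int m) * f (m + n) i) (w (a + of_int (i + (m + n)))) = act M (bracket (L m) (L n)) (w (a + of_int i))"
      unfolding bracket_simps(5) witt_act_scale_left[OF W v] f by simp
    also have "\<dots> = scale M (f m (i + n) * f n i) (w (a + of_int (i + n + m))) - scale M (f n (i + m) * f m i) (w (a + of_int (i + m + n)))"
      unfolding witt_act_bracket[OF W v] f2 ..
    also have "\<dots> = scale M (f m (i + n) * f n i - f n (i + m) * f m i) (w (a + of_int (i + (m + n))))"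
      by (simp add: scale_left_diff_distrib add_ac)
    finally show "f m (i + n) * f n i - f n (i + m) * f m i = (of_int n - of_int m) * f (m + n) i"
      using w(1)[OF s[of "i + (m + n)"]] scale_right_imp_eq by metis
  next
    fix i
    have "scale M (f 0 i) (w (a + of_int i)) = scale M (a + of_int i) (w (a + of_int i))"
      using f[of 0 i] wt[of i] unfolding wt_space_def by simp
    then show "f 0 i = a + of_int i" using w(1)[OF s[of i]] scale_right_imp_eq by metis
  qed
  then show ?thesis using that f by blast
qed

text \<open>This is the part of the Kaplansky--Santharoubane classification that the theorem needs.\<close>

lemma class_S_standard_basis:
  assumes M: "M \<in> class_S"
  obtains \<delta> v r where "\<And>s. s \<in> Supp M \<Longrightarrow> v s \<noteq> 0" "\<And>s. s \<in> Supp M \<Longrightarrow> wt_space M s = range (\<lambda>c. scale M c (v s))"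
    "\<And>s m. s \<in> Supp M \<Longrightarrow> \<delta> \<notin> {0, 1} \<or> r \<le> Re s \<and> r \<le> Re (s + of_int m) \<Longrightarrow>
      act M (L m) (v s) = scale M (of_int m * \<delta> + s) (v (s + of_int m))"
proof -
  note W = class_SD(1)[OF M]
  interpret vector_space "scale M" by (rule witt_vector_space[OF W])
  obtain w where w: "\<And>s. s \<in> Supp M \<Longrightarrow> w s \<noteq> 0" "\<And>s. s \<in> Supp M \<Longrightarrow> wt_space M s = range (\<lambda>c. scale M c (w s))"
    using class_S_weight_vectors[OF M] by blast
  obtain a0 where a0: "a0 \<in> Supp M" using int_coset_above[OF class_SD(3)[OF M]] by blast
  obtain f0 where f0: "struct_const a0 f0"
    "\<And>m i. act M (L m) (w (a0 + of_int i)) = scale M (f0 m i) (w (a0 + of_int (i + m)))"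
    using class_S_struct_const[OF M w a0] by blast
  obtain \<delta>0 where \<delta>0: "\<And>i. f0 (- 1) (i + 1) * f0 1 i = (a0 + of_int i + \<delta>0) * (a0 + of_int i + 1 - \<delta>0)"
    using struct_const_casimir[OF f0(1)] by blast
  \<comment> \<open>The origin is moved far enough to the right for the margin demanded with
    \<delta>0; the Casimir parameter itself does not depend on the origin.\<close>
  define k where "k = \<lceil>cmod \<delta>0 + 6 - Re a0\<rceil>"
  define a where "a = a0 + of_int k"
  have far: "Re a > cmod \<delta>0 + 5" unfolding a_def k_def by simp linarith
  have a: "a \<in> Supp M" unfolding a_def by (rule int_coset_shift[OF class_SD(3)[OF M] a0])
  have s: "a + of_int i \<in> Supp M" for i by (rule int_coset_shift[OF class_SD(3)[OF M] a])
  define f where "f m i = f0 m (i + k)" for m i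
  have f: "struct_const a f"
    using f0(1) unfolding struct_const_def f_def a_def by (simp add: add_ac)
  have act: "act M (L m) (w (a + of_int i)) = scale M (f m i) (w (a + of_int (i + m)))" for m i
    using f0(2)[of m "i + k"] unfolding f_def a_def by (simp add: add_ac)
  define x where "x i = a + of_int i" for i
  have cas: "f (- 1) (i + 1) * f 1 i = (x i + \<delta>0) * (x i + 1 - \<delta>0)" for i
    using \<delta>0[of "i + k"] unfolding f_def x_def a_def by (simp add: add_ac)
  have nz: "x i + \<delta>0 \<noteq> 0" "x i + 1 - \<delta>0 \<noteq> 0" if "0 \<le> i" for i
  proof -
    have "real_of_int i \<ge> 0" using that by simp
    moreover have "- cmod \<delta>0 \<le> Re \<delta>0" "Re \<delta>0 \<le> cmod \<delta>0" using abs_Re_le_cmod[of \<delta>0] by auto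
    ultimately have "Re (x i + \<delta>0) > 0" "Re (x i + 1 - \<delta>0) > 0" using far unfolding x_def by simp_all
    then show "x i + \<delta>0 \<noteq> 0" "x i + 1 - \<delta>0 \<noteq> 0" by (metis less_irrefl zero_complex.sel(1))+
  qed
  have f1: "f 1 i \<noteq> 0" if "0 \<le> i" for i using cas[of i] nz[OF that] by auto
  \<comment> \<open>Makes L_1 equal to x + \<delta>0; the Casimir product then fixes L_(-1).\<close>
  obtain c1 where c1: "\<And>i. c1 i \<noteq> 0" "\<And>i. 0 \<le> i \<Longrightarrow> c1 (i + 1) = (x i + \<delta>0) / f 1 i * c1 i"
    using nonneg_rescaling[of "\<lambda>i. (x i + \<delta>0) / f 1 i"] nz(1) f1 by (metis divide_eq_0_iff)
  have g1: "rescale c1 f 1 i = a + of_int i + \<delta>0" if "0 \<le> i" for i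
    unfolding rescale_def c1(2)[OF that] using f1[OF that] c1(1)[of i] unfolding x_def by simp
  have g2: "rescale c1 f (- 1) (i + 1) = a + of_int i + 1 - \<delta>0" if "0 \<le> i" for i
  proof -
    have "rescale c1 f (- 1) (i + 1) = (f (- 1) (i + 1) * f 1 i) / (x i + \<delta>0)"
    proof -
      have "A * c / (z / b * c) = A * b / z" if "b \<noteq> 0" "c \<noteq> 0" "z \<noteq> 0" for A b c z :: complex
        using that by (simp add: field_simps)
      from this[OF f1[OF that] c1(1)[of i] nz(1)[OF that]] show ?thesis
        unfolding rescale_def c1(2)[OF that] by simp
    qed
    then show ?thesis unfolding cas using nz[OF that] unfolding x_def by simp
  qed
  obtain \<delta> c2 where c2: "\<And>i. c2 i \<noteq> 0" "standard_from a \<delta> 0 (rescale c2 (rescale c1 f))"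
    using standard_germ_from_casimir[OF struct_const_rescale[OF f c1(1)] far g1 g2] by blast
  define c3 where "c3 = (\<lambda>i. c1 i * c2 i)"
  have c3: "c3 i \<noteq> 0" for i unfolding c3_def using c1 c2 by simp
  have st: "standard_from a \<delta> 0 (rescale c3 f)"
    using c2(2) unfolding c3_def rescale_rescale[OF c1(1) c2(1)] .
  have "\<exists>c. (\<forall>i. c i \<noteq> 0) \<and> (\<forall>m i. \<delta> \<notin> {0, 1} \<or> 0 \<le> i \<and> 0 \<le> i + m \<longrightarrow> rescale c f m i = of_int m * \<delta> + (a + of_int i))"
  proof (cases "\<delta> \<in> {0, 1}")
    case True
    then show ?thesis using c3 st unfolding standard_from_def by blast
  next
    case False
    then show ?thesis using standard_globally[OF f c3 st] by blast
  qed
  then obtain c where c: "\<And>i. c i \<noteq> 0"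
    "\<And>m i. \<delta> \<notin> {0, 1} \<or> 0 \<le> i \<and> 0 \<le> i + m \<Longrightarrow> rescale c f m i = of_int m * \<delta> + (a + of_int i)" by blast
  define idx where "idx s = \<lfloor>Re (s - a)\<rfloor>" for s
  have idx: "s = a + of_int (idx s)" if sM: "s \<in> Supp M" for s
  proof -
    obtain t where t: "Supp M = t +o \<int>" using class_SD(3)[OF M] unfolding int_cosets_def by auto
    obtain k l where kl: "s = t + of_int k" "a = t + of_int l" using sM a unfolding t elt_set_plus_def by (auto elim!: Ints_cases)
    then have "s - a = of_int (k - l)" by simp
    then show ?thesis unfolding idx_def by (metis Re_complex_of_real add.commute diff_add_cancel floor_of_int of_real_of_int_eq)
  qed
  \<comment> \<open>Division by \<open>c\<close> matches the convention of
    \<open>rescale\<close>.\<close>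
  define v where "v s = scale M (1 / c (idx s)) (w s)" for s
  have v0: "v s \<noteq> 0" if "s \<in> Supp M" for s unfolding v_def using w(1)[OF that] c(1) by simp
  have vr: "wt_space M s = range (\<lambda>c. scale M c (v s))" if "s \<in> Supp M" for s
  proof -
    have 1: "scale M k (w s) = scale M (k * c (idx s)) (v s)" for k unfolding v_def using c(1)[of "idx s"] by simp
    have 2: "scale M k (v s) = scale M (k / c (idx s)) (w s)" for k unfolding v_def by simp
    have "scale M k (w s) \<in> range (\<lambda>c. scale M c (v s))" "scale M k (v s) \<in> range (\<lambda>c. scale M c (w s))" for k
      using rangeI[of "\<lambda>c. scale M c (v s)" "k * c (idx s)"] rangeI[of "\<lambda>c. scale M c (w s)" "k / c (idx s)"]
      unfolding 1[symmetric] 2[symmetric] by simp_all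
    then show ?thesis unfolding w(2)[OF that] by blast
  qed
  show ?thesis
  proof (rule that[of v \<delta> "Re a"])
    fix s m assume s: "s \<in> Supp M" and reg: "\<delta> \<notin> {0, 1} \<or> Re a \<le> Re s \<and> Re a \<le> Re (s + of_int m)"
    define i where "i = idx s"
    have si: "s = a + of_int i" using idx[OF s] unfolding i_def .
    have sm: "s + of_int m \<in> Supp M" by (rule int_coset_shift[OF class_SD(3)[OF M] s])
    have idm: "idx (s + of_int m) = i + m" unfolding idx_def si by simp
    have vs: "w s \<in> vspace M" using w(2)[OF s] wt_subset_vspace[of M s] by (metis rangeI scale_one subsetD)
    have "rescale c f m i = of_int m * \<delta> + s" unfolding si by (rule c(2)) (use reg si in auto)
    then have r: "f m i * c (i + m) / c i = of_int m * \<delta> + s" unfolding rescale_def .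
    have "act M (L m) (v s) = scale M (1 / c i) (scale M (f m i) (w (s + of_int m)))"
      unfolding v_def Hom_scale[OF witt_act_Hom[OF W] vs] i_def[symmetric] using act[of m i] unfolding si by (simp add: add.assoc)
    also have "\<dots> = scale M (f m i * c (i + m) / c i) (v (s + of_int m))"
      unfolding v_def idm using c(1)[of "i + m"] by simp
    finally show "act M (L m) (v s) = scale M (of_int m * \<delta> + s) (v (s + of_int m))" unfolding r .
  qed (use v0 vr in auto)
qed

section \<open>Germ isomorphisms with the modules \<open>Omega\<close>\<close>

lemma Hom0_comb:
  assumes M: "witt_module M" and N: "witt_module N" and "f \<in> Hom0 M N" "g \<in> Hom0 M N"
  shows "(\<lambda>m. scale N c (f m) + scale N c' (g m)) \<in> Hom0 M N"
proof -
  interpret vector_space "scale N" by (rule witt_vector_space[OF N])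
  have "\<exists>x. \<forall>m\<in>upper M x. f m = 0" "\<exists>x. \<forall>m\<in>upper M x. g m = 0" using assms(3,4) unfolding Hom0_def by auto
  from eventually_upper[OF M this(1)] eventually_upper[OF M this(2)]
  have "\<forall>\<^sub>F x in at_top. \<forall>m\<in>upper M x. scale N c (f m) + scale N c' (g m) = 0"
    by eventually_elim simp
  then show ?thesis
    unfolding Hom0_def eventually_at_top_linorder using Hom_comb[OF N] assms(3,4) unfolding Hom0_def by blast
qed

lemma Hom0_cong:
  assumes "f \<in> Hom0 M N" "witt_module M" "\<And>m. m \<in> vspace M \<Longrightarrow> f m = g m"
  shows "g \<in> Hom0 M N"
proof -
  have "g \<in> Hom M N"
    using assms(1,3) witt_add[OF assms(2)] witt_scale[OF assms(2)] unfolding Hom0_def Hom_def by simp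
  moreover obtain x where "\<forall>m\<in>upper M x. f m = 0" using assms(1) unfolding Hom0_def by blast
  then have "\<forall>m\<in>upper M x. g m = 0" using assms(3) upper_subset_vspace[OF assms(2), of x] by (metis subsetD)
  ultimately show ?thesis unfolding Hom0_def by blast
qed

lemma Hom_W_I:
  assumes M: "witt_module M" and N: "witt_module N" and f: "f \<in> Hom M N"
    and L: "\<And>n. (\<lambda>m. act N (L n) (f m) - f (act M (L n) m)) \<in> Hom0 M N"
  shows "f \<in> Hom_W M N"
proof -
  interpret vector_space "scale N" by (rule witt_vector_space[OF N])
  have sc: "(\<lambda>m. act N (pm_scale c X) (f m) - f (act M (pm_scale c X) m)) \<in> Hom0 M N"
    if "(\<lambda>m. act N X (f m) - f (act M X m)) \<in> Hom0 M N" for c X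
  proof (rule Hom0_cong[OF Hom0_comb[OF M N that that, of c 0] M])
    fix m assume m: "m \<in> vspace M"
    show "scale N c (act N X (f m) - f (act M X m)) + scale N 0 (act N X (f m) - f (act M X m))
      = act N (pm_scale c X) (f m) - f (act M (pm_scale c X) m)"
      unfolding witt_act_scale_left[OF M m] witt_act_scale_left[OF N Hom_closed[OF f m]] Hom_scale[OF f witt_act[OF M m]]
      by (simp add: scale_right_diff_distrib)
  qed
  have ad: "(\<lambda>m. act N (X + Y) (f m) - f (act M (X + Y) m)) \<in> Hom0 M N"
    if "(\<lambda>m. act N X (f m) - f (act M X m)) \<in> Hom0 M N" "(\<lambda>m. act N Y (f m) - f (act M Y m)) \<in> Hom0 M N" for X Y
  proof (rule Hom0_cong[OF Hom0_comb[OF M N that, of 1 1] M])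
    fix m assume m: "m \<in> vspace M"
    show "scale N 1 (act N X (f m) - f (act M X m)) + scale N 1 (act N Y (f m) - f (act M Y m))
      = act N (X + Y) (f m) - f (act M (X + Y) m)"
      unfolding witt_act_add_left[OF M m] witt_act_add_left[OF N Hom_closed[OF f m]] Hom_add[OF f witt_act[OF M m] witt_act[OF M m]]
      by simp
  qed
  have "(\<lambda>m. act N X (f m) - f (act M X m)) \<in> Hom0 M N" for X
  proof -
    have "Poly_Mapping.keys X \<subseteq> UNIV" by simp
    then show ?thesis
    proof (induction X rule: pm_span_induct)
      case zero
      show ?case using sc[OF L, of 0 0] by simp
    next
      case (single c n)
      show ?case unfolding L_def[symmetric] by (rule sc[OF L])
    next
      case (add X Y)
      then show ?case using ad by blast
    qed
  qed
  then show ?thesis unfolding Hom_W_def using f by blast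
qed

lemma inv_into_Hom:
  assumes M: "witt_module M" and f: "f \<in> Hom M N" and bij: "bij_betw f (vspace M) (vspace N)"
  shows "inv_into (vspace M) f \<in> Hom N M"
proof -
  let ?g = "inv_into (vspace M) f"
  have g: "?g n \<in> vspace M" "f (?g n) = n" if "n \<in> vspace N" for n
    using that bij by (auto simp: bij_betw_def inv_into_into f_inv_into_f)
  have gf: "?g (f m) = m" if "m \<in> vspace M" for m using that bij by (auto simp: bij_betw_def)
  have "?g (n + n') = ?g n + ?g n'" if "n \<in> vspace N" "n' \<in> vspace N" for n n'
    using gf[of "?g n + ?g n'"] Hom_add[OF f g(1) g(1)] g that witt_add[OF M] by metis
  moreover have "?g (scale N c n) = scale M c (?g n)" if "n \<in> vspace N" for c n
    using gf[of "scale M c (?g n)"] Hom_scale[OF f g(1)] g that witt_scale[OF M] by metis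
  ultimately show ?thesis unfolding Hom_def using g by blast
qed

text \<open>Exact compatibility with \<open>L 0\<close> makes the inverse preserve weights, so it
  sends vectors far to the right to vectors far to the right. There the equivariance of
  \<open>f\<close> can be inverted.\<close>

lemma germ_iso_if_bij:
  assumes M: "witt_module M" and N: "witt_module N" and f: "f \<in> Hom_W M N" and bij: "bij_betw f (vspace M) (vspace N)"
    and L0: "\<And>m. m \<in> vspace M \<Longrightarrow> f (act M (L 0) m) = act N (L 0) (f m)"
  shows "f \<in> germ_iso M N" "inv_into (vspace M) f \<in> germ_iso N M"
proof -
  interpret N: vector_space "scale N" by (rule witt_vector_space[OF N])
  interpret M: vector_space "scale M" by (rule witt_vector_space[OF M])
  let ?g = "inv_into (vspace M) f"
  have fH: "f \<in> Hom M N" using f unfolding Hom_W_def by blast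
  have gH: "?g \<in> Hom N M" by (rule inv_into_Hom[OF M fH bij])
  have g: "?g n \<in> vspace M" "f (?g n) = n" if "n \<in> vspace N" for n
    using that bij by (auto simp: bij_betw_def inv_into_into f_inv_into_f)
  have gf: "?g (f m) = m" if "m \<in> vspace M" for m using that bij by (auto simp: bij_betw_def)
  have g_upper: "?g n \<in> upper M x" if n: "n \<in> upper N x" for n x
  proof (rule Hom_upper_subset[OF N M gH subspace_upper[OF M] _ n])
    fix s n assume s: "x \<le> Re s" and n: "n \<in> wt_space N s"
    then have v: "n \<in> vspace N" "act N (L 0) n = scale N s n" unfolding wt_space_def by auto
    have "f (act M (L 0) (?g n)) = f (scale M s (?g n))"
      unfolding L0[OF g(1)[OF v(1)]] g(2)[OF v(1)] Hom_scale[OF fH g(1)[OF v(1)]] v(2) ..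
    then have "act M (L 0) (?g n) = scale M s (?g n)"
      using gf witt_act[OF M g(1)[OF v(1)]] witt_scale[OF M g(1)[OF v(1)]] by metis
    then have "?g n \<in> wt_space M s" using g(1)[OF v(1)] unfolding wt_space_def by simp
    then show "?g n \<in> upper M x" using wt_subset_upper[OF M s] by blast
  qed
  have "(\<lambda>n. act M X (?g n) - ?g (act N X n)) \<in> Hom0 N M" for X
  proof -
    have "(\<lambda>n. act M X (?g n) - ?g (act N X n)) \<in> Hom N M"
      using Hom_comb[OF M Hom_comp[OF gH witt_act_Hom[OF M]] Hom_comp[OF witt_act_Hom[OF N] gH], of 1 X "-1" X] by simp
    moreover obtain x where x: "\<forall>m\<in>upper M x. act N X (f m) = f (act M X m)"
      using Hom_W_equivariant[OF M f, of X] unfolding eventually_at_top_linorder by blast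
    have "act M X (?g n) - ?g (act N X n) = 0" if n: "n \<in> upper N x" for n
    proof -
      have v: "n \<in> vspace N" using n upper_subset_vspace[OF N] by blast
      have "f (act M X (?g n)) = act N X n" using x g_upper[OF n] g(2)[OF v] by metis
      then have "act M X (?g n) = ?g (act N X n)" using gf witt_act[OF M g(1)[OF v]] by metis
      then show ?thesis by simp
    qed
    ultimately show ?thesis unfolding Hom0_def by blast
  qed
  then have gW: "?g \<in> Hom_W N M" unfolding Hom_W_def using gH by blast
  have z: "(\<lambda>m. 0) \<in> Hom0 M M" "(\<lambda>m. 0) \<in> Hom0 N N"
    unfolding Hom0_def Hom_def using witt_zero[OF M] witt_zero[OF N] by simp_all
  have "(\<lambda>m. ?g (f m) - m) \<in> Hom0 M M" by (rule Hom0_cong[OF z(1) M]) (simp add: gf)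
  moreover have "(\<lambda>n. f (?g n) - n) \<in> Hom0 N N" by (rule Hom0_cong[OF z(2) N]) (simp add: g)
  ultimately show "f \<in> germ_iso M N" "?g \<in> germ_iso N M" unfolding germ_iso_def using f gW by blast+
qed

lemma wmod_iso_sym:
  assumes M: "witt_module M" and iso: "wmod_iso M N"
  shows "wmod_iso N M"
proof -
  obtain f where f: "f \<in> Hom M N" "bij_betw f (vspace M) (vspace N)" "\<And>X m. m \<in> vspace M \<Longrightarrow> f (act M X m) = act N X (f m)"
    using iso unfolding wmod_iso_def by blast
  let ?g = "inv_into (vspace M) f"
  have g: "?g n \<in> vspace M" "f (?g n) = n" if "n \<in> vspace N" for n
    using that f(2) by (auto simp: bij_betw_def inv_into_into f_inv_into_f)
  have gf: "?g (f m) = m" if "m \<in> vspace M" for m using that f(2) by (auto simp: bij_betw_def)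
  have "?g (act N X n) = act M X (?g n)" if n: "n \<in> vspace N" for X n
    using gf[OF witt_act[OF M g(1)[OF n]], of X] f(3)[OF g(1)[OF n], of X] g(2)[OF n] by simp
  then show ?thesis
    unfolding wmod_iso_def using inv_into_Hom[OF M f(1,2)] bij_betw_inv_into[OF f(2)] by blast
qed

lemma wmod_iso_Supp:
  assumes M: "witt_module M" and N: "witt_module N" and iso: "wmod_iso M N"
  shows "Supp M = Supp N"
proof -
  have sub: "Supp M \<subseteq> Supp N" if M: "witt_module M" and N: "witt_module N" and iso: "wmod_iso M N"
    for M :: "'x::ab_group_add wmod" and N :: "'y::ab_group_add wmod"
  proof
    fix s assume "s \<in> Supp M"
    interpret M: vector_space "scale M" by (rule witt_vector_space[OF M])
    have z: "0 \<in> wt_space M s"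
      using witt_zero[OF M] Hom_zero[OF witt_act_Hom[OF M] M] unfolding wt_space_def by simp
    then obtain m where m: "m \<in> wt_space M s" "m \<noteq> 0" using \<open>s \<in> Supp M\<close> unfolding Supp_def by blast
    obtain f where f: "f \<in> Hom M N" "bij_betw f (vspace M) (vspace N)" "\<And>X m. m \<in> vspace M \<Longrightarrow> f (act M X m) = act N X (f m)"
      using iso unfolding wmod_iso_def by blast
    have v: "m \<in> vspace M" "act M (L 0) m = scale M s m" using m unfolding wt_space_def by auto
    have "f m \<in> wt_space N s"
      using f(3)[OF v(1), of "L 0"] v(2) Hom_scale[OF f(1) v(1)] Hom_closed[OF f(1) v(1)] unfolding wt_space_def by simp
    moreover have "f m \<noteq> 0"
    proof
      assume "f m = 0"
      then have "f m = f 0" using Hom_zero[OF f(1) M] by simp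
      then show False using f(2) v(1) m(2) witt_zero[OF M] unfolding bij_betw_def inj_on_def by blast
    qed
    ultimately show "s \<in> Supp N" unfolding Supp_def by blast
  qed
  show ?thesis using sub[OF M N iso] sub[OF N M wmod_iso_sym[OF M iso]] by blast
qed

definition basis_map :: "'a::ab_group_add wmod \<Rightarrow> (complex \<Rightarrow> 'a) \<Rightarrow> omega \<Rightarrow> 'a" where
  "basis_map M v p = (\<Sum>x\<in>Poly_Mapping.keys p. scale M (Poly_Mapping.lookup p x) (v x))"

lemma basis_map_superset:
  assumes M: "witt_module M" and "finite A" "Poly_Mapping.keys p \<subseteq> A"
  shows "basis_map M v p = (\<Sum>x\<in>A. scale M (Poly_Mapping.lookup p x) (v x))"
proof -
  interpret vector_space "scale M" by (rule witt_vector_space[OF M])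
  show ?thesis unfolding basis_map_def
    by (rule sum.mono_neutral_left) (use assms in \<open>auto simp: in_keys_iff\<close>)
qed

lemma basis_map_Hom:
  assumes M: "witt_module M" and v: "\<And>x. x \<in> u \<Longrightarrow> v x \<in> vspace M"
  shows "basis_map M v \<in> Hom (Omega \<delta> u) M"
proof -
  interpret vector_space "scale M" by (rule witt_vector_space[OF M])
  have "basis_map M v (p + q) = basis_map M v p + basis_map M v q" for p q
  proof -
    let ?A = "Poly_Mapping.keys p \<union> Poly_Mapping.keys q"
    have "basis_map M v (p + q) = (\<Sum>x\<in>?A. scale M (Poly_Mapping.lookup (p + q) x) (v x))"
      by (rule basis_map_superset[OF M]) (use keys_add[of p q] in auto)
    also have "\<dots> = (\<Sum>x\<in>?A. scale M (Poly_Mapping.lookup p x) (v x)) + (\<Sum>x\<in>?A. scale M (Poly_Mapping.lookup q x) (v x))"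
      by (simp add: lookup_add scale_left_distrib sum.distrib)
    also have "(\<Sum>x\<in>?A. scale M (Poly_Mapping.lookup p x) (v x)) = basis_map M v p"
      by (rule basis_map_superset[OF M, symmetric]) auto
    also have "(\<Sum>x\<in>?A. scale M (Poly_Mapping.lookup q x) (v x)) = basis_map M v q"
      by (rule basis_map_superset[OF M, symmetric]) auto
    finally show ?thesis .
  qed
  moreover have "basis_map M v (pm_scale c p) = scale M c (basis_map M v p)" for c p
    using basis_map_superset[OF M, of "Poly_Mapping.keys p" "pm_scale c p" v] keys_pm_scale[of c p]
    unfolding basis_map_def[of M v p] by (simp add: scale_sum_right)
  moreover have "basis_map M v p \<in> vspace M" if "Poly_Mapping.keys p \<subseteq> u" for p
    unfolding basis_map_def by (intro witt_sum[OF M] witt_scale[OF M] v) (use that in auto)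
  ultimately show ?thesis unfolding Hom_def by simp
qed

lemma basis_map_e:
  assumes M: "witt_module M"
  shows "basis_map M v (e x) = v x"
proof -
  interpret vector_space "scale M" by (rule witt_vector_space[OF M])
  show ?thesis unfolding basis_map_def by (simp add: lookup_e)
qed

lemma basis_map_equivariant:
  assumes M: "witt_module M" and u: "u \<in> int_cosets" and v: "\<And>x. x \<in> u \<Longrightarrow> v x \<in> vspace M" and U: "U \<subseteq> u"
    and act: "\<And>x. x \<in> U \<Longrightarrow> act M (L m) (v x) = scale M (of_int m * \<delta> + x) (v (x + of_int m))"
    and p: "Poly_Mapping.keys p \<subseteq> U"
  shows "act M (L m) (basis_map M v p) = basis_map M v (act (Omega \<delta> u) (L m) p)"
proof -
  interpret vector_space "scale M" by (rule witt_vector_space[OF M])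
  note W = witt_module_Omega[OF u, of \<delta>]
  note H = basis_map_Hom[where \<delta> = \<delta> and u = u and v = v, OF M v]
  have cl: "basis_map M v q \<in> vspace M" if "Poly_Mapping.keys q \<subseteq> u" for q
    using Hom_closed[OF H, of q] that by simp
  have ka: "Poly_Mapping.keys (act (Omega \<delta> u) (L m) q) \<subseteq> u" if "Poly_Mapping.keys q \<subseteq> u" for q
    by (rule keys_act_Omega[OF u that])
  show ?thesis using p
  proof (induction p rule: pm_span_induct)
    case zero
    show ?case using Hom_zero[OF H W] Hom_zero[OF witt_act_Hom[OF M] M] Hom_zero[OF witt_act_Hom[OF W] W] by simp
  next
    case (single c x)
    then have x: "x \<in> u" using U by blast
    have gs: "basis_map M v (pm_scale c (e y)) = scale M c (v y)" if "y \<in> u" for c y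
      using Hom_scale[OF H, of "e y" c] basis_map_e[OF M, of v] that by simp
    show ?case
      unfolding e_def[symmetric] act_Omega_scale act_Omega_L_e pm.scale_scale gs[OF x] gs[OF int_coset_shift[OF u x]]
        Hom_scale[OF witt_act_Hom[OF M] v[OF x]] act[OF single] scale_scale ..
  next
    case (add p q)
    have k: "Poly_Mapping.keys p \<subseteq> u" "Poly_Mapping.keys q \<subseteq> u" using add U by auto
    have "act M (L m) (basis_map M v (p + q)) = act M (L m) (basis_map M v p) + act M (L m) (basis_map M v q)"
      using Hom_add[OF H, of p q] Hom_add[OF witt_act_Hom[OF M] cl[OF k(1)] cl[OF k(2)]] k by simp
    also have "\<dots> = basis_map M v (act (Omega \<delta> u) (L m) (p + q))"
      unfolding add.IH act_Omega_add using Hom_add[OF H, of "act (Omega \<delta> u) (L m) p" "act (Omega \<delta> u) (L m) q"] ka[OF k(1)] ka[OF k(2)] by simp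
    finally show ?case .
  qed
qed

text \<open>Independence of eigenvectors: L_0 - x removes the weight x from a vanishing combination
  and multiplies the other terms by nonzero factors. Only L_0 acts, in the same way in every
  \<open>Omega\<close>.\<close>

lemma basis_map_inj:
  assumes M: "witt_module M" and u: "u \<in> int_cosets" and v: "\<And>x. x \<in> u \<Longrightarrow> v x \<in> wt_space M x" "\<And>x. x \<in> u \<Longrightarrow> v x \<noteq> 0"
    and "Poly_Mapping.keys p \<subseteq> u" "basis_map M v p = 0"
  shows "p = 0"
  using assms(5,6)
proof (induction "card (Poly_Mapping.keys p)" arbitrary: p rule: less_induct)
  case less
  interpret vector_space "scale M" by (rule witt_vector_space[OF M])
  note W = witt_module_Omega[OF u, of 0]
  have vv: "v x \<in> vspace M" if "x \<in> u" for x using v(1)[OF that] unfolding wt_space_def by blast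
  note H = basis_map_Hom[where \<delta> = 0 and u = u and v = v, OF M vv]
  show ?case
  proof (rule ccontr)
    assume "p \<noteq> 0"
    then obtain x where x: "x \<in> Poly_Mapping.keys p" by (metis all_not_in_conv keys_eq_empty)
    define q where "q = act (Omega 0 u) (L 0) p - pm_scale x p"
    have lq: "Poly_Mapping.lookup q y = (y - x) * Poly_Mapping.lookup p y" for y
      unfolding q_def by (simp add: lookup_minus lookup_act_L0_Omega left_diff_distrib)
    have kq: "Poly_Mapping.keys q = Poly_Mapping.keys p - {x}" by (auto simp: in_keys_iff lq)
    have k1: "Poly_Mapping.keys (act (Omega 0 u) (L 0) p) \<subseteq> u" "Poly_Mapping.keys (pm_scale x p) \<subseteq> u"
      using keys_act_Omega[OF u less.prems(1)] keys_pm_scale[of x p] less.prems(1) by auto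
    have "basis_map M v (act (Omega 0 u) (L 0) p) = act M (L 0) (basis_map M v p)"
    proof (rule basis_map_equivariant[OF M u vv order_refl _ less.prems(1), symmetric])
      show "act M (L 0) (v x) = scale M (of_int 0 * 0 + x) (v (x + of_int 0))" if "x \<in> u" for x
        using v(1)[OF that] unfolding wt_space_def by simp
    qed
    then have "basis_map M v q = 0"
      unfolding q_def using Hom_diff[OF H W, of "act (Omega 0 u) (L 0) p" "pm_scale x p"] Hom_scale[OF H, of p x] k1 less.prems
        Hom_zero[OF witt_act_Hom[OF M] M] by simp
    moreover have "card (Poly_Mapping.keys q) < card (Poly_Mapping.keys p)"
      unfolding kq by (rule card_Diff1_less[OF finite_keys x])
    ultimately have "q = 0" using less.hyps[of q] kq less.prems(1) by blast
    then have "Poly_Mapping.keys p = {x}" using kq x by auto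
    then have "scale M (Poly_Mapping.lookup p x) (v x) = 0" using less.prems(2) unfolding basis_map_def by simp
    moreover have "Poly_Mapping.lookup p x \<noteq> 0" using x by (simp add: in_keys_iff)
    ultimately show False using v(2)[of x] x less.prems(1) by auto
  qed
qed

lemma basis_map_bij:
  assumes M: "M \<in> class_S" and v: "\<And>s. s \<in> Supp M \<Longrightarrow> v s \<noteq> 0" "\<And>s. s \<in> Supp M \<Longrightarrow> wt_space M s = range (\<lambda>c. scale M c (v s))"
  shows "bij_betw (basis_map M v) (vspace (Omega \<delta> (Supp M))) (vspace M)"
proof -
  note W = class_SD(1)[OF M] and u = class_SD(3)[OF M]
  note W' = witt_module_Omega[OF u, of \<delta>]
  interpret vector_space "scale M" by (rule witt_vector_space[OF W])
  have wt: "v s \<in> wt_space M s" if "s \<in> Supp M" for s unfolding v(2)[OF that] by (rule range_eqI[of _ _ 1]) simp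
  have vv: "v x \<in> vspace M" if "x \<in> Supp M" for x using wt[OF that] unfolding wt_space_def by blast
  note H = basis_map_Hom[where \<delta> = \<delta> and u = "Supp M" and v = v, OF W vv]
  let ?I = "basis_map M v ` vspace (Omega \<delta> (Supp M))"
  have inj: "inj_on (basis_map M v) (vspace (Omega \<delta> (Supp M)))"
  proof (rule inj_onI)
    fix p q assume pq: "p \<in> vspace (Omega \<delta> (Supp M))" "q \<in> vspace (Omega \<delta> (Supp M))" "basis_map M v p = basis_map M v q"
    have "basis_map M v (p - q) = 0" using Hom_diff[OF H W' pq(1,2)] pq(3) by simp
    moreover have "Poly_Mapping.keys (p - q) \<subseteq> Supp M" using witt_diff[OF W' pq(1,2)] by simp
    ultimately have "p - q = 0" using basis_map_inj[OF W u wt v(1)] by blast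
    then show "p = q" by simp
  qed
  have "subspace ?I"
    unfolding subspace_def
  proof (intro conjI ballI allI)
    show "0 \<in> ?I" using Hom_zero[OF H W'] witt_zero[OF W'] by (metis image_eqI)
  next
    fix a b assume "a \<in> ?I" "b \<in> ?I"
    then obtain p q where pq: "p \<in> vspace (Omega \<delta> (Supp M))" "q \<in> vspace (Omega \<delta> (Supp M))" "a = basis_map M v p" "b = basis_map M v q" by blast
    then have "a + b = basis_map M v (p + q)" using Hom_add[OF H pq(1,2)] by simp
    then show "a + b \<in> ?I" using witt_add[OF W' pq(1,2)] by blast
  next
    fix c a assume "a \<in> ?I"
    then obtain p where p: "p \<in> vspace (Omega \<delta> (Supp M))" "a = basis_map M v p" by blast
    then have "scale M c a = basis_map M v (pm_scale c p)" using Hom_scale[OF H p(1), of c] by simp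
    moreover have "pm_scale c p \<in> vspace (Omega \<delta> (Supp M))" using witt_scale[OF W' p(1), of c] by simp
    ultimately show "scale M c a \<in> ?I" by blast
  qed
  moreover have "(\<Union>s. wt_space M s) \<subseteq> ?I"
  proof
    fix m assume "m \<in> (\<Union>s. wt_space M s)"
    then obtain s where s: "m \<in> wt_space M s" by blast
    show "m \<in> ?I"
    proof (cases "s \<in> Supp M")
      case True
      then obtain c where c: "m = scale M c (v s)" using s v(2)[OF True] by blast
      have es: "e s \<in> vspace (Omega \<delta> (Supp M))" using True by simp
      have "m = basis_map M v (pm_scale c (e s))" using Hom_scale[OF H es, of c] basis_map_e[OF W, of v s] c by simp
      moreover have "pm_scale c (e s) \<in> vspace (Omega \<delta> (Supp M))" using witt_scale[OF W' es, of c] by simp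
      ultimately show ?thesis by blast
    next
      case False
      then have "m = 0" using s unfolding Supp_def by blast
      then show ?thesis using \<open>subspace ?I\<close> subspace_0 by blast
    qed
  qed
  ultimately have "vspace M \<subseteq> ?I" unfolding class_SD(2)[OF M] by (rule span_minimal[rotated])
  moreover have "?I \<subseteq> vspace M" using Hom_closed[OF H] by blast
  ultimately show ?thesis unfolding bij_betw_def using inj by blast
qed

lemma standard_basis_germ_iso:
  assumes M: "M \<in> class_S" and v: "\<And>s. s \<in> Supp M \<Longrightarrow> v s \<noteq> 0" "\<And>s. s \<in> Supp M \<Longrightarrow> wt_space M s = range (\<lambda>c. scale M c (v s))"
    and act: "\<And>s m. s \<in> Supp M \<Longrightarrow> r \<le> Re s \<Longrightarrow> r \<le> Re (s + of_int m) \<Longrightarrow>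
      act M (L m) (v s) = scale M (of_int m * \<delta> + s) (v (s + of_int m))"
  shows "germ_iso M (Omega \<delta> (Supp M)) \<noteq> {}" "germ_iso (Omega \<delta> (Supp M)) M \<noteq> {}"
proof -
  note W = class_SD(1)[OF M] and u = class_SD(3)[OF M]
  note W' = witt_module_Omega[OF u, of \<delta>]
  interpret vector_space "scale M" by (rule witt_vector_space[OF W])
  have wt: "v s \<in> wt_space M s" if "s \<in> Supp M" for s unfolding v(2)[OF that] by (rule range_eqI[of _ _ 1]) simp
  have vv: "v x \<in> vspace M" if "x \<in> Supp M" for x using wt[OF that] unfolding wt_space_def by blast
  note H = basis_map_Hom[where \<delta> = \<delta> and u = "Supp M" and v = v, OF W vv]
  let ?O = "Omega \<delta> (Supp M)" and ?G = "basis_map M v"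
  have hom0: "(\<lambda>p. act M (L m) (?G p) - ?G (act ?O (L m) p)) \<in> Hom0 ?O M" for m
  proof -
    have "(\<lambda>p. act M (L m) (?G p) - ?G (act ?O (L m) p)) \<in> Hom ?O M"
      using Hom_comb[OF W Hom_comp[OF H witt_act_Hom[OF W]] Hom_comp[OF witt_act_Hom[OF W'] H], of 1 "L m" "-1" "L m"] by simp
    \<comment> \<open>The extra |m| keeps x + m beyond \<open>r\<close> for negative m.\<close>
    moreover have "act M (L m) (?G p) - ?G (act ?O (L m) p) = 0" if p: "p \<in> upper ?O (r + \<bar>real_of_int m\<bar>)" for p
    proof -
      have k: "Poly_Mapping.keys p \<subseteq> Supp M \<inter> {x. r + \<bar>real_of_int m\<bar> \<le> Re x}" using p unfolding upper_Omega[OF u] by blast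
      have "act M (L m) (?G p) = ?G (act ?O (L m) p)"
      proof (rule basis_map_equivariant[OF W u vv _ _ k])
        show "act M (L m) (v x) = scale M (of_int m * \<delta> + x) (v (x + of_int m))"
          if "x \<in> Supp M \<inter> {x. r + \<bar>real_of_int m\<bar> \<le> Re x}" for x
          by (rule act) (use that in auto)
      qed auto
      then show ?thesis by simp
    qed
    ultimately show ?thesis unfolding Hom0_def by blast
  qed
  have GW: "?G \<in> Hom_W ?O M"
    by (rule Hom_W_I[OF W' W H hom0])
  have L0: "?G (act ?O (L 0) p) = act M (L 0) (?G p)" if "p \<in> vspace ?O" for p
  proof (rule basis_map_equivariant[OF W u vv order_refl, symmetric])
    show "act M (L 0) (v x) = scale M (of_int 0 * \<delta> + x) (v (x + of_int 0))" if "x \<in> Supp M" for x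
      using wt[OF that] unfolding wt_space_def by simp
  qed (use that in auto)
  from germ_iso_if_bij[OF W' W GW basis_map_bij[OF M v] L0]
  show "germ_iso M ?O \<noteq> {}" "germ_iso ?O M \<noteq> {}" by blast+
qed

lemma standard_basis_wmod_iso:
  assumes M: "M \<in> class_S" and v: "\<And>s. s \<in> Supp M \<Longrightarrow> v s \<noteq> 0" "\<And>s. s \<in> Supp M \<Longrightarrow> wt_space M s = range (\<lambda>c. scale M c (v s))"
    and act: "\<And>s m. s \<in> Supp M \<Longrightarrow> act M (L m) (v s) = scale M (of_int m * \<delta> + s) (v (s + of_int m))"
  shows "wmod_iso M (Omega \<delta> (Supp M))"
proof -
  note W = class_SD(1)[OF M] and u = class_SD(3)[OF M]
  note W' = witt_module_Omega[OF u, of \<delta>]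
  interpret vector_space "scale M" by (rule witt_vector_space[OF W])
  have vv: "v x \<in> vspace M" if "x \<in> Supp M" for x
    using v(2)[OF that] wt_subset_vspace[of M x] by (metis rangeI scale_one subsetD)
  note H = basis_map_Hom[where \<delta> = \<delta> and u = "Supp M" and v = v, OF W vv]
  let ?O = "Omega \<delta> (Supp M)" and ?G = "basis_map M v"
  have "?G (act ?O X p) = act M X (?G p)" if p: "p \<in> vspace ?O" for X p
  proof -
    have Gp: "?G p \<in> vspace M" by (rule Hom_closed[OF H p])
    have cl: "act ?O X p \<in> vspace ?O" for X by (rule witt_act[OF W' p])
    have Lm: "act M (L m) (?G p) = ?G (act ?O (L m) p)" for m
      by (rule basis_map_equivariant[OF W u vv order_refl act]) (use p in auto)
    have sc: "?G (act ?O (pm_scale c X) p) = act M (pm_scale c X) (?G p)" if "?G (act ?O X p) = act M X (?G p)" for c X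
      using that Hom_scale[OF H cl[of X], of c] unfolding witt_act_scale_left[OF W Gp] act_Omega_scale_left by simp
    have "Poly_Mapping.keys X \<subseteq> UNIV" by simp
    then show ?thesis
    proof (induction X rule: pm_span_induct)
      case zero
      show ?case using sc[OF Lm[symmetric], of 0 0] by simp
    next
      case (single c n)
      show ?case unfolding L_def[symmetric] by (rule sc[OF Lm[symmetric]])
    next
      case (add X Y)
      then show ?case
        using Hom_add[OF H cl[of X] cl[of Y]] unfolding witt_act_add_left[OF W Gp] act_Omega_add_left by simp
    qed
  qed
  then have "wmod_iso ?O M" unfolding wmod_iso_def using H basis_map_bij[OF M v] by blast
  then show ?thesis by (rule wmod_iso_sym[OF W'])
qed

text \<open>If M is isomorphic to some \<open>Omega\<close> of degree outside {0, 1}, this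
  isomorphism is also one of germs. Otherwise the standard basis must have degree 0 or 1, and these
  two degrees differ by a scaling with the weight far to the right.\<close>

lemma germ_iso_Deg:
  assumes M: "M \<in> class_S" and \<delta>: "\<delta> \<in> Deg M"
  shows "germ_iso M (Omega \<delta> (Supp M)) \<noteq> {}" "germ_iso (Omega \<delta> (Supp M)) M \<noteq> {}"
proof -
  note W = class_SD(1)[OF M] and u = class_SD(3)[OF M]
  interpret vector_space "scale M" by (rule witt_vector_space[OF W])
  define D where "D = {\<delta>. \<delta> \<notin> {0, 1} \<and> (\<exists>s\<in>int_cosets. wmod_iso M (Omega \<delta> s))}"
  have Deg: "Deg M = (if D \<noteq> {} then D else {0, 1})" unfolding Deg_def D_def Let_def ..
  have "germ_iso M (Omega \<delta> (Supp M)) \<noteq> {} \<and> germ_iso (Omega \<delta> (Supp M)) M \<noteq> {}"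
  proof (cases "D = {}")
    case False
    then obtain s where s: "s \<in> int_cosets" "wmod_iso M (Omega \<delta> s)" using \<delta> unfolding Deg D_def by auto
    note W' = witt_module_Omega[OF s(1), of \<delta>]
    have S: "Supp M = s" using wmod_iso_Supp[OF W W' s(2)] Supp_Omega by simp
    obtain f where f: "f \<in> Hom M (Omega \<delta> s)" "bij_betw f (vspace M) (vspace (Omega \<delta> s))"
      "\<And>X m. m \<in> vspace M \<Longrightarrow> f (act M X m) = act (Omega \<delta> s) X (f m)"
      using s(2) unfolding wmod_iso_def by blast
    have "f \<in> Hom_W M (Omega \<delta> s)"
    proof (rule Hom_W_I[OF W W' f(1)])
      fix n
      have z: "(\<lambda>m. 0) \<in> Hom0 M (Omega \<delta> s)" unfolding Hom0_def Hom_def by simp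
      show "(\<lambda>m. act (Omega \<delta> s) (L n) (f m) - f (act M (L n) m)) \<in> Hom0 M (Omega \<delta> s)"
        by (rule Hom0_cong[OF z W]) (simp add: f(3))
    qed
    from germ_iso_if_bij[OF W W' this f(2,3)] show ?thesis unfolding S by blast
  next
    case True
    then have \<delta>01: "\<delta> = 0 \<or> \<delta> = 1" using \<delta> unfolding Deg by auto
    obtain \<delta>0 v r where v: "\<And>s. s \<in> Supp M \<Longrightarrow> v s \<noteq> 0" "\<And>s. s \<in> Supp M \<Longrightarrow> wt_space M s = range (\<lambda>c. scale M c (v s))"
      and act: "\<And>s m. s \<in> Supp M \<Longrightarrow> \<delta>0 \<notin> {0, 1} \<or> r \<le> Re s \<and> r \<le> Re (s + of_int m) \<Longrightarrow>
        act M (L m) (v s) = scale M (of_int m * \<delta>0 + s) (v (s + of_int m))"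
      using class_S_standard_basis[OF M] by metis
    have \<delta>0: "\<delta>0 \<in> {0, 1}"
    proof (rule ccontr)
      assume n: "\<delta>0 \<notin> {0, 1}"
      have "wmod_iso M (Omega \<delta>0 (Supp M))" by (rule standard_basis_wmod_iso[OF M v act]) (use n in auto)
      then show False using True n u unfolding D_def by blast
    qed
    \<comment> \<open>This is \<open>op_d\<close> or its inverse in terms of the basis: scaling by s
      or 1 / s exchanges the degrees 0 and 1. The value at s = 0 only has to be nonzero, since the
      bound \<open>max r 1\<close> stays away from it.\<close>
    define k where "k s = (if s = 0 \<or> \<delta> = \<delta>0 then 1 else if \<delta> = 0 then s else 1 / s)" for s :: complex
    have k: "k s \<noteq> 0" for s unfolding k_def by simp
    define w where "w s = scale M (k s) (v s)" for s
    have w1: "w s \<noteq> 0" if "s \<in> Supp M" for s unfolding w_def using v(1)[OF that] k by simp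
    have w2: "wt_space M s = range (\<lambda>c. scale M c (w s))" if "s \<in> Supp M" for s
    proof -
      have 1: "scale M c (v s) = scale M (c / k s) (w s)" for c unfolding w_def using k[of s] by simp
      have 2: "scale M c (w s) = scale M (c * k s) (v s)" for c unfolding w_def by simp
      have "scale M c (v s) \<in> range (\<lambda>c. scale M c (w s))" "scale M c (w s) \<in> range (\<lambda>c. scale M c (v s))" for c
        using rangeI[of "\<lambda>c. scale M c (w s)" "c / k s"] rangeI[of "\<lambda>c. scale M c (v s)" "c * k s"]
        unfolding 1[symmetric] 2[symmetric] by simp_all
      then show ?thesis unfolding v(2)[OF that] by blast
    qed
    have w3: "act M (L m) (w s) = scale M (of_int m * \<delta> + s) (w (s + of_int m))"
      if s: "s \<in> Supp M" "max r 1 \<le> Re s" "max r 1 \<le> Re (s + of_int m)" for s m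
    proof -
      have vs: "v s \<in> vspace M" using v(2)[OF s(1)] wt_subset_vspace[of M s] by (metis rangeI scale_one subsetD)
      have "Re s > 0" "Re (s + of_int m) > 0" using s(2,3) by simp_all
      then have nz: "s \<noteq> 0" "s + of_int m \<noteq> 0" by (metis less_irrefl zero_complex.sel(1))+
      have kk: "k s * (of_int m * \<delta>0 + s) = (of_int m * \<delta> + s) * k (s + of_int m)"
      proof -
        have "(of_int m + s) * (1 / (s + of_int m)) = 1" using nz by (simp add: add.commute)
        then show ?thesis using nz \<delta>01 \<delta>0 unfolding k_def by (auto simp: mult.commute)
      qed
      have "act M (L m) (w s) = scale M (k s * (of_int m * \<delta>0 + s)) (v (s + of_int m))"
        unfolding w_def Hom_scale[OF witt_act_Hom[OF W] vs] using act[OF s(1), of m] s by simp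
      then show ?thesis unfolding kk w_def by simp
    qed
    show ?thesis using standard_basis_germ_iso[OF M w1 w2 w3] by blast
  qed
  then show "germ_iso M (Omega \<delta> (Supp M)) \<noteq> {}" "germ_iso (Omega \<delta> (Supp M)) M \<noteq> {}" by blast+
qed

theorem theorem2:
  fixes M :: "'a::ab_group_add wmod" and N :: "'b::ab_group_add wmod"
    and P :: "'c::ab_group_add wmod" and \<delta>1 \<delta>2 \<gamma> :: complex
  assumes "M \<in> class_S" and "N \<in> class_S" and "P \<in> class_S"
    and "Supp P = Supp M + Supp N"
    and "\<delta>1 \<in> Deg M" and "\<delta>2 \<in> Deg N" and "\<gamma> \<in> Deg P"
  shows
    "({\<delta>1, \<delta>2, \<gamma>} \<subseteq> {0, 1} \<longrightarrow>
        dim_G_W_eq M N P 2 \<and>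
        (\<forall>f\<in>germ_iso M (Omega 0 (Supp M)). \<forall>g\<in>germ_iso N (Omega 0 (Supp N)).
         \<forall>h\<in>germ_iso (Omega 1 (Supp M + Supp N)) P.
           is_basis_G_W M N P
             [bgerm M N P (comp2 h (comp2 id op_P id op_d) f g),
              bgerm M N P (comp2 h (comp2 id op_P op_d id) f g)])) \<and>
     ((\<delta>1, \<delta>2, \<gamma>) \<in> zset_star \<longrightarrow>
        dim_G_W_eq M N P 1 \<and>
        (\<forall>Q. table (\<delta>1, \<delta>2, \<gamma>) Q \<longrightarrow>
          (\<forall>f\<in>germ_iso M (Omega \<delta>1 (Supp M)). \<forall>g\<in>germ_iso N (Omega \<delta>2 (Supp N)).
           \<forall>h\<in>germ_iso (Omega \<gamma> (Supp M + Supp N)) P.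
             is_basis_G_W M N P [bgerm M N P (comp2 h Q f g)]))) \<and>
     (\<not> {\<delta>1, \<delta>2, \<gamma>} \<subseteq> {0, 1} \<and> (\<delta>1, \<delta>2, \<gamma>) \<notin> zset_star \<longrightarrow>
        G_W M N P = {bgerm M N P 0})"
proof -
  let ?u = "Supp M" and ?v = "Supp N"
  note W = class_SD(1)[OF assms(1)] class_SD(1)[OF assms(2)] class_SD(1)[OF assms(3)]
  note u = class_SD(3)[OF assms(1)] and v = class_SD(3)[OF assms(2)]
  note W' = witt_module_Omega[OF u] witt_module_Omega[OF v] witt_module_Omega[OF sum_int_cosets[OF u v]]
  have iso: "\<exists>f. f \<in> germ_iso M (Omega d1 ?u)" "\<exists>g. g \<in> germ_iso N (Omega d2 ?v)" "\<exists>h. h \<in> germ_iso (Omega d3 (?u + ?v)) P"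
    if "d1 \<in> Deg M" "d2 \<in> Deg N" "d3 \<in> Deg P" for d1 d2 d3
    using germ_iso_Deg[OF assms(1) that(1)] germ_iso_Deg[OF assms(2) that(2)] germ_iso_Deg[OF assms(3) that(3)]
    unfolding assms(4) by blast+
  \<comment> \<open>The degrees 0 and 1 occur in \<open>Deg\<close> together, so in (i) the
    identification can use 0, 0, 1 whichever elements of {0, 1} are given.\<close>
  have Deg01: "0 \<in> Deg Q \<and> 1 \<in> Deg Q" if "d \<in> Deg Q" "d \<in> {0, 1}" for d and Q :: "'x::ab_group_add wmod"
    using that unfolding Deg_def Let_def by (auto split: if_splits)
  have tr: "is_basis_G_W M N P (map (bgerm M N P) (map (\<lambda>\<rho>. comp2 h \<rho> f g) \<rho>s))"
    if "f \<in> germ_iso M (Omega d1 ?u)" "g \<in> germ_iso N (Omega d2 ?v)" "h \<in> germ_iso (Omega d3 (?u + ?v)) P"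
      "germ_basis (Omega d1 ?u) (Omega d2 ?v) (Omega d3 (?u + ?v)) \<rho>s" for f g h d1 d2 d3 \<rho>s
    by (rule is_basis_G_W_if_germ_basis[OF W germ_basis_transport[OF W W' that]])
  show ?thesis
  proof (intro conjI impI)
    assume t: "{\<delta>1, \<delta>2, \<gamma>} \<subseteq> {0, 1}"
    show b: "\<forall>f\<in>germ_iso M (Omega 0 ?u). \<forall>g\<in>germ_iso N (Omega 0 ?v). \<forall>h\<in>germ_iso (Omega 1 (?u + ?v)) P.
      is_basis_G_W M N P [bgerm M N P (comp2 h (comp2 id op_P id op_d) f g), bgerm M N P (comp2 h (comp2 id op_P op_d id) f g)]"
      using tr[OF _ _ _ germ_basis_Omega_0_0_1[OF u v]] by simp
    have "0 \<in> Deg M" "0 \<in> Deg N" "1 \<in> Deg P" using Deg01 assms(5-7) t by blast+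
    then show "dim_G_W_eq M N P 2"
      using iso[of 0 0 1] b unfolding dim_G_W_eq_def by (metis length_Cons list.size(3) numeral_2_eq_2)
  next
    assume z: "(\<delta>1, \<delta>2, \<gamma>) \<in> zset_star"
    then have t: "\<not> {\<delta>1, \<delta>2, \<gamma>} \<subseteq> {0, 1}" unfolding zset_star_def by blast
    show b: "\<forall>Q. table (\<delta>1, \<delta>2, \<gamma>) Q \<longrightarrow> (\<forall>f\<in>germ_iso M (Omega \<delta>1 ?u). \<forall>g\<in>germ_iso N (Omega \<delta>2 ?v).
      \<forall>h\<in>germ_iso (Omega \<gamma> (?u + ?v)) P. is_basis_G_W M N P [bgerm M N P (comp2 h Q f g)])"
      using tr[OF _ _ _ germ_basis_Omega_table[OF u v t]] by simp
    then show "dim_G_W_eq M N P 1"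
      using iso[OF assms(5-7)] table_exists[OF z] unfolding dim_G_W_eq_def by (metis length_Cons list.size(3) One_nat_def)
  next
    assume a: "\<not> {\<delta>1, \<delta>2, \<gamma>} \<subseteq> {0, 1} \<and> (\<delta>1, \<delta>2, \<gamma>) \<notin> zset_star"
    \<comment> \<open>As the triple is not contained in {0, 1}, lying outside
      \<open>zset_star\<close> means lying outside \<open>zset\<close>.\<close>
    then have z: "(\<delta>1, \<delta>2, \<gamma>) \<notin> zset" unfolding zset_star_def by blast
    obtain f g h where "f \<in> germ_iso M (Omega \<delta>1 ?u)" "g \<in> germ_iso N (Omega \<delta>2 ?v)" "h \<in> germ_iso (Omega \<gamma> (?u + ?v)) P"
      using iso[OF assms(5-7)] by blast
    \<comment> \<open>An empty basis says that every invariant map lies in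
      \<open>Bil0\<close>.\<close>
    from germ_basis_transport[OF W W' this germ_basis_Omega_empty[OF u v _ z]] a
    have "germ_basis M N P []" by simp
    then have "Inv_W M N P \<subseteq> Bil0 M N P" unfolding germ_basis_def lin_comb_def by (auto simp: fun_diff_def)
    then show "G_W M N P = {bgerm M N P 0}" by (rule G_W_trivial[OF W])
  qed
qed

end
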